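(* Assume $r_is_i^{-1}=q^{2d_i}$ for all $i\in I$, and let $p_{ij}=r^{\langle j,i\rangle}s^{-\langle i,j\rangle}q^{-d_ia_{ij}}$ for $i,j\in I$. Let $\zeta:Q\times Q\to\mathbb K^*$ be the bicharacter with $\zeta(\alpha_i,\alpha_j)=p_{ij}^{1/2}$ for all $i,j\in I$. Then $\zeta$ is a skew bicharacter on $Q$, and, as $Q$-bigraded Hopf algebras, $$U_{q,\zeta}(\mathfrak g)\simeq U_{r,s}(\mathfrak g).$$
   Context: Setting. $\mathfrak g$ is a finite-dimensional simple Lie algebra with Cartan matrix $(a_{ij})_{i,j\in I}$, $I=\{1,\dots,n\}$; $d_i$ are relatively prime positive integers with $d_ia_{ij}=d_ja_{ji}$; $\alpha_i$ are the simple roots, $Q=\bigoplus_i\mathbb Z\alpha_i$, and $\Lambda$ is the weight lattice. $\mathbb K\supseteq\mathbb Q(r,s)$ is a field ($r,s$ indeterminates over $\mathbb Q$) containing $(rs^{-1})^{1/m}$, where $m$ is the smallest positive integer with $m\Lambda\subseteq Q$; $rs^{-1}$ is not a root of unity; $q\in\mathbb K$. $r_i=r^{d_i}$, $s_i=s^{d_i}$, $q_i=q^{d_i}$. The Euler form is the bilinear form on $Q$ with $\langle\alpha_i,\alpha_j\rangle=\langle i,j\rangle=d_ia_{ij}$ if $i<j$, $d_i$ if $i=j$, $0$ if $i>j$. One has $p_{ii}=1$ and $p_{ij}p_{ji}=1$; square roots $p_{ij}^{1/2}\in\mathbb K$ are fixed with $p_{ii}^{1/2}=1$ and $p_{ij}^{1/2}p_{ji}^{1/2}=1$.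 Put $(k)_v=\frac{v^k-1}{v-1}$, $(k)_v!=(1)_v\cdots(k)_v$, $(0)_v!=1$, $\binom{k}{l}_v=\frac{(k)_v!}{(l)_v!(k-l)_v!}$. $U_{r,s}(\mathfrak g)$ is the unital associative $\mathbb K$-algebra generated by $e_i,f_i,\omega_i^{\pm1},\omega_i'^{\pm1}$ ($i\in I$) with relations: $\omega_i^{\pm1}\omega_i^{\mp1}=\omega_i'^{\pm1}\omega_i'^{\mp1}=1$; all $\omega_i,\omega_j'$ commute with each other; $\omega_ie_j=r^{\langle j,i\rangle}s^{-\langle i,j\rangle}e_j\omega_i$, $\omega_i'e_j=r^{-\langle i,j\rangle}s^{\langle j,i\rangle}e_j\omega_i'$, $\omega_if_j=r^{-\langle j,i\rangle}s^{\langle i,j\rangle}f_j\omega_i$, $\omega_i'f_j=r^{\langle i,j\rangle}s^{-\langle j,i\rangle}f_j\omega_i'$; $e_if_j-f_je_i=\delta_{i,j}\frac{\omega_i-\omega_i'}{r_i-s_i}$; and for $i\ne j$, with $c_{ij}^{(k)}=(r_is_i^{-1})^{k(k-1)/2}r^{k\langle j,i\rangle}s^{-k\langle i,j\rangle}$, $\sum_{k=0}^{1-a_{ij}}(-1)^k\binom{1-a_{ij}}{k}_{r_is_i^{-1}}c_{ij}^{(k)}e_i^{1-a_{ij}-k}e_je_i^k=0$, $\ \sum_{k=0}^{1-a_{ij}}(-1)^k\binom{1-a_{ij}}{k}_{r_is_i^{-1}}c_{ij}^{(k)}f_i^kf_jf_i^{1-a_{ij}-k}=0$. It is a Hopf algebra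 with $\omega_i,\omega_i'$ group-like, $\Delta(e_i)=e_i\otimes1+\omega_i\otimes e_i$, $\Delta(f_i)=1\otimes f_i+f_i\otimes\omega_i'$, $\varepsilon(e_i)=\varepsilon(f_i)=0$, $S(e_i)=-\omega_i^{-1}e_i$, $S(f_i)=-f_i\omega_i'^{-1}$. $U_q(\mathfrak g):=U_{q,q^{-1}}(\mathfrak g)$ is the Hopf algebra over $\mathbb K$ obtained from the same presentation with $r,s$ replaced by $q,q^{-1}$; its generators are written $E_i,F_i,K_i^{\pm1},K_i'^{\pm1}$ (in place of $e_i,f_i,\omega_i^{\pm1},\omega_i'^{\pm1}$). Bigradings. For an abelian group $G$, a $G$-bigraded Hopf algebra over $k$ is a Hopf algebra $H$ with a $G\times G$-grading $H=\bigoplus H_{\alpha,\beta}$ such that $k\subseteq H_{0,0}$, $H_{\alpha,\beta}H_{\alpha',\beta'}\subset H_{\alpha+\alpha',\beta+\beta'}$, $\Delta(H_{\alpha,\beta})\subset\sum_{\gamma\in G}H_{\alpha,\gamma}\otimes H_{-\gamma,\beta}$, $\varepsilon(H_{\alpha,\beta})=0$ for $\alpha\ne-\beta$, and $S(H_{\alpha,\beta})\subset H_{\beta,\alpha}$. A skew bicharacter on $G$ is a bicharacter $\zeta:G\times G\to k^*$ with $\zeta(\alpha,\alpha)=1$ and $\zeta(\alpha,\beta)=\zeta(\beta,\alpha)^{-1}$. Given one, $H_\zeta$ denotes the $G$-bigraded Hopf algebra with the same coalgebra, unit and antipode as $H$ and product $a\circ b=\zeta(\alpha,\alpha')\zeta(\beta,\beta')^{-1}ab$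 for $a\in H_{\alpha,\beta}$, $b\in H_{\alpha',\beta'}$. $U_q(\mathfrak g)$ is $Q$-bigraded by $E_i\in(U_q)_{\alpha_i,0}$, $F_i\in(U_q)_{0,-\alpha_i}$, $K_i,K_i'\in(U_q)_{\alpha_i,-\alpha_i}$; $U_{r,s}(\mathfrak g)$ is $Q$-bigraded in the same way with $e_i,f_i,\omega_i,\omega_i'$ of bidegrees $(\alpha_i,0),(0,-\alpha_i),(\alpha_i,-\alpha_i),(\alpha_i,-\alpha_i)$. $U_{q,\zeta}(\mathfrak g)$ is the deformation $(U_q(\mathfrak g))_\zeta$. *)

theory Defs
  imports
    "HOL-Algebra.Module"
    "HOL-Algebra.Ideal"
    "HOL-Algebra.Algebraic_Closure_Type"
    "HOL-Computational_Algebra.Polynomial"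
    "HOL-Library.Poly_Mapping"
begin

section \<open>Formal linear combinations and tensor powers\<close>

text \<open>An element of \<^typ>\<open>'x \<Rightarrow>\<^sub>0 'k\<close> is a formal linear combination of elements of \<^typ>\<open>'x\<close>.\<close>

definition scale_comb :: "'k::field \<Rightarrow> ('x \<Rightarrow>\<^sub>0 'k) \<Rightarrow> ('x \<Rightarrow>\<^sub>0 'k)" where
  "scale_comb c t = Poly_Mapping.map ((*) c) t"

abbreviation pure :: "'x \<Rightarrow> ('x \<Rightarrow>\<^sub>0 'k::field)" where
  "pure x \<equiv> Poly_Mapping.single x 1"

definition lin_ext :: "('x \<Rightarrow> ('y \<Rightarrow>\<^sub>0 'k::field)) \<Rightarrow> ('x \<Rightarrow>\<^sub>0 'k) \<Rightarrow> ('y \<Rightarrow>\<^sub>0 'k)" where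
  "lin_ext f t = (\<Sum>x\<in>Poly_Mapping.keys t. scale_comb (Poly_Mapping.lookup t x) (f x))"

definition comb_span :: "('x \<Rightarrow>\<^sub>0 'k::field) set \<Rightarrow> ('x \<Rightarrow>\<^sub>0 'k) set" where
  "comb_span = Modules.module.span scale_comb"

text \<open>
  Elements of $H \otimes H$ and $H \otimes H \otimes H$ are represented by formal linear
  combinations of pairs and triples from the carrier; a combination represents $0$ iff it lies
  in the span of the multilinearity relations.
\<close>

definition tensor_null :: "('k::field, 'h, 'm) module_scheme \<Rightarrow> ('h \<times> 'h \<Rightarrow>\<^sub>0 'k) set" where
  "tensor_null H = comb_span
     ({pure (x \<oplus>\<^bsub>H\<^esub> y, z) - pure (x, z) - pure (y, z) | x y z.
         x \<in> carrier H \<and> y \<in> carrier H \<and> z \<in> carrier H}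
    \<union> {pure (z, x \<oplus>\<^bsub>H\<^esub> y) - pure (z, x) - pure (z, y) | x y z.
         x \<in> carrier H \<and> y \<in> carrier H \<and> z \<in> carrier H}
    \<union> {pure (c \<odot>\<^bsub>H\<^esub> x, z) - scale_comb c (pure (x, z)) | c x z.
         x \<in> carrier H \<and> z \<in> carrier H}
    \<union> {pure (z, c \<odot>\<^bsub>H\<^esub> x) - scale_comb c (pure (z, x)) | c x z.
         x \<in> carrier H \<and> z \<in> carrier H})"

definition tensor3_null :: "('k::field, 'h, 'm) module_scheme \<Rightarrow> ('h \<times> 'h \<times> 'h \<Rightarrow>\<^sub>0 'k) set" where
  "tensor3_null H = comb_span
     ({lin_ext (\<lambda>(x, y). pure (x, y, z)) t | t z. t \<in> tensor_null H \<and> z \<in> carrier H}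
    \<union> {lin_ext (\<lambda>(y, z). pure (x, y, z)) t | t x. t \<in> tensor_null H \<and> x \<in> carrier H})"

definition tensor_eq ::
  "('k::field, 'h, 'm) module_scheme \<Rightarrow> ('h \<times> 'h \<Rightarrow>\<^sub>0 'k) \<Rightarrow> ('h \<times> 'h \<Rightarrow>\<^sub>0 'k) \<Rightarrow> bool" where
  "tensor_eq H t u \<longleftrightarrow> t - u \<in> tensor_null H"

definition tensor3_eq ::
  "('k::field, 'h, 'm) module_scheme \<Rightarrow> ('h \<times> 'h \<times> 'h \<Rightarrow>\<^sub>0 'k) \<Rightarrow> ('h \<times> 'h \<times> 'h \<Rightarrow>\<^sub>0 'k) \<Rightarrow> bool" where
  "tensor3_eq H t u \<longleftrightarrow> t - u \<in> tensor3_null H"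

definition tensor_mult ::
  "('k::field, 'h, 'm) module_scheme \<Rightarrow> ('h \<times> 'h \<Rightarrow>\<^sub>0 'k) \<Rightarrow> ('h \<times> 'h \<Rightarrow>\<^sub>0 'k) \<Rightarrow> ('h \<times> 'h \<Rightarrow>\<^sub>0 'k)" where
  "tensor_mult H t u =
     lin_ext (\<lambda>(x, y). lin_ext (\<lambda>(x', y'). pure (x \<otimes>\<^bsub>H\<^esub> x', y \<otimes>\<^bsub>H\<^esub> y')) u) t"

definition comb_eval ::
  "('k::field, 'h, 'm) module_scheme \<Rightarrow> ('x \<Rightarrow> 'h) \<Rightarrow> ('x \<Rightarrow>\<^sub>0 'k) \<Rightarrow> 'h" where
  "comb_eval H f t = (\<Oplus>\<^bsub>H\<^esub>x\<in>Poly_Mapping.keys t. Poly_Mapping.lookup t x \<odot>\<^bsub>H\<^esub> f x)"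


section \<open>Bigraded Hopf algebras\<close>

text \<open>
  The comultiplication returns a representative of an element of $H \otimes H$; only its class
  modulo \<^const>\<open>tensor_eq\<close> is meaningful.  \<open>component (\<alpha>, \<beta>)\<close> is $H_{\alpha,\beta}$.
\<close>

record (overloaded) ('k::zero, 'h, 'g) bihopf = "('k, 'h) module" +
  comult :: "'h \<Rightarrow> ('h \<times> 'h \<Rightarrow>\<^sub>0 'k)"
  counit :: "'h \<Rightarrow> 'k"
  antipode :: "'h \<Rightarrow> 'h"
  component :: "'g \<times> 'g \<Rightarrow> 'h set"

locale assoc_algebra =
  fixes H :: "('k::field, 'h, 'm) module_scheme" (structure)
  assumes module: "Module.module (ring_of_type_algebra :: 'k ring) H"
    and ring: "Ring.ring H"
    and smult_mult_left: "x \<in> carrier H \<Longrightarrow> y \<in> carrier H \<Longrightarrow> (c \<odot> x) \<otimes> y = c \<odot> (x \<otimes> y)"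
    and smult_mult_right: "x \<in> carrier H \<Longrightarrow> y \<in> carrier H \<Longrightarrow> x \<otimes> (c \<odot> y) = c \<odot> (x \<otimes> y)"

locale hopf_algebra = assoc_algebra H
  for H :: "('k::field, 'h, 'g) bihopf" (structure) +
  assumes comult_closed: "x \<in> carrier H \<Longrightarrow>
        Poly_Mapping.keys (comult H x) \<subseteq> carrier H \<times> carrier H"
    and comult_add: "x \<in> carrier H \<Longrightarrow> y \<in> carrier H \<Longrightarrow>
        tensor_eq H (comult H (x \<oplus> y)) (comult H x + comult H y)"
    and comult_smult: "x \<in> carrier H \<Longrightarrow>
        tensor_eq H (comult H (c \<odot> x)) (scale_comb c (comult H x))"
    and comult_mult: "x \<in> carrier H \<Longrightarrow> y \<in> carrier H \<Longrightarrow>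
        tensor_eq H (comult H (x \<otimes> y)) (tensor_mult H (comult H x) (comult H y))"
    and comult_one: "tensor_eq H (comult H \<one>) (pure (\<one>, \<one>))"
    and coassoc: "x \<in> carrier H \<Longrightarrow>
        tensor3_eq H
          (lin_ext (\<lambda>(y, z). lin_ext (\<lambda>(y1, y2). pure (y1, y2, z)) (comult H y)) (comult H x))
          (lin_ext (\<lambda>(y, z). lin_ext (\<lambda>(z1, z2). pure (y, z1, z2)) (comult H z)) (comult H x))"
    and counit_add: "x \<in> carrier H \<Longrightarrow> y \<in> carrier H \<Longrightarrow>
        counit H (x \<oplus> y) = counit H x + counit H y"
    and counit_smult: "x \<in> carrier H \<Longrightarrow> counit H (c \<odot> x) = c * counit H x"
    and counit_mult: "x \<in> carrier H \<Longrightarrow> y \<in> carrier H \<Longrightarrow>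
        counit H (x \<otimes> y) = counit H x * counit H y"
    and counit_one: "counit H \<one> = 1"
    and counit_left: "x \<in> carrier H \<Longrightarrow>
        comb_eval H (\<lambda>(y, z). counit H y \<odot> z) (comult H x) = x"
    and counit_right: "x \<in> carrier H \<Longrightarrow>
        comb_eval H (\<lambda>(y, z). counit H z \<odot> y) (comult H x) = x"
    and antipode_closed: "x \<in> carrier H \<Longrightarrow> antipode H x \<in> carrier H"
    and antipode_add: "x \<in> carrier H \<Longrightarrow> y \<in> carrier H \<Longrightarrow>
        antipode H (x \<oplus> y) = antipode H x \<oplus> antipode H y"
    and antipode_smult: "x \<in> carrier H \<Longrightarrow> antipode H (c \<odot> x) = c \<odot> antipode H x"
    and antipode_left: "x \<in> carrier H \<Longrightarrow>
        comb_eval H (\<lambda>(y, z). antipode H y \<otimes> z) (comult H x) = counit H x \<odot> \<one>"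
    and antipode_right: "x \<in> carrier H \<Longrightarrow>
        comb_eval H (\<lambda>(y, z). y \<otimes> antipode H z) (comult H x) = counit H x \<odot> \<one>"

definition homogeneous_decomposition ::
  "('k::field, 'h, 'g) bihopf \<Rightarrow> 'h \<Rightarrow> ('g \<times> 'g \<Rightarrow> 'h) \<Rightarrow> bool" where
  "homogeneous_decomposition H x f \<longleftrightarrow>
     (\<forall>p. f p \<in> component H p) \<and> finite {p. f p \<noteq> \<zero>\<^bsub>H\<^esub>} \<and>
     x = (\<Oplus>\<^bsub>H\<^esub>p\<in>{p. f p \<noteq> \<zero>\<^bsub>H\<^esub>}. f p)"

locale bigraded_hopf_algebra = hopf_algebra H
  for H :: "('k::field, 'h, 'g::ab_group_add) bihopf" (structure) +
  assumes component_submodule: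
        "submodule (component H p) (ring_of_type_algebra :: 'k ring) H"
    and direct_sum: "x \<in> carrier H \<Longrightarrow> \<exists>!f. homogeneous_decomposition H x f"
    and scalar_degree: "c \<odot> \<one> \<in> component H (0, 0)"
    and mult_degree: "x \<in> component H (\<alpha>, \<beta>) \<Longrightarrow> y \<in> component H (\<alpha>', \<beta>') \<Longrightarrow>
        x \<otimes> y \<in> component H (\<alpha> + \<alpha>', \<beta> + \<beta>')"
    and comult_degree: "x \<in> component H (\<alpha>, \<beta>) \<Longrightarrow>
        \<exists>t. tensor_eq H (comult H x) t \<and>
            Poly_Mapping.keys t \<subseteq> (\<Union>\<gamma>. component H (\<alpha>, \<gamma>) \<times> component H (- \<gamma>, \<beta>))"
    and counit_degree: "x \<in> component H (\<alpha>, \<beta>) \<Longrightarrow> \<alpha> \<noteq> - \<beta> \<Longrightarrow> counit H x = 0"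
    and antipode_degree: "x \<in> component H (\<alpha>, \<beta>) \<Longrightarrow> antipode H x \<in> component H (\<beta>, \<alpha>)"

definition bigraded_hopf_iso ::
  "('k::field, 'h, 'g::ab_group_add) bihopf \<Rightarrow> ('k, 'l, 'g) bihopf \<Rightarrow> ('h \<Rightarrow> 'l) \<Rightarrow> bool" where
  "bigraded_hopf_iso A B \<phi> \<longleftrightarrow>
     bigraded_hopf_algebra A \<and> bigraded_hopf_algebra B \<and>
     bij_betw \<phi> (carrier A) (carrier B) \<and>
     \<phi> \<in> ring_hom A B \<and>
     (\<forall>c. \<forall>x\<in>carrier A. \<phi> (c \<odot>\<^bsub>A\<^esub> x) = c \<odot>\<^bsub>B\<^esub> \<phi> x) \<and>
     (\<forall>x\<in>carrier A. tensor_eq B (comult B (\<phi> x))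
        (lin_ext (\<lambda>(y, z). pure (\<phi> y, \<phi> z)) (comult A x))) \<and>
     (\<forall>x\<in>carrier A. counit B (\<phi> x) = counit A x) \<and>
     (\<forall>x\<in>carrier A. antipode B (\<phi> x) = \<phi> (antipode A x)) \<and>
     (\<forall>p. \<phi> ` component A p = component B p)"

definition bigraded_hopf_isomorphic ::
  "('k::field, 'h, 'g::ab_group_add) bihopf \<Rightarrow> ('k, 'l, 'g) bihopf \<Rightarrow> bool" (infix \<open>\<simeq>\<^sub>H\<close> 50) where
  "A \<simeq>\<^sub>H B \<longleftrightarrow> (\<exists>\<phi>. bigraded_hopf_iso A B \<phi>)"


section \<open>Skew bicharacters and the deformed product\<close>

definition bicharacter :: "('g::ab_group_add \<Rightarrow> 'g \<Rightarrow> 'k::field) \<Rightarrow> bool" where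
  "bicharacter \<zeta> \<longleftrightarrow>
     (\<forall>\<alpha> \<beta>. \<zeta> \<alpha> \<beta> \<noteq> 0) \<and>
     (\<forall>\<alpha> \<alpha>' \<beta>. \<zeta> (\<alpha> + \<alpha>') \<beta> = \<zeta> \<alpha> \<beta> * \<zeta> \<alpha>' \<beta>) \<and>
     (\<forall>\<alpha> \<beta> \<beta>'. \<zeta> \<alpha> (\<beta> + \<beta>') = \<zeta> \<alpha> \<beta> * \<zeta> \<alpha> \<beta>')"

definition skew_bicharacter :: "('g::ab_group_add \<Rightarrow> 'g \<Rightarrow> 'k::field) \<Rightarrow> bool" where
  "skew_bicharacter \<zeta> \<longleftrightarrow>
     bicharacter \<zeta> \<and> (\<forall>\<alpha>. \<zeta> \<alpha> \<alpha> = 1) \<and> (\<forall>\<alpha> \<beta>. \<zeta> \<alpha> \<beta> = inverse (\<zeta> \<beta> \<alpha>))"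

definition homogeneous_part ::
  "('k::field, 'h, 'g) bihopf \<Rightarrow> 'h \<Rightarrow> ('g \<times> 'g \<Rightarrow> 'h)" where
  "homogeneous_part H x = (THE f. homogeneous_decomposition H x f)"

text \<open>The bilinear extension of
  $a \circ b = \zeta(\alpha,\alpha')\,\zeta(\beta,\beta')^{-1}\,ab$ from homogeneous elements.\<close>

definition deformed_mult ::
  "('k::field, 'h, 'g) bihopf \<Rightarrow> ('g \<Rightarrow> 'g \<Rightarrow> 'k) \<Rightarrow> 'h \<Rightarrow> 'h \<Rightarrow> 'h" where
  "deformed_mult H \<zeta> a b =
     (\<Oplus>\<^bsub>H\<^esub>p\<in>{p. homogeneous_part H a p \<noteq> \<zero>\<^bsub>H\<^esub>}.
      \<Oplus>\<^bsub>H\<^esub>p'\<in>{p'. homogeneous_part H b p' \<noteq> \<zero>\<^bsub>H\<^esub>}.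
        (\<zeta> (fst p) (fst p') * inverse (\<zeta> (snd p) (snd p'))) \<odot>\<^bsub>H\<^esub>
          (homogeneous_part H a p \<otimes>\<^bsub>H\<^esub> homogeneous_part H b p'))"

definition deform ::
  "('k::field, 'h, 'g) bihopf \<Rightarrow> ('g \<Rightarrow> 'g \<Rightarrow> 'k) \<Rightarrow> ('k, 'h, 'g) bihopf" where
  "deform H \<zeta> = H\<lparr>monoid.mult := deformed_mult H \<zeta>\<rparr>"


section \<open>Presentations by generators and relations\<close>

text \<open>The free monoid, written additively, so that \<open>'x word \<Rightarrow>\<^sub>0 'k\<close> with the convolution
  product of \<^theory>\<open>HOL-Library.Poly_Mapping\<close> is the free associative algebra.\<close>

datatype 'x word = Word (letters: "'x list")

instantiation word :: (type) monoid_add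
begin

definition zero_word :: "'a word" where
  "0 = Word []"

definition plus_word :: "'a word \<Rightarrow> 'a word \<Rightarrow> 'a word" where
  "v + w = Word (letters v @ letters w)"

instance
  by standard (simp_all add: zero_word_def plus_word_def)

end

type_synonym ('x, 'k) free_algebra = "'x word \<Rightarrow>\<^sub>0 'k"

definition gen :: "'x \<Rightarrow> ('x, 'k::field) free_algebra" where
  "gen x = pure (Word [x])"

definition const :: "'k \<Rightarrow> ('x, 'k::field) free_algebra" where
  "const c = Poly_Mapping.single 0 c"

definition free_eval ::
  "('k::field, 'h, 'm) module_scheme \<Rightarrow> ('x \<Rightarrow> 'h) \<Rightarrow> ('x, 'k) free_algebra \<Rightarrow> 'h" where
  "free_eval H g = comb_eval H (\<lambda>w. foldr (\<lambda>x y. g x \<otimes>\<^bsub>H\<^esub> y) (letters w) \<one>\<^bsub>H\<^esub>)"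

text \<open>\<open>R\<close> is a set of equations between elements of the free algebra.\<close>

definition presented_by ::
  "('k::field, 'h, 'm) module_scheme \<Rightarrow> ('x \<Rightarrow> 'h) \<Rightarrow>
     (('x, 'k) free_algebra \<times> ('x, 'k) free_algebra) set \<Rightarrow> bool" where
  "presented_by H g R \<longleftrightarrow>
     assoc_algebra H \<and> range g \<subseteq> carrier H \<and>
     range (free_eval H g) = carrier H \<and>
     {t. free_eval H g t = \<zero>\<^bsub>H\<^esub>} =
       Idl\<^bsub>ring_of_type_algebra :: ('x, 'k) free_algebra ring\<^esub> {t - u | t u. (t, u) \<in> R}"


section \<open>Cartan data\<close>

text \<open>
  The index set $I = \{1, \dots, n\}$ is a type of class \<^class>\<open>finite\<close> and \<^class>\<open>linorder\<close>;
  only its order enters.  The Cartan matrices of the finite-dimensional simple Lie algebras are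
  exactly the indecomposable Cartan matrices of finite type.
\<close>

definition simple_cartan_matrix :: "('i::finite \<Rightarrow> 'i \<Rightarrow> int) \<Rightarrow> bool" where
  "simple_cartan_matrix a \<longleftrightarrow>
     (\<forall>i. a i i = 2) \<and>
     (\<forall>i j. i \<noteq> j \<longrightarrow> a i j \<le> 0) \<and>
     (\<forall>i j. a i j = 0 \<longrightarrow> a j i = 0) \<and>
     (\<forall>J. J \<noteq> {} \<and> J \<noteq> UNIV \<longrightarrow> (\<exists>i\<in>J. \<exists>j\<in>- J. a i j \<noteq> 0)) \<and>
     (\<exists>D :: 'i \<Rightarrow> real. (\<forall>i. D i > 0) \<and>
        (\<forall>i j. D i * of_int (a i j) = D j * of_int (a j i)) \<and>
        (\<forall>x :: 'i \<Rightarrow> real. x \<noteq> (\<lambda>_. 0) \<longrightarrow>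
           (\<Sum>i\<in>UNIV. \<Sum>j\<in>UNIV. x i * D i * of_int (a i j) * x j) > 0))"

definition symmetrizer :: "('i::finite \<Rightarrow> 'i \<Rightarrow> int) \<Rightarrow> ('i \<Rightarrow> nat) \<Rightarrow> bool" where
  "symmetrizer a d \<longleftrightarrow>
     (\<forall>i. d i > 0) \<and> Gcd (range d) = 1 \<and> (\<forall>i j. int (d i) * a i j = int (d j) * a j i)"

type_synonym 'i root_lattice = "'i \<Rightarrow>\<^sub>0 int"

abbreviation simple_root :: "'i \<Rightarrow> 'i root_lattice" where
  "simple_root i \<equiv> Poly_Mapping.single i 1"

text \<open>The function \<open>c\<close> stands for $\lambda = \sum_j c_j \alpha_j$, for which
  $\langle \lambda, \alpha_i^\vee \rangle = \sum_j a_{ij} c_j$.\<close>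

definition weight_lattice :: "('i::finite \<Rightarrow> 'i \<Rightarrow> int) \<Rightarrow> ('i \<Rightarrow> rat) set" where
  "weight_lattice a = {c. \<forall>i. (\<Sum>j\<in>UNIV. of_int (a i j) * c j) \<in> \<int>}"

definition weight_exponent :: "('i::finite \<Rightarrow> 'i \<Rightarrow> int) \<Rightarrow> nat" where
  "weight_exponent a =
     (LEAST m. m > 0 \<and> (\<forall>c\<in>weight_lattice a. \<forall>i. of_nat m * c i \<in> \<int>))"

definition euler :: "('i::linorder \<Rightarrow> 'i \<Rightarrow> int) \<Rightarrow> ('i \<Rightarrow> nat) \<Rightarrow> 'i \<Rightarrow> 'i \<Rightarrow> int" where
  "euler a d i j = (if i < j then int (d i) * a i j else if i = j then int (d i) else 0)"

definition alg_independent_over_rat :: "'k::field_char_0 \<Rightarrow> 'k \<Rightarrow> bool" where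
  "alg_independent_over_rat r s \<longleftrightarrow>
     (\<forall>P :: rat poly poly.
        poly (map_poly (\<lambda>c. poly (map_poly of_rat c) r) P) s = 0 \<longrightarrow> P = 0)"


section \<open>Two-parameter quantum groups\<close>

definition qnum :: "'k::field \<Rightarrow> nat \<Rightarrow> 'k" where
  "qnum v k = (v ^ k - 1) / (v - 1)"

definition qfact :: "'k::field \<Rightarrow> nat \<Rightarrow> 'k" where
  "qfact v k = (\<Prod>l=1..k. qnum v l)"

definition qbinom :: "'k::field \<Rightarrow> nat \<Rightarrow> nat \<Rightarrow> 'k" where
  "qbinom v k l = qfact v k / (qfact v l * qfact v (k - l))"

text \<open>\<open>Om i\<close> and \<open>Om' i\<close> are $\omega_i$ and $\omega_i'$, \<open>OmI i\<close> and \<open>OmI' i\<close> their inverses.\<close>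

datatype 'i qgen = E 'i | F 'i | Om 'i | OmI 'i | Om' 'i | OmI' 'i

definition serre_coeff ::
  "('i::linorder \<Rightarrow> 'i \<Rightarrow> int) \<Rightarrow> ('i \<Rightarrow> nat) \<Rightarrow> 'k::field \<Rightarrow> 'k \<Rightarrow> 'i \<Rightarrow> 'i \<Rightarrow> nat \<Rightarrow> 'k" where
  "serre_coeff a d r s i j k =
     (-1) ^ k * qbinom (r ^ d i / s ^ d i) (nat (1 - a i j)) k *
     ((r ^ d i / s ^ d i) ^ (k * (k - 1) div 2) *
       (r powi (int k * euler a d j i)) * (s powi (- int k * euler a d i j)))"

definition qgroup_relations ::
  "('i::linorder \<Rightarrow> 'i \<Rightarrow> int) \<Rightarrow> ('i \<Rightarrow> nat) \<Rightarrow> 'k::field \<Rightarrow> 'k \<Rightarrow>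
     (('i qgen, 'k) free_algebra \<times> ('i qgen, 'k) free_algebra) set" where
  "qgroup_relations a d r s =
     (\<Union>i. {(gen (Om i) * gen (OmI i), 1), (gen (OmI i) * gen (Om i), 1),
           (gen (Om' i) * gen (OmI' i), 1), (gen (OmI' i) * gen (Om' i), 1)}) \<union>
     {(gen x * gen y, gen y * gen x) | x y. x \<in> range Om \<union> range Om' \<and> y \<in> range Om \<union> range Om'} \<union>
     (\<Union>i j.
       {(gen (Om i) * gen (E j),
           const (r powi (euler a d j i) * s powi (- euler a d i j)) * gen (E j) * gen (Om i)),
        (gen (Om' i) * gen (E j),
           const (r powi (- euler a d i j) * s powi (euler a d j i)) * gen (E j) * gen (Om' i)),
        (gen (Om i) * gen (F j),
           const (r powi (- euler a d j i) * s powi (euler a d i j)) * gen (F j) * gen (Om i)),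
        (gen (Om' i) * gen (F j),
           const (r powi (euler a d i j) * s powi (- euler a d j i)) * gen (F j) * gen (Om' i)),
        (gen (E i) * gen (F j) - gen (F j) * gen (E i),
           if i = j then const (1 / (r ^ d i - s ^ d i)) * (gen (Om i) - gen (Om' i)) else 0)}) \<union>
     {(\<Sum>k\<le>nat (1 - a i j). const (serre_coeff a d r s i j k) *
          gen (E i) ^ (nat (1 - a i j) - k) * gen (E j) * gen (E i) ^ k, 0) | i j. i \<noteq> j} \<union>
     {(\<Sum>k\<le>nat (1 - a i j). const (serre_coeff a d r s i j k) *
          gen (F i) ^ k * gen (F j) * gen (F i) ^ (nat (1 - a i j) - k), 0) | i j. i \<noteq> j}"

text \<open>\<open>is_qgroup a d r s U g\<close>: the $Q$-bigraded Hopf algebra \<open>U\<close> is $U_{r,s}(\mathfrak g)$,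
  with \<open>g\<close> naming its generators.\<close>

definition is_qgroup ::
  "('i::{finite,linorder} \<Rightarrow> 'i \<Rightarrow> int) \<Rightarrow> ('i \<Rightarrow> nat) \<Rightarrow> 'k::field \<Rightarrow> 'k \<Rightarrow>
     ('k, 'h, 'i root_lattice) bihopf \<Rightarrow> ('i qgen \<Rightarrow> 'h) \<Rightarrow> bool" where
  "is_qgroup a d r s U g \<longleftrightarrow>
     bigraded_hopf_algebra U \<and>
     presented_by U g (qgroup_relations a d r s) \<and>
     (\<forall>i.
        tensor_eq U (comult U (g (Om i))) (pure (g (Om i), g (Om i))) \<and>
        tensor_eq U (comult U (g (Om' i))) (pure (g (Om' i), g (Om' i))) \<and>
        tensor_eq U (comult U (g (E i))) (pure (g (E i), \<one>\<^bsub>U\<^esub>) + pure (g (Om i), g (E i))) \<and>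
        tensor_eq U (comult U (g (F i))) (pure (\<one>\<^bsub>U\<^esub>, g (F i)) + pure (g (F i), g (Om' i))) \<and>
        counit U (g (Om i)) = 1 \<and> counit U (g (Om' i)) = 1 \<and>
        counit U (g (E i)) = 0 \<and> counit U (g (F i)) = 0 \<and>
        antipode U (g (E i)) = \<ominus>\<^bsub>U\<^esub> (g (OmI i) \<otimes>\<^bsub>U\<^esub> g (E i)) \<and>
        antipode U (g (F i)) = \<ominus>\<^bsub>U\<^esub> (g (F i) \<otimes>\<^bsub>U\<^esub> g (OmI' i))) \<and>
     (\<forall>i.
        g (E i) \<in> component U (simple_root i, 0) \<and>
        g (F i) \<in> component U (0, - simple_root i) \<and>
        g (Om i) \<in> component U (simple_root i, - simple_root i) \<and>
        g (Om' i) \<in> component U (simple_root i, - simple_root i))"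

end

theory Submission
  imports Defs "HOL-Library.Product_Plus"
begin

text \<open>In the deformed algebra two homogeneous generators $x$, $y$ multiply to a scalar multiple of
  $xy$, so exchanging them costs the square of a value of $\zeta$.  On simple roots this square is
  $p_{ij}$, which is the quotient of the exchange factors of $U_{r,s}(\mathfrak g)$ and of
  $U_q(\mathfrak g)$.  Hence the generators of $U_{q,\zeta}(\mathfrak g)$ obey the relations of
  $U_{r,s}(\mathfrak g)$: the Serre relations are homogeneous, so that all their monomials are
  corrected coherently, and the relation for $e_if_i - f_ie_i$ is repaired by multiplying $F_i$ by
  $(q_i - q_i^{-1}) / (r_i - s_i)$.

  This gives a surjection from $U_{r,s}(\mathfrak g)$, and it is injective for a formal reason.
  Evaluating a noncommutative polynomial in the deformed algebra amounts to evaluating it in the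
  original algebra after each word has been multiplied by a nonzero scalar
  (\<open>free_eval_deform\<close>).  The inverse scalars are those belonging to $\zeta^{-1}$, and the pairs
  $(q, q^{-1})$ and $(r, s)$ enter symmetrically.  So each of the two ideals of relations is carried
  into the other one, and the two evaluation maps have the same kernel (\<open>kernel_twist\<close>).

  Algebras that are quotients of the free algebra by the same kernel are isomorphic, and the rest
  of the structure follows (\<open>isomorphic\<close>).  A homogeneous component is the image of the words
  of that degree.  The comultiplication and the counit are multiplicative, so it is enough to compare
  them on generators, where inverses of generators come for free.  The antipode is the convolution
  inverse of the identity and therefore determined by everything else.

  It also has to be shown that the deformation is a bigraded Hopf algebra
  (\<open>bigraded_hopf_algebra_deform\<close>).  On the term of degree $(\alpha,\gamma) \otimes (-\gamma,\beta)$ of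
  a coproduct the scalars depending on $\gamma$ cancel, and the remaining ones do not depend on the term.
  Tensors are given here by representatives; they are compared by applying bilinear forms
  (\<open>tensor_eq_forms\<close>), so that a computation with iterated coproducts becomes a
  computation with nested sums of scalars.\<close>

section \<open>Linear functionals on formal linear combinations\<close>

text \<open>The linear functional with values \<open>f\<close> on the basis.  For $t = \Delta(x)$ it is the scalar
  usually written $\sum f(x_{(1)}, x_{(2)})$.\<close>

definition pairing :: "('x \<Rightarrow> 'k) \<Rightarrow> ('x \<Rightarrow>\<^sub>0 'k::field) \<Rightarrow> 'k" where
  "pairing f t = (\<Sum>x\<in>Poly_Mapping.keys t. Poly_Mapping.lookup t x * f x)"

lemma lookup_scale_comb [simp]:
  "Poly_Mapping.lookup (scale_comb c t) x = c * Poly_Mapping.lookup t x"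
  by (simp add: scale_comb_def Poly_Mapping.map.rep_eq when_def)

lemma keys_scale_comb: "Poly_Mapping.keys (scale_comb c t) \<subseteq> Poly_Mapping.keys t"
  by (auto simp: in_keys_iff)

interpretation comb: vector_space "scale_comb :: 'k::field \<Rightarrow> ('x \<Rightarrow>\<^sub>0 'k) \<Rightarrow> ('x \<Rightarrow>\<^sub>0 'k)"
  by unfold_locales
    (rule poly_mapping_eqI, simp only: lookup_scale_comb lookup_add distrib_left distrib_right mult.assoc mult_1)+

lemma pairing_superset:
  assumes "finite A" "Poly_Mapping.keys t \<subseteq> A"
  shows "pairing f t = (\<Sum>x\<in>A. Poly_Mapping.lookup t x * f x)"
  unfolding pairing_def
  by (rule sum.mono_neutral_left) (use assms in \<open>auto simp: in_keys_iff\<close>)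

lemma pairing_zero [simp]: "pairing f 0 = 0"
  by (simp add: pairing_def)

lemma pairing_add: "pairing f (t + u) = pairing f t + pairing f u"
proof -
  let ?A = "Poly_Mapping.keys t \<union> Poly_Mapping.keys u"
  have "Poly_Mapping.keys (t + u) \<subseteq> ?A"
    by (rule Poly_Mapping.keys_add)
  then show ?thesis
    by (simp add: pairing_superset[of ?A] lookup_add sum.distrib distrib_right)
qed

lemma pairing_scale: "pairing f (scale_comb c t) = c * pairing f t"
  using pairing_superset[OF _ keys_scale_comb, of t f c]
  by (simp add: pairing_def sum_distrib_left mult.assoc mult.left_commute)

lemma pairing_single [simp]: "pairing f (Poly_Mapping.single x c) = c * f x"
  by (cases "c = 0") (auto simp: pairing_def)

lemma pairing_uminus: "pairing f (- t) = - pairing f t"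
  by (rule minus_unique[symmetric]) (simp flip: pairing_add)

lemma pairing_diff: "pairing f (t - u) = pairing f t - pairing f u"
  using pairing_add[of f t "- u"] by (simp add: pairing_uminus)

lemma pairing_sum: "pairing f (\<Sum>i\<in>I. t i) = (\<Sum>i\<in>I. pairing f (t i))"
  by (induction I rule: infinite_finite_induct) (auto simp: pairing_add)

text \<open>Products and iterated coproducts of tensors are nested applications of \<^const>\<open>lin_ext\<close>; this
  rule turns them into nested sums of scalars.\<close>

lemma pairing_lin_ext: "pairing f (lin_ext G t) = pairing (\<lambda>x. pairing f (G x)) t"
  by (simp add: lin_ext_def pairing_sum pairing_scale) (simp add: pairing_def)

lemma pairing_fun_add: "pairing (\<lambda>x. f x + g x) t = pairing f t + pairing g t"
  by (simp add: pairing_def distrib_left sum.distrib)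

lemma pairing_fun_scale: "pairing (\<lambda>x. c * f x) t = c * pairing f t"
  by (simp add: pairing_def sum_distrib_left ac_simps)

lemma pairing_cong:
  "(\<And>x. x \<in> Poly_Mapping.keys t \<Longrightarrow> f x = g x) \<Longrightarrow> pairing f t = pairing g t"
  by (simp add: pairing_def)

lemma pairing_swap:
  "pairing (\<lambda>x. pairing (\<lambda>y. f x y) u) t = pairing (\<lambda>y. pairing (\<lambda>x. f x y) t) u"
  unfolding pairing_def sum_distrib_left
  by (subst sum.swap) (simp add: ac_simps)

lemma comb_induct [case_names single add]:
  assumes "\<And>x c. P (Poly_Mapping.single x c)" "\<And>t u. P t \<Longrightarrow> P u \<Longrightarrow> P (t + u)"
  shows "P (t :: 'x \<Rightarrow>\<^sub>0 'k::field)"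
proof -
  have zero: "P 0"
    using assms(1)[of undefined 0] by simp
  have *: "P (\<Sum>x\<in>A. Poly_Mapping.single x (Poly_Mapping.lookup t x))" if "finite A" for A
    using that by induction (simp_all add: zero assms(1) assms(2))
  have "(\<Sum>x\<in>Poly_Mapping.keys t. Poly_Mapping.single x (Poly_Mapping.lookup t x)) = t"
  proof (rule poly_mapping_eqI)
    fix k
    have "Poly_Mapping.lookup (\<Sum>x\<in>Poly_Mapping.keys t. Poly_Mapping.single x (Poly_Mapping.lookup t x)) k
      = (\<Sum>x\<in>Poly_Mapping.keys t. if x = k then Poly_Mapping.lookup t x else 0)"
      by (simp only: lookup_sum lookup_single when_def)
    also have "\<dots> = Poly_Mapping.lookup t k"
      by (simp only: sum.delta[OF finite_keys]) (simp add: in_keys_iff)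
    finally show "Poly_Mapping.lookup
      (\<Sum>x\<in>Poly_Mapping.keys t. Poly_Mapping.single x (Poly_Mapping.lookup t x)) k
      = Poly_Mapping.lookup t k" .
  qed
  with *[OF finite_keys[of t]] show ?thesis
    by simp
qed

lemma linear_functional_is_pairing:
  assumes "\<And>t u. \<Phi> (t + u) = \<Phi> t + \<Phi> u" "\<And>c t. \<Phi> (scale_comb c t) = c * \<Phi> t"
  shows "\<Phi> t = pairing (\<lambda>x. \<Phi> (pure x)) t"
proof (induction t rule: comb_induct)
  case (single x c)
  have "\<Phi> (scale_comb c (pure x)) = c * \<Phi> (pure x)"
    by (rule assms(2))
  also have "scale_comb c (pure x) = Poly_Mapping.single x c"
    by (rule poly_mapping_eqI) (simp add: lookup_single when_def)
  finally show ?case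
    by simp
next
  case (add t u)
  then show ?case
    by (simp only: assms(1) pairing_add)
qed

text \<open>A basis of \<open>N\<close> remains independent when \<open>t\<close> is added, so a functional may be prescribed to be
  $0$ on \<open>N\<close> and $1$ at \<open>t\<close>.\<close>

lemma separating_functional:
  assumes "comb.subspace N" "t \<notin> N"
  obtains f where "\<And>n. n \<in> N \<Longrightarrow> pairing f n = 0" "pairing f t \<noteq> (0 :: 'k::field)"
proof -
  interpret vector_space_pair
    "scale_comb :: 'k \<Rightarrow> ('a \<Rightarrow>\<^sub>0 'k) \<Rightarrow> ('a \<Rightarrow>\<^sub>0 'k)" "(*) :: 'k \<Rightarrow> 'k \<Rightarrow> 'k"
    by unfold_locales (simp_all add: algebra_simps)
  obtain B where B: "B \<subseteq> N" "comb.independent B" "N \<subseteq> comb.span B"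
    using comb.maximal_independent_subset by blast
  have "comb.span B \<subseteq> N"
    by (rule comb.span_minimal[OF B(1) assms(1)])
  then have "t \<notin> comb.span B"
    using assms(2) by blast
  then have ind: "comb.independent (insert t B)" and "t \<notin> B"
    using B(2) comb.independent_insertI comb.span_base by blast+
  obtain \<Phi> where \<Phi>: "Vector_Spaces.linear scale_comb (*) \<Phi>"
    and val: "\<And>x. x \<in> insert t B \<Longrightarrow> \<Phi> x = (if x = t then 1 else 0)"
    using linear_independent_extend[OF ind, of "\<lambda>x. if x = t then 1 else 0"] by blast
  have pair: "\<Phi> u = pairing (\<lambda>x. \<Phi> (pure x)) u" for u
    by (rule linear_functional_is_pairing)
      (rule linear_add[OF \<Phi>], rule linear_scale[OF \<Phi>])
  have "\<Phi> n = 0" if "n \<in> comb.span B" for n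
    by (rule linear_eq_0_on_span[OF \<Phi> _ that]) (use val \<open>t \<notin> B\<close> in auto)
  moreover have "\<Phi> t \<noteq> 0"
    using val by simp
  ultimately show ?thesis
    using that[of "\<lambda>x. \<Phi> (pure x)"] B(3) unfolding pair[symmetric] by blast
qed

section \<open>Linear, bilinear and trilinear forms\<close>

definition linear_form :: "('k::field, 'h, 'm) module_scheme \<Rightarrow> ('h \<Rightarrow> 'k) \<Rightarrow> bool" where
  "linear_form H f \<longleftrightarrow>
     (\<forall>x\<in>carrier H. \<forall>y\<in>carrier H. f (x \<oplus>\<^bsub>H\<^esub> y) = f x + f y) \<and>
     (\<forall>c. \<forall>x\<in>carrier H. f (c \<odot>\<^bsub>H\<^esub> x) = c * f x)"

definition bilinear_form :: "('k::field, 'h, 'm) module_scheme \<Rightarrow> ('h \<Rightarrow> 'h \<Rightarrow> 'k) \<Rightarrow> bool" where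
  "bilinear_form H f \<longleftrightarrow>
     (\<forall>z\<in>carrier H. linear_form H (\<lambda>x. f x z) \<and> linear_form H (f z))"

definition trilinear_form ::
  "('k::field, 'h, 'm) module_scheme \<Rightarrow> ('h \<Rightarrow> 'h \<Rightarrow> 'h \<Rightarrow> 'k) \<Rightarrow> bool" where
  "trilinear_form H f \<longleftrightarrow>
     (\<forall>z\<in>carrier H. bilinear_form H (\<lambda>x y. f x y z) \<and> bilinear_form H (f z))"

lemma linear_formI:
  assumes "\<And>x y. x \<in> carrier H \<Longrightarrow> y \<in> carrier H \<Longrightarrow> f (x \<oplus>\<^bsub>H\<^esub> y) = f x + f y"
    and "\<And>c x. x \<in> carrier H \<Longrightarrow> f (c \<odot>\<^bsub>H\<^esub> x) = c * f x"
  shows "linear_form H f"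
  using assms by (simp add: linear_form_def)

lemma linear_formD:
  assumes "linear_form H f"
  shows "x \<in> carrier H \<Longrightarrow> y \<in> carrier H \<Longrightarrow> f (x \<oplus>\<^bsub>H\<^esub> y) = f x + f y"
    and "x \<in> carrier H \<Longrightarrow> f (c \<odot>\<^bsub>H\<^esub> x) = c * f x"
  using assms by (simp_all add: linear_form_def)

lemma bilinear_formI:
  assumes "\<And>z. z \<in> carrier H \<Longrightarrow> linear_form H (\<lambda>x. f x z)"
    and "\<And>z. z \<in> carrier H \<Longrightarrow> linear_form H (f z)"
  shows "bilinear_form H f"
  using assms by (simp add: bilinear_form_def)

lemma bilinear_formD:
  assumes "bilinear_form H f" "z \<in> carrier H"
  shows "linear_form H (\<lambda>x. f x z)" "linear_form H (f z)"
  using assms by (simp_all add: bilinear_form_def)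

text \<open>A functional on formal combinations of pairs kills the multilinearity relations exactly if it is
  bilinear on the carrier, and the functionals killing a subspace determine it.\<close>

lemma tensor_eq_forms:
  "tensor_eq H t u \<longleftrightarrow>
     (\<forall>f. bilinear_form H f \<longrightarrow> pairing (\<lambda>(x, y). f x y) t = pairing (\<lambda>(x, y). f x y) u)"
proof -
  have null: "pairing (\<lambda>(x, y). f x y) t = 0" if "t \<in> tensor_null H" and f: "bilinear_form H f" for t f
  proof -
    have f1: "f (x \<oplus>\<^bsub>H\<^esub> y) z = f x z + f y z" "f z (x \<oplus>\<^bsub>H\<^esub> y) = f z x + f z y"
      "f (c \<odot>\<^bsub>H\<^esub> x) z = c * f x z" "f z (c \<odot>\<^bsub>H\<^esub> x) = c * f z x"
      if "x \<in> carrier H" "y \<in> carrier H" "z \<in> carrier H" for x y z c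
      using linear_formD[OF bilinear_formD(1)[OF f that(3)]]
        linear_formD[OF bilinear_formD(2)[OF f that(3)]] that by auto
    from that(1) show ?thesis
      unfolding tensor_null_def comb_span_def
    proof (induction rule: comb.span_induct_alt)
      case base
      then show ?case by simp
    next
      case (step c x y)
      then show ?case
        by (auto simp: pairing_add pairing_scale pairing_diff f1)
    qed
  qed
  show ?thesis
  proof
    assume "tensor_eq H t u"
    then show "\<forall>f. bilinear_form H f \<longrightarrow> pairing (\<lambda>(x, y). f x y) t = pairing (\<lambda>(x, y). f x y) u"
      using null[of "t - u"] by (auto simp: tensor_eq_def pairing_diff)
  next
    assume eq: "\<forall>f. bilinear_form H f \<longrightarrow>
      pairing (\<lambda>(x, y). f x y) t = pairing (\<lambda>(x, y). f x y) u"
    show "tensor_eq H t u"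
      unfolding tensor_eq_def
    proof (rule ccontr)
      assume "t - u \<notin> tensor_null H"
      moreover have "comb.subspace (tensor_null H)"
        by (simp add: tensor_null_def comb_span_def)
      ultimately obtain f where f0: "\<And>n. n \<in> tensor_null H \<Longrightarrow> pairing f n = 0"
        and ft: "pairing f (t - u) \<noteq> 0"
        using separating_functional by metis
      have rel: "pairing f n = 0" if "n \<in>
     ({pure (x \<oplus>\<^bsub>H\<^esub> y, z) - pure (x, z) - pure (y, z) | x y z.
         x \<in> carrier H \<and> y \<in> carrier H \<and> z \<in> carrier H}
    \<union> {pure (z, x \<oplus>\<^bsub>H\<^esub> y) - pure (z, x) - pure (z, y) | x y z.
         x \<in> carrier H \<and> y \<in> carrier H \<and> z \<in> carrier H}
    \<union> {pure (c \<odot>\<^bsub>H\<^esub> x, z) - scale_comb c (pure (x, z)) | c x z.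
         x \<in> carrier H \<and> z \<in> carrier H}
    \<union> {pure (z, c \<odot>\<^bsub>H\<^esub> x) - scale_comb c (pure (z, x)) | c x z.
         x \<in> carrier H \<and> z \<in> carrier H})" for n
        using f0[unfolded tensor_null_def comb_span_def] comb.span_base[OF that] by blast
      have r: "f (x \<oplus>\<^bsub>H\<^esub> y, z) = f (x, z) + f (y, z)" "f (z, x \<oplus>\<^bsub>H\<^esub> y) = f (z, x) + f (z, y)"
        "f (c \<odot>\<^bsub>H\<^esub> x, z) = c * f (x, z)" "f (z, c \<odot>\<^bsub>H\<^esub> x) = c * f (z, x)"
        if "x \<in> carrier H" "y \<in> carrier H" "z \<in> carrier H" for x y z c
      proof -
        have "pairing f (pure (x \<oplus>\<^bsub>H\<^esub> y, z) - pure (x, z) - pure (y, z)) = 0"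
          by (rule rel) (use that in blast)
        then show "f (x \<oplus>\<^bsub>H\<^esub> y, z) = f (x, z) + f (y, z)"
          by (simp add: pairing_diff diff_eq_eq add.commute)
        have "pairing f (pure (z, x \<oplus>\<^bsub>H\<^esub> y) - pure (z, x) - pure (z, y)) = 0"
          by (rule rel) (use that in blast)
        then show "f (z, x \<oplus>\<^bsub>H\<^esub> y) = f (z, x) + f (z, y)"
          by (simp add: pairing_diff diff_eq_eq add.commute)
        have "pairing f (pure (c \<odot>\<^bsub>H\<^esub> x, z) - scale_comb c (pure (x, z))) = 0"
          by (rule rel) (use that in blast)
        then show "f (c \<odot>\<^bsub>H\<^esub> x, z) = c * f (x, z)"
          by (simp add: pairing_diff pairing_scale diff_eq_eq)
        have "pairing f (pure (z, c \<odot>\<^bsub>H\<^esub> x) - scale_comb c (pure (z, x))) = 0"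
          by (rule rel) (use that in blast)
        then show "f (z, c \<odot>\<^bsub>H\<^esub> x) = c * f (z, x)"
          by (simp add: pairing_diff pairing_scale diff_eq_eq)
      qed
      have "bilinear_form H (\<lambda>x y. f (x, y))"
        by (intro bilinear_formI linear_formI) (auto simp: r)
      then show False
        using eq ft by (auto simp: pairing_diff case_prod_unfold)
    qed
  qed
qed

text \<open>Each generator of \<^const>\<open>tensor3_null\<close> has one tensor factor fixed, and a trilinear form with
  one fixed argument is bilinear in the others.\<close>

lemma tensor3_eq_forms:
  assumes "tensor3_eq H t u" and f: "trilinear_form H f"
  shows "pairing (\<lambda>(x, y, z). f x y z) t = pairing (\<lambda>(x, y, z). f x y z) u"
proof -
  have null: "pairing (\<lambda>(x, y). g x y) t = 0" if "t \<in> tensor_null H" "bilinear_form H g" for t g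
    using tensor_eq_forms[of H t 0] that by (simp add: tensor_eq_def)
  have "pairing (\<lambda>(x, y, z). f x y z) n = 0" if "n \<in> tensor3_null H" for n
    using that unfolding tensor3_null_def comb_span_def
  proof (induction rule: comb.span_induct_alt)
    case base
    then show ?case by simp
  next
    case (step c x y)
    have "pairing (\<lambda>(x, y, z). f x y z) x = 0"
      using step(1)
    proof (elim UnE CollectE exE conjE)
      fix t z assume x: "x = lin_ext (\<lambda>(x, y). pure (x, y, z)) t"
        and "t \<in> tensor_null H" "z \<in> carrier H"
      then show ?thesis
        using null[of t "\<lambda>x y. f x y z"] f
        by (simp add: trilinear_form_def pairing_lin_ext case_prod_unfold)
    next
      fix t z assume x: "x = lin_ext (\<lambda>(x, y). pure (z, x, y)) t"
        and "t \<in> tensor_null H" "z \<in> carrier H"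
      then show ?thesis
        using null[of t "f z"] f
        by (simp add: trilinear_form_def pairing_lin_ext case_prod_unfold)
    qed
    with step(2) show ?case
      by (simp add: pairing_add pairing_scale)
  qed
  from this[of "t - u"] assms(1) show ?thesis
    by (simp add: tensor3_eq_def pairing_diff)
qed

context assoc_algebra
begin

sublocale alg: Ring.ring H
  by (rule ring)

lemma smult_closed: "x \<in> carrier H \<Longrightarrow> c \<odot> x \<in> carrier H"
  and smult_add_left: "x \<in> carrier H \<Longrightarrow> (c + d) \<odot> x = c \<odot> x \<oplus> d \<odot> x"
  and smult_smult: "x \<in> carrier H \<Longrightarrow> c \<odot> (d \<odot> x) = (c * d) \<odot> x"
  and smult_1: "x \<in> carrier H \<Longrightarrow> 1 \<odot> x = x"
  and smult_0: "x \<in> carrier H \<Longrightarrow> 0 \<odot> x = \<zero>"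
  and smult_zero: "c \<odot> \<zero> = \<zero>"
proof -
  interpret M: Module.module "ring_of_type_algebra :: 'k ring" H
    by (rule module)
  show "x \<in> carrier H \<Longrightarrow> c \<odot> x \<in> carrier H"
    using M.smult_closed[of c x] by (simp add: ring_of_type_algebra_def)
  show "x \<in> carrier H \<Longrightarrow> (c + d) \<odot> x = c \<odot> x \<oplus> d \<odot> x"
    using M.smult_l_distr[of c d x] by (simp add: ring_of_type_algebra_def)
  show "x \<in> carrier H \<Longrightarrow> c \<odot> (d \<odot> x) = (c * d) \<odot> x"
    using M.smult_assoc1[of c d x] by (simp add: ring_of_type_algebra_def)
  show "x \<in> carrier H \<Longrightarrow> 1 \<odot> x = x"
    using M.smult_one[of x] by (simp add: ring_of_type_algebra_def)
  show "x \<in> carrier H \<Longrightarrow> 0 \<odot> x = \<zero>"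
    using M.smult_l_null[of x] by (simp add: ring_of_type_algebra_def)
  show "c \<odot> \<zero> = \<zero>"
    using M.smult_r_null[of c] by (simp add: ring_of_type_algebra_def)
qed

lemma smult_neg_1: "x \<in> carrier H \<Longrightarrow> (- 1) \<odot> x = \<ominus> x"
proof -
  assume x: "x \<in> carrier H"
  have "(- 1) \<odot> x \<oplus> x = (- 1 + 1) \<odot> x"
    using x by (simp only: smult_add_left smult_1)
  also have "\<dots> = \<zero>"
    using x by (simp add: smult_0)
  finally show ?thesis
    using x by (simp add: alg.minus_equality smult_closed)
qed

lemma linear_form_zero: "linear_form H f \<Longrightarrow> f \<zero> = 0"
  using linear_formD(2)[of H f \<zero> 0] by (simp add: smult_zero)

lemma linear_form_finsum:
  assumes "linear_form H f" "finite A" "\<And>i. i \<in> A \<Longrightarrow> g i \<in> carrier H"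
  shows "f (\<Oplus>i\<in>A. g i) = (\<Sum>i\<in>A. f (g i))"
  using assms(2,3)
proof (induction rule: finite_induct)
  case empty
  then show ?case
    using assms(1) by (simp add: linear_form_zero)
next
  case (insert i A)
  then have "(\<Oplus>i\<in>insert i A. g i) = g i \<oplus> (\<Oplus>i\<in>A. g i)" "(\<Oplus>i\<in>A. g i) \<in> carrier H"
    by (auto intro!: alg.finsum_insert alg.finsum_closed)
  with insert show ?case
    using linear_formD(1)[OF assms(1)] by simp
qed

section \<open>Evaluating formal combinations\<close>

lemma comb_eval_closed:
  assumes "\<And>x. x \<in> Poly_Mapping.keys t \<Longrightarrow> g x \<in> carrier H"
  shows "comb_eval H g t \<in> carrier H"
  unfolding comb_eval_def using assms by (intro alg.finsum_closed) (auto intro: smult_closed)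

lemma linear_form_comb_eval:
  assumes "linear_form H f" "\<And>x. x \<in> Poly_Mapping.keys t \<Longrightarrow> g x \<in> carrier H"
  shows "f (comb_eval H g t) = pairing (\<lambda>x. f (g x)) t"
  unfolding comb_eval_def pairing_def
  using assms by (subst linear_form_finsum) (auto intro!: smult_closed sum.cong simp: linear_formD)

lemma comb_eval_superset:
  assumes "finite A" "Poly_Mapping.keys t \<subseteq> A" "\<And>x. x \<in> A \<Longrightarrow> g x \<in> carrier H"
  shows "comb_eval H g t = (\<Oplus>x\<in>A. Poly_Mapping.lookup t x \<odot> g x)"
  unfolding comb_eval_def
proof (rule alg.add.finprod_mono_neutral_cong_left[OF assms(1,2)])
  show "Poly_Mapping.lookup t i \<odot> g i = \<zero>" if "i \<in> A - Poly_Mapping.keys t" for i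
    using that assms(3) by (simp add: in_keys_iff smult_0)
qed (use assms(3) in \<open>auto intro: smult_closed\<close>)

lemma comb_eval_add:
  assumes "\<And>x. x \<in> Poly_Mapping.keys t \<union> Poly_Mapping.keys u \<Longrightarrow> g x \<in> carrier H"
  shows "comb_eval H g (t + u) = comb_eval H g t \<oplus> comb_eval H g u"
proof -
  let ?A = "Poly_Mapping.keys t \<union> Poly_Mapping.keys u"
  have fin: "finite ?A" by simp
  have "comb_eval H g (t + u) = (\<Oplus>x\<in>?A. Poly_Mapping.lookup (t + u) x \<odot> g x)"
    by (rule comb_eval_superset[OF fin Poly_Mapping.keys_add assms])
  also have "\<dots> = (\<Oplus>x\<in>?A. Poly_Mapping.lookup t x \<odot> g x \<oplus> Poly_Mapping.lookup u x \<odot> g x)"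
    by (rule alg.finsum_cong') (use assms in \<open>auto simp: lookup_add smult_add_left intro: smult_closed\<close>)
  also have "\<dots> = (\<Oplus>x\<in>?A. Poly_Mapping.lookup t x \<odot> g x) \<oplus> (\<Oplus>x\<in>?A. Poly_Mapping.lookup u x \<odot> g x)"
    by (rule alg.finsum_addf) (use assms in \<open>auto intro: smult_closed\<close>)
  also have "\<dots> = comb_eval H g t \<oplus> comb_eval H g u"
    using comb_eval_superset[OF fin _ assms, of t] comb_eval_superset[OF fin _ assms, of u] by simp
  finally show ?thesis .
qed

lemma comb_eval_single:
  "g x \<in> carrier H \<Longrightarrow> comb_eval H g (Poly_Mapping.single x c) = c \<odot> g x"
  using comb_eval_superset[of "{x}" "Poly_Mapping.single x c" g]
  by (simp add: smult_closed)

lemma comb_eval_zero: "comb_eval H g 0 = \<zero>"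
  by (simp add: comb_eval_def)

lemma comb_eval_scale:
  assumes "\<And>x. x \<in> Poly_Mapping.keys t \<Longrightarrow> g x \<in> carrier H"
  shows "comb_eval H g (scale_comb c t) = c \<odot> comb_eval H g t"
proof -
  interpret M: Module.module "ring_of_type_algebra :: 'k ring" H
    by (rule module)
  have "comb_eval H g (scale_comb c t) =
      (\<Oplus>x\<in>Poly_Mapping.keys t. c \<odot> (Poly_Mapping.lookup t x \<odot> g x))"
    using assms by (subst comb_eval_superset[OF _ keys_scale_comb])
      (auto simp: smult_smult intro!: alg.finsum_cong' smult_closed)
  also have "\<dots> = c \<odot> comb_eval H g t"
    unfolding comb_eval_def using assms
    by (intro M.finsum_smult_ldistr[symmetric])
      (auto simp: ring_of_type_algebra_def intro: smult_closed)
  finally show ?thesis .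
qed

text \<open>Formal combinations of elements of the carrier modulo the kernel \<open>N\<close> of their evaluation are a
  copy of the algebra, and a functional that kills \<open>N\<close> is a linear form.\<close>

lemma forms_separate_points:
  assumes x: "x \<in> carrier H" and y: "y \<in> carrier H"
    and eq: "\<And>f. linear_form H f \<Longrightarrow> f x = f y"
  shows "x = y"
proof (rule ccontr)
  assume ne: "x \<noteq> y"
  define N where "N = {t. Poly_Mapping.keys t \<subseteq> carrier H \<and> comb_eval H (\<lambda>x. x) t = \<zero>}"
  have "comb.subspace N"
    unfolding comb.subspace_def
  proof (intro conjI ballI allI)
    show "0 \<in> N"
      by (simp add: N_def comb_eval_zero)
    show "t + u \<in> N" if "t \<in> N" "u \<in> N" for t u
      using that Poly_Mapping.keys_add[of t u] comb_eval_add[of t u "\<lambda>x. x"]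
      by (auto simp: N_def subset_iff)
    show "scale_comb c t \<in> N" if "t \<in> N" for c t
      using that keys_scale_comb[of c t] by (auto simp: N_def comb_eval_scale subset_iff smult_zero)
  qed
  have ev: "comb_eval H (\<lambda>x. x) (pure a + scale_comb c (pure b) + scale_comb c' (pure b')) =
      a \<oplus> c \<odot> b \<oplus> c' \<odot> b'" and ks: "Poly_Mapping.keys (pure a + scale_comb c (pure b) + scale_comb c' (pure b')) \<subseteq> carrier H"
    if "a \<in> carrier H" "b \<in> carrier H" "b' \<in> carrier H" for a b b' c c'
  proof -
    have k: "Poly_Mapping.keys (pure a) \<subseteq> carrier H" "Poly_Mapping.keys (scale_comb c (pure b)) \<subseteq> carrier H"
      "Poly_Mapping.keys (scale_comb c' (pure b')) \<subseteq> carrier H"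
      using that keys_scale_comb[of c "pure b"] keys_scale_comb[of c' "pure b'"] by auto
    then have k2: "Poly_Mapping.keys (pure a + scale_comb c (pure b)) \<subseteq> carrier H"
      by (intro order_trans[OF Poly_Mapping.keys_add Un_least])
    with k show "Poly_Mapping.keys (pure a + scale_comb c (pure b) + scale_comb c' (pure b')) \<subseteq> carrier H"
      by (intro order_trans[OF Poly_Mapping.keys_add Un_least])
    have "comb_eval H (\<lambda>x. x) (pure a + scale_comb c (pure b) + scale_comb c' (pure b')) =
      comb_eval H (\<lambda>x. x) (pure a + scale_comb c (pure b)) \<oplus>
      comb_eval H (\<lambda>x. x) (scale_comb c' (pure b'))"
      using k k2 by (intro comb_eval_add) blast
    also have "comb_eval H (\<lambda>x. x) (pure a + scale_comb c (pure b)) =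
      comb_eval H (\<lambda>x. x) (pure a) \<oplus> comb_eval H (\<lambda>x. x) (scale_comb c (pure b))"
      using k by (intro comb_eval_add) blast
    finally show "comb_eval H (\<lambda>x. x) (pure a + scale_comb c (pure b) + scale_comb c' (pure b')) =
      a \<oplus> c \<odot> b \<oplus> c' \<odot> b'"
      using that comb_eval_scale[of "pure b" "\<lambda>x. x" c] comb_eval_scale[of "pure b'" "\<lambda>x. x" c']
      by (auto simp: comb_eval_single smult_1)
  qed
  have rel: "pure a + scale_comb c (pure b) + scale_comb c' (pure b') \<in> N"
    if "a \<in> carrier H" "b \<in> carrier H" "b' \<in> carrier H" "a \<oplus> c \<odot> b \<oplus> c' \<odot> b' = \<zero>" for a b b' c c'
    using that ev ks by (simp add: N_def)
  \<comment> \<open>The last summand only completes the three-term pattern of \<open>rel\<close>.\<close>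
  let ?d = "pure x + scale_comb (- 1) (pure y) + scale_comb 0 (pure y)"
  have "?d \<notin> N"
  proof
    assume "?d \<in> N"
    then have "x \<oplus> (- 1) \<odot> y \<oplus> 0 \<odot> y = \<zero>"
      using ev[OF x y y, of "- 1" 0] by (simp add: N_def)
    then show False
      using x y ne alg.minus_equality[of x "\<ominus> y"] by (simp add: smult_neg_1 smult_0)
  qed
  then obtain f where f: "\<And>n. n \<in> N \<Longrightarrow> pairing f n = 0" and "pairing f ?d \<noteq> 0"
    using separating_functional[OF \<open>comb.subspace N\<close>] by metis
  then have "f x \<noteq> f y"
    by (auto simp: pairing_diff)
  moreover have "linear_form H f"
  proof (rule linear_formI)
    fix a b assume ab: "a \<in> carrier H" "b \<in> carrier H"
    have "a \<oplus> b \<oplus> (- 1) \<odot> a \<oplus> (- 1) \<odot> b = \<zero>"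
      using ab by (metis smult_neg_1 alg.add.inv_mult_group alg.a_assoc alg.a_comm
          alg.r_neg alg.add.inv_closed alg.add.m_closed)
    then have "pairing f (pure (a \<oplus> b) + scale_comb (- 1) (pure a) + scale_comb (- 1) (pure b)) = 0"
      using ab by (intro f rel) auto
    then show "f (a \<oplus> b) = f a + f b"
      by (simp only: pairing_add pairing_scale pairing_single) (simp add: algebra_simps)
  next
    fix c a assume a: "a \<in> carrier H"
    have "c \<odot> a \<oplus> (- c) \<odot> a \<oplus> 0 \<odot> a = (c + - c + 0) \<odot> a"
      by (simp only: smult_add_left a)
    then have "c \<odot> a \<oplus> (- c) \<odot> a \<oplus> 0 \<odot> a = \<zero>"
      using a by (simp add: smult_0)
    then have "pairing f (pure (c \<odot> a) + scale_comb (- c) (pure a) + scale_comb 0 (pure a)) = 0"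
      using a by (intro f rel smult_closed) auto
    then show "f (c \<odot> a) = c * f a"
      by (simp only: pairing_add pairing_scale pairing_single) simp
  qed
  ultimately show False
    using eq by blast
qed

section \<open>Evaluating noncommutative polynomials\<close>

definition word_eval :: "('x \<Rightarrow> 'h) \<Rightarrow> 'x word \<Rightarrow> 'h" where
  "word_eval g w = foldr (\<lambda>x y. g x \<otimes> y) (letters w) \<one>"

lemma free_eval_word_eval: "free_eval H g = comb_eval H (word_eval g)"
  by (simp add: free_eval_def word_eval_def[abs_def])

lemma word_eval_simps:
  "word_eval g 0 = \<one>" "word_eval g (Word []) = \<one>"
  "word_eval g (Word (x # xs)) = g x \<otimes> word_eval g (Word xs)"
  by (simp_all add: word_eval_def zero_word_def)

context
  fixes g :: "'x \<Rightarrow> 'h"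
  assumes gens: "range g \<subseteq> carrier H"
begin

lemma generator_closed: "g x \<in> carrier H"
  using gens by auto

lemma word_eval_closed: "word_eval g w \<in> carrier H"
proof (cases w)
  case (Word xs)
  show ?thesis
    unfolding Word by (induction xs) (use gens in \<open>auto simp: word_eval_simps\<close>)
qed

lemma word_eval_add: "word_eval g (v + w) = word_eval g v \<otimes> word_eval g w"
proof (cases v; cases w)
  fix xs ys assume v: "v = Word xs" and w: "w = Word ys"
  have "word_eval g (Word (xs @ ys)) = word_eval g (Word xs) \<otimes> word_eval g (Word ys)"
    by (induction xs) (simp_all add: word_eval_simps alg.m_assoc generator_closed word_eval_closed)
  then show ?thesis
    by (simp add: v w plus_word_def)
qed

lemma free_eval_closed: "free_eval H g t \<in> carrier H"
  by (simp add: free_eval_word_eval comb_eval_closed word_eval_closed)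

lemma free_eval_add: "free_eval H g (t + u) = free_eval H g t \<oplus> free_eval H g u"
  by (simp add: free_eval_word_eval comb_eval_add word_eval_closed)

lemma free_eval_single: "free_eval H g (Poly_Mapping.single w c) = c \<odot> word_eval g w"
  by (simp add: free_eval_word_eval comb_eval_single word_eval_closed)

lemma free_eval_scale: "free_eval H g (scale_comb c t) = c \<odot> free_eval H g t"
  by (simp add: free_eval_word_eval comb_eval_scale word_eval_closed)

lemma free_eval_zero: "free_eval H g 0 = \<zero>"
  by (simp add: free_eval_word_eval comb_eval_zero)

lemma free_eval_gen: "free_eval H g (gen x) = g x"
  by (simp add: gen_def free_eval_single word_eval_simps smult_1 generator_closed)

lemma free_eval_one: "free_eval H g 1 = \<one>"
  using free_eval_single[of 0 1] by (simp add: word_eval_simps smult_1)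

lemma free_eval_mult: "free_eval H g (t * u) = free_eval H g t \<otimes> free_eval H g u"
proof (induction t rule: comb_induct)
  case (single v c)
  show ?case
  proof (induction u rule: comb_induct)
    case (single w d)
    show ?case
      by (simp add: mult_single free_eval_single word_eval_add word_eval_closed
          smult_mult_left smult_mult_right smult_smult smult_closed mult.commute)
  next
    case (add t u)
    then show ?case
      by (simp add: distrib_left free_eval_add alg.r_distr free_eval_closed)
  qed
next
  case (add t t')
  then show ?case
    by (simp add: distrib_right free_eval_add alg.l_distr free_eval_closed)
qed

lemma free_eval_diff: "free_eval H g (t - u) = free_eval H g t \<ominus> free_eval H g u"
proof -
  have "free_eval H g (scale_comb (- 1) u) = \<ominus> free_eval H g u"
    by (simp only: free_eval_scale smult_neg_1 free_eval_closed)
  moreover have "scale_comb (- 1) u = - u"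
    by simp
  ultimately show ?thesis
    using free_eval_add[of t "- u"] by (simp add: a_minus_def)
qed

lemma generated_induct [case_names gen one add smult mult]:
  assumes surj: "range (free_eval H g) = carrier H"
    and x: "x \<in> carrier H"
    and gen: "\<And>i. P (g i)" and one: "P \<one>"
    and add: "\<And>x y. x \<in> carrier H \<Longrightarrow> y \<in> carrier H \<Longrightarrow> P x \<Longrightarrow> P y \<Longrightarrow> P (x \<oplus> y)"
    and smult: "\<And>c x. x \<in> carrier H \<Longrightarrow> P x \<Longrightarrow> P (c \<odot> x)"
    and mult: "\<And>x y. x \<in> carrier H \<Longrightarrow> y \<in> carrier H \<Longrightarrow> P x \<Longrightarrow> P y \<Longrightarrow> P (x \<otimes> y)"
  shows "P x"
proof -
  have words: "P (word_eval g w)" for w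
  proof (cases w)
    case (Word xs)
    show ?thesis
      unfolding Word
    proof (induction xs)
      case Nil
      then show ?case
        by (simp add: word_eval_simps one)
    next
      case (Cons y xs)
      then show ?case
        unfolding word_eval_simps using gens by (intro mult gen word_eval_closed) auto
    qed
  qed
  have "P (free_eval H g t)" for t
    by (induction t rule: comb_induct)
      (auto simp: free_eval_single free_eval_add intro: smult add words word_eval_closed free_eval_closed)
  then show ?thesis
    using surj x by (metis rangeE)
qed

end

end

lemma ring_free_algebra: "Ring.ring (ring_of_type_algebra :: ('x, 'k::field) free_algebra ring)"
proof -
  have "\<exists>y. x + y = 0" "\<exists>y. y + x = 0" for x :: "('x, 'k) free_algebra"
    using add.right_inverse add.left_inverse by blast+
  then show ?thesis
    unfolding ring_of_type_algebra_def
    by unfold_locales (auto simp: distrib_left distrib_right add.assoc add.commute mult.assoc Units_def)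
qed

lemma (in assoc_algebra) kernel_ideal:
  assumes "range g \<subseteq> carrier H"
  shows "ideal {t. free_eval H g t = \<zero>} (ring_of_type_algebra :: ('x, 'k) free_algebra ring)"
proof (rule idealI[OF ring_free_algebra])
  let ?T = "ring_of_type_algebra :: ('x, 'k) free_algebra ring"
  note ev = free_eval_add[OF assms] free_eval_mult[OF assms] free_eval_zero[OF assms]
    free_eval_diff[OF assms] free_eval_closed[OF assms]
  interpret T: Ring.ring ?T
    by (rule ring_free_algebra)
  have inv: "inv\<^bsub>add_monoid ?T\<^esub> t = - t" for t
    unfolding a_inv_def[symmetric]
    by (rule T.minus_equality) (auto simp: ring_of_type_algebra_def)
  show "subgroup {t. free_eval H g t = \<zero>} (add_monoid ?T)"
  proof
    show "inv\<^bsub>add_monoid ?T\<^esub> t \<in> {t. free_eval H g t = \<zero>}" if "t \<in> {t. free_eval H g t = \<zero>}" for t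
      unfolding inv using that free_eval_diff[OF assms, of 0 t] by (simp add: ev)
  qed (auto simp: ring_of_type_algebra_def ev)
qed (simp_all add: ring_of_type_algebra_def free_eval_mult[OF assms] free_eval_closed[OF assms])

section \<open>Bilinear forms and comultiplication\<close>

lemma bilinear_form_pairing:
  assumes "\<And>z. z \<in> Poly_Mapping.keys u \<Longrightarrow> bilinear_form H (f z)"
  shows "bilinear_form H (\<lambda>x y. pairing (\<lambda>z. f z x y) u)"
proof (intro bilinear_formI linear_formI)
  fix z x y assume c: "z \<in> carrier H" "x \<in> carrier H" "y \<in> carrier H"
  show "pairing (\<lambda>i. f i (x \<oplus>\<^bsub>H\<^esub> y) z) u = pairing (\<lambda>i. f i x z) u + pairing (\<lambda>i. f i y z) u"
    unfolding pairing_fun_add[symmetric]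
    by (rule pairing_cong) (use c linear_formD(1)[OF bilinear_formD(1)[OF assms]] in blast)
  show "pairing (\<lambda>i. f i z (x \<oplus>\<^bsub>H\<^esub> y)) u = pairing (\<lambda>i. f i z x) u + pairing (\<lambda>i. f i z y) u"
    unfolding pairing_fun_add[symmetric]
    by (rule pairing_cong) (use c linear_formD(1)[OF bilinear_formD(2)[OF assms]] in blast)
next
  fix z x c assume c: "z \<in> carrier H" "x \<in> carrier H"
  show "pairing (\<lambda>i. f i (c \<odot>\<^bsub>H\<^esub> x) z) u = c * pairing (\<lambda>i. f i x z) u"
    unfolding pairing_fun_scale[symmetric]
    by (rule pairing_cong) (use c linear_formD(2)[OF bilinear_formD(1)[OF assms]] in blast)
  show "pairing (\<lambda>i. f i z (c \<odot>\<^bsub>H\<^esub> x)) u = c * pairing (\<lambda>i. f i z x) u"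
    unfolding pairing_fun_scale[symmetric]
    by (rule pairing_cong) (use c linear_formD(2)[OF bilinear_formD(2)[OF assms]] in blast)
qed

lemma pairing_tensor_mult:
  "pairing (\<lambda>(x, y). f x y) (tensor_mult H t u) =
   pairing (\<lambda>(x, y). pairing (\<lambda>(x', y'). f (x \<otimes>\<^bsub>H\<^esub> x') (y \<otimes>\<^bsub>H\<^esub> y')) u) t"
  by (simp add: tensor_mult_def pairing_lin_ext case_prod_unfold)

lemma (in assoc_algebra) bilinear_form_translate:
  assumes f: "bilinear_form H f" and c: "c \<in> carrier H" "c' \<in> carrier H"
  shows "bilinear_form H (\<lambda>x y. f (x \<otimes> c) (y \<otimes> c'))"
    and "bilinear_form H (\<lambda>x y. f (c \<otimes> x) (c' \<otimes> y))"
  using c linear_formD[OF bilinear_formD(1)[OF f]] linear_formD[OF bilinear_formD(2)[OF f]]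
  by (auto intro!: bilinear_formI linear_formI
      simp: alg.l_distr alg.r_distr smult_mult_left smult_mult_right)

text \<open>In a product of two coproducts either factor may be replaced by another representative, because
  the form stays bilinear in this factor while the other one is held fixed.\<close>

lemma (in assoc_algebra) bilinear_form_mult:
  assumes f: "bilinear_form H f" and t: "Poly_Mapping.keys t \<subseteq> carrier H \<times> carrier H"
  shows "bilinear_form H (\<lambda>x y. pairing (\<lambda>(x', y'). f (x \<otimes> x') (y \<otimes> y')) t)"
    and "bilinear_form H (\<lambda>x y. pairing (\<lambda>(x', y'). f (x' \<otimes> x) (y' \<otimes> y)) t)"
  using t unfolding case_prod_unfold
  by (auto intro!: bilinear_form_pairing bilinear_form_translate[OF f])

lemma (in hopf_algebra) linear_form_comult:
  assumes f: "bilinear_form H f"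
  shows "linear_form H (\<lambda>x. pairing (\<lambda>(x, y). f x y) (comult H x))"
proof (rule linear_formI)
  show "pairing (\<lambda>(x, y). f x y) (comult H (x \<oplus> y)) =
      pairing (\<lambda>(x, y). f x y) (comult H x) + pairing (\<lambda>(x, y). f x y) (comult H y)"
    if "x \<in> carrier H" "y \<in> carrier H" for x y
    using comult_add[OF that] f by (simp add: tensor_eq_forms pairing_add)
  show "pairing (\<lambda>(x, y). f x y) (comult H (c \<odot> x)) = c * pairing (\<lambda>(x, y). f x y) (comult H x)"
    if "x \<in> carrier H" for x c
    using comult_smult[OF that] f by (simp add: tensor_eq_forms pairing_scale)
qed

lemma (in hopf_algebra) pairing_comult_mult:
  assumes "bilinear_form H f" "a \<in> carrier H" "b \<in> carrier H"
  shows "pairing (\<lambda>(x, y). f x y) (comult H (a \<otimes> b)) =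
    pairing (\<lambda>(x, y). pairing (\<lambda>(x', y'). f (x \<otimes> x') (y \<otimes> y')) (comult H b)) (comult H a)"
  using comult_mult[OF assms(2,3)] assms(1) by (simp add: tensor_eq_forms pairing_tensor_mult)

lemma (in hopf_algebra) pairing_comult_one:
  assumes "bilinear_form H f"
  shows "pairing (\<lambda>(x, y). f x y) (comult H \<one>) = f \<one> \<one>"
  using comult_one assms by (simp add: tensor_eq_forms)

section \<open>Homogeneous components\<close>

context bigraded_hopf_algebra
begin

lemma component_closed: "x \<in> component H p \<Longrightarrow> x \<in> carrier H"
  and component_zero: "\<zero> \<in> component H p"
  and component_add: "x \<in> component H p \<Longrightarrow> y \<in> component H p \<Longrightarrow> x \<oplus> y \<in> component H p"
  and component_smult: "x \<in> component H p \<Longrightarrow> c \<odot> x \<in> component H p"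
proof -
  interpret S: submodule "component H p" "ring_of_type_algebra :: 'k ring" H
    by (rule component_submodule)
  show "x \<in> component H p \<Longrightarrow> x \<in> carrier H"
    using S.subset by auto
  show "\<zero> \<in> component H p"
    using S.one_closed by simp
  show "x \<in> component H p \<Longrightarrow> y \<in> component H p \<Longrightarrow> x \<oplus> y \<in> component H p"
    using S.m_closed by simp
  show "x \<in> component H p \<Longrightarrow> c \<odot> x \<in> component H p"
    using S.smult_closed[of c x] by (simp add: ring_of_type_algebra_def)
qed

lemma mult_component:
  "x \<in> component H p \<Longrightarrow> y \<in> component H p' \<Longrightarrow> x \<otimes> y \<in> component H (p + p')"
  using mult_degree[of x "fst p" "snd p" y "fst p'" "snd p'"] by (simp add: plus_prod_def)

lemma one_degree: "\<one> \<in> component H (0, 0)"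
  using scalar_degree[of 1] by (simp add: smult_1)

lemma homogeneous_part_decomposition:
  "x \<in> carrier H \<Longrightarrow> homogeneous_decomposition H x (homogeneous_part H x)"
  unfolding homogeneous_part_def by (rule theI'[OF direct_sum])

lemma homogeneous_part_unique:
  "x \<in> carrier H \<Longrightarrow> homogeneous_decomposition H x f \<Longrightarrow> homogeneous_part H x = f"
  unfolding homogeneous_part_def by (rule the1_equality[OF direct_sum])

lemma homogeneous_part_in_component: "x \<in> carrier H \<Longrightarrow> homogeneous_part H x p \<in> component H p"
  and homogeneous_part_finite: "x \<in> carrier H \<Longrightarrow> finite {p. homogeneous_part H x p \<noteq> \<zero>}"
  and homogeneous_part_sum: "x \<in> carrier H \<Longrightarrow>
    (\<Oplus>p\<in>{p. homogeneous_part H x p \<noteq> \<zero>}. homogeneous_part H x p) = x"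
  using homogeneous_part_decomposition[of x] unfolding homogeneous_decomposition_def by metis+

lemma homogeneous_part_closed: "x \<in> carrier H \<Longrightarrow> homogeneous_part H x p \<in> carrier H"
  by (rule component_closed[OF homogeneous_part_in_component])

lemma linear_form_homogeneous_parts:
  assumes f: "linear_form H f" and x: "x \<in> carrier H"
    and A: "finite A" "{p. homogeneous_part H x p \<noteq> \<zero>} \<subseteq> A"
  shows "f x = (\<Sum>p\<in>A. f (homogeneous_part H x p))"
proof -
  have "f x = f (\<Oplus>p\<in>{p. homogeneous_part H x p \<noteq> \<zero>}. homogeneous_part H x p)"
    by (simp add: homogeneous_part_sum x)
  also have "\<dots> = (\<Sum>p\<in>{p. homogeneous_part H x p \<noteq> \<zero>}. f (homogeneous_part H x p))"
    by (rule linear_form_finsum[OF f homogeneous_part_finite[OF x] homogeneous_part_closed[OF x]])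
  also have "\<dots> = (\<Sum>p\<in>A. f (homogeneous_part H x p))"
    by (rule sum.mono_neutral_left[OF A]) (use linear_form_zero[OF f] in auto)
  finally show ?thesis .
qed

text \<open>Linear forms separate points, so a decomposition may be verified after applying them; this
  replaces sums in the algebra by sums of scalars over one common finite set of degrees.\<close>

lemma homogeneous_partI:
  assumes x: "x \<in> carrier H" and A: "finite A" "\<And>p. p \<notin> A \<Longrightarrow> h p = \<zero>"
    and comp: "\<And>p. h p \<in> component H p"
    and sum: "\<And>f. linear_form H f \<Longrightarrow> f x = (\<Sum>p\<in>A. f (h p))"
  shows "homogeneous_part H x = h"
proof (rule homogeneous_part_unique[OF x])
  have sub: "{p. h p \<noteq> \<zero>} \<subseteq> A"
    using A(2) by auto
  then have fin: "finite {p. h p \<noteq> \<zero>}"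
    using A(1) finite_subset by blast
  have "x = (\<Oplus>p\<in>{p. h p \<noteq> \<zero>}. h p)"
  proof (rule forms_separate_points[OF x])
    show "(\<Oplus>p\<in>{p. h p \<noteq> \<zero>}. h p) \<in> carrier H"
      by (intro alg.finsum_closed Pi_I component_closed[OF comp])
    fix f assume f: "linear_form H f"
    have "(\<Sum>p\<in>A. f (h p)) = (\<Sum>p\<in>{p. h p \<noteq> \<zero>}. f (h p))"
      by (rule sum.mono_neutral_right[OF A(1) sub]) (use linear_form_zero[OF f] in auto)
    then show "f x = f (\<Oplus>p\<in>{p. h p \<noteq> \<zero>}. h p)"
      using sum[OF f] linear_form_finsum[OF f fin] component_closed[OF comp] by simp
  qed
  then show "homogeneous_decomposition H x h"
    using comp fin by (simp add: homogeneous_decomposition_def)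
qed

lemma homogeneous_part_add:
  assumes x: "x \<in> carrier H" and y: "y \<in> carrier H"
  shows "homogeneous_part H (x \<oplus> y) = (\<lambda>p. homogeneous_part H x p \<oplus> homogeneous_part H y p)"
proof (rule homogeneous_partI)
  let ?A = "{p. homogeneous_part H x p \<noteq> \<zero>} \<union> {p. homogeneous_part H y p \<noteq> \<zero>}"
  show fin: "finite ?A"
    by (simp add: homogeneous_part_finite x y)
  show "f (x \<oplus> y) = (\<Sum>p\<in>?A. f (homogeneous_part H x p \<oplus> homogeneous_part H y p))"
    if "linear_form H f" for f
    using linear_form_homogeneous_parts[OF that x fin] linear_form_homogeneous_parts[OF that y fin]
    by (simp add: linear_formD(1)[OF that] x y homogeneous_part_closed sum.distrib)
qed (use x y in \<open>auto intro: component_add homogeneous_part_in_component\<close>)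

lemma homogeneous_part_smult:
  assumes x: "x \<in> carrier H"
  shows "homogeneous_part H (c \<odot> x) = (\<lambda>p. c \<odot> homogeneous_part H x p)"
proof (rule homogeneous_partI)
  let ?A = "{p. homogeneous_part H x p \<noteq> \<zero>}"
  show fin: "finite ?A"
    by (simp add: homogeneous_part_finite x)
  show "f (c \<odot> x) = (\<Sum>p\<in>?A. f (c \<odot> homogeneous_part H x p))"
    if "linear_form H f" for f
    using linear_form_homogeneous_parts[OF that x fin]
    by (simp add: linear_formD(2)[OF that] x homogeneous_part_closed sum_distrib_left)
qed (use x in \<open>auto intro: component_smult homogeneous_part_in_component smult_closed simp: smult_zero\<close>)

lemma homogeneous_part_homogeneous:
  assumes x: "x \<in> component H p"
  shows "homogeneous_part H x = (\<lambda>p'. if p' = p then x else \<zero>)"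
  by (rule homogeneous_partI[of _ "{p}"])
    (use x in \<open>auto intro: component_closed component_zero\<close>)

lemma homogeneous_induct [consumes 1, case_names homogeneous add]:
  assumes x: "x \<in> carrier H"
    and hom: "\<And>p x. x \<in> component H p \<Longrightarrow> P x"
    and add: "\<And>x y. x \<in> carrier H \<Longrightarrow> y \<in> carrier H \<Longrightarrow> P x \<Longrightarrow> P y \<Longrightarrow> P (x \<oplus> y)"
  shows "P x"
proof -
  have "P (\<Oplus>p\<in>A. homogeneous_part H x p) \<and> (\<Oplus>p\<in>A. homogeneous_part H x p) \<in> carrier H"
    if "finite A" for A
    using that
  proof induction
    case empty
    then show ?case
      using hom[OF component_zero] by simp
  next
    case (insert p A)
    have "(\<Oplus>p\<in>insert p A. homogeneous_part H x p) =
        homogeneous_part H x p \<oplus> (\<Oplus>p\<in>A. homogeneous_part H x p)"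
      using insert(1,2) homogeneous_part_closed[OF x] by (intro alg.finsum_insert) auto
    then show ?case
      using insert(3) homogeneous_part_closed[OF x, of p] add
        hom[OF homogeneous_part_in_component[OF x, of p]] by auto
  qed
  from this[OF homogeneous_part_finite[OF x]] show ?thesis
    by (simp add: homogeneous_part_sum x)
qed

lemma linear_forms_eqI:
  assumes f: "linear_form H f" and g: "linear_form H g" and x: "x \<in> carrier H"
    and hom: "\<And>p x. x \<in> component H p \<Longrightarrow> f x = g x"
  shows "f x = g x"
  using x
proof (induction x rule: homogeneous_induct)
  case (add x y)
  then show ?case
    by (simp add: linear_formD(1)[OF f] linear_formD(1)[OF g])
qed (rule hom)

end

section \<open>The deformation by a skew bicharacter\<close>

text \<open>The factor by which the deformed product differs from the original one in degrees \<open>p\<close> and \<open>p'\<close>.\<close>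

definition twist :: "('g \<Rightarrow> 'g \<Rightarrow> 'k::field) \<Rightarrow> 'g \<times> 'g \<Rightarrow> 'g \<times> 'g \<Rightarrow> 'k" where
  "twist \<zeta> p p' = \<zeta> (fst p) (fst p') * inverse (\<zeta> (snd p) (snd p'))"

lemma deform_simps [simp]:
  "carrier (deform H \<zeta>) = carrier H" "\<zero>\<^bsub>deform H \<zeta>\<^esub> = \<zero>\<^bsub>H\<^esub>" "\<one>\<^bsub>deform H \<zeta>\<^esub> = \<one>\<^bsub>H\<^esub>"
  "ring.add (deform H \<zeta>) = ring.add H" "module.smult (deform H \<zeta>) = module.smult H"
  "monoid.mult (deform H \<zeta>) = deformed_mult H \<zeta>"
  "comult (deform H \<zeta>) = comult H" "counit (deform H \<zeta>) = counit H"
  "antipode (deform H \<zeta>) = antipode H" "component (deform H \<zeta>) = component H"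
  by (simp_all add: deform_def)

text \<open>Only the multiplication is deformed, so all notions that depend on the module structure alone are
  unchanged.\<close>

lemma deform_linear_structure [simp]:
  "add_monoid (deform H \<zeta>) = add_monoid H"
  "finsum (deform H \<zeta>) = finsum H"
  "comb_eval (deform H \<zeta>) = comb_eval H"
  "tensor_eq (deform H \<zeta>) = tensor_eq H"
  "tensor3_eq (deform H \<zeta>) = tensor3_eq H"
  "linear_form (deform H \<zeta>) = linear_form H"
  "bilinear_form (deform H \<zeta>) = bilinear_form H"
  "homogeneous_decomposition (deform H \<zeta>) = homogeneous_decomposition H"
proof -
  show add: "add_monoid (deform H \<zeta>) = add_monoid H"
    by simp
  show fs: "finsum (deform H \<zeta>) = finsum H"
    by (simp add: finsum_def add)
  show "comb_eval (deform H \<zeta>) = comb_eval H"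
    by (intro ext) (simp add: comb_eval_def fs)
  have tn: "tensor_null (deform H \<zeta>) = tensor_null H"
    by (simp add: tensor_null_def)
  show "tensor_eq (deform H \<zeta>) = tensor_eq H" "tensor3_eq (deform H \<zeta>) = tensor3_eq H"
    by (intro ext, simp add: tensor_eq_def tensor3_eq_def tensor3_null_def tn)+
  show lf: "linear_form (deform H \<zeta>) = linear_form H"
    by (intro ext) (simp add: linear_form_def)
  show "bilinear_form (deform H \<zeta>) = bilinear_form H"
    by (intro ext) (simp add: bilinear_form_def lf)
  show "homogeneous_decomposition (deform H \<zeta>) = homogeneous_decomposition H"
    by (intro ext) (simp add: homogeneous_decomposition_def fs)
qed

lemma bicharacter_zero:
  assumes "bicharacter \<zeta>"
  shows "\<zeta> 0 \<beta> = 1" "\<zeta> \<alpha> 0 = 1"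
proof -
  have "\<zeta> (0 + 0) \<beta> = \<zeta> 0 \<beta> * \<zeta> 0 \<beta>" "\<zeta> \<alpha> (0 + 0) = \<zeta> \<alpha> 0 * \<zeta> \<alpha> 0"
    "\<zeta> 0 \<beta> \<noteq> 0" "\<zeta> \<alpha> 0 \<noteq> 0"
    using assms unfolding bicharacter_def by blast+
  then show "\<zeta> 0 \<beta> = 1" "\<zeta> \<alpha> 0 = 1"
    by simp_all
qed

lemma bicharacter_uminus:
  assumes "bicharacter \<zeta>"
  shows "\<zeta> (- \<alpha>) \<beta> = inverse (\<zeta> \<alpha> \<beta>)" "\<zeta> \<alpha> (- \<beta>) = inverse (\<zeta> \<alpha> \<beta>)"
proof -
  have "\<zeta> (\<alpha> + - \<alpha>) \<beta> = \<zeta> \<alpha> \<beta> * \<zeta> (- \<alpha>) \<beta>" "\<zeta> \<alpha> (\<beta> + - \<beta>) = \<zeta> \<alpha> \<beta> * \<zeta> \<alpha> (- \<beta>)"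
    using assms unfolding bicharacter_def by blast+
  then have "\<zeta> \<alpha> \<beta> * \<zeta> (- \<alpha>) \<beta> = 1" "\<zeta> \<alpha> \<beta> * \<zeta> \<alpha> (- \<beta>) = 1"
    by (simp_all add: bicharacter_zero[OF assms])
  then show "\<zeta> (- \<alpha>) \<beta> = inverse (\<zeta> \<alpha> \<beta>)" "\<zeta> \<alpha> (- \<beta>) = inverse (\<zeta> \<alpha> \<beta>)"
    by (metis inverse_unique)+
qed

lemma twist_add:
  assumes "bicharacter \<zeta>"
  shows "twist \<zeta> (p + p') p'' = twist \<zeta> p p'' * twist \<zeta> p' p''"
    and "twist \<zeta> p (p' + p'') = twist \<zeta> p p' * twist \<zeta> p p''"
  using assms by (simp_all add: twist_def bicharacter_def)

lemma twist_nonzero: "bicharacter \<zeta> \<Longrightarrow> twist \<zeta> p p' \<noteq> 0"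
  by (simp add: twist_def bicharacter_def)

lemma twist_zero: "bicharacter \<zeta> \<Longrightarrow> twist \<zeta> (0, 0) p = 1" "bicharacter \<zeta> \<Longrightarrow> twist \<zeta> p (0, 0) = 1"
  by (simp_all add: twist_def bicharacter_zero)

locale twisted_hopf = bigraded_hopf_algebra H
  for H :: "('k::field, 'h, 'g::ab_group_add) bihopf" (structure) +
  fixes \<zeta> :: "'g \<Rightarrow> 'g \<Rightarrow> 'k"
  assumes skew: "skew_bicharacter \<zeta>"
begin

abbreviation deformed :: "'h \<Rightarrow> 'h \<Rightarrow> 'h" (infixl "\<circ>\<^sub>\<zeta>" 70) where
  "a \<circ>\<^sub>\<zeta> b \<equiv> deformed_mult H \<zeta> a b"

lemma bichar: "bicharacter \<zeta>"
  using skew by (simp add: skew_bicharacter_def)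

lemma deformed_mult_closed:
  assumes "a \<in> carrier H" "b \<in> carrier H"
  shows "a \<circ>\<^sub>\<zeta> b \<in> carrier H"
  unfolding deformed_mult_def using assms
  by (intro alg.finsum_closed Pi_I smult_closed alg.m_closed homogeneous_part_closed)

text \<open>Bilinearity of the deformed product compares sums over the supports of different elements.  The
  sets \<open>A\<close> and \<open>B\<close> allow all of them to be extended to the same range.\<close>

lemma linear_form_deformed_mult:
  assumes f: "linear_form H f" and a: "a \<in> carrier H" and b: "b \<in> carrier H"
    and A: "finite A" "{p. homogeneous_part H a p \<noteq> \<zero>} \<subseteq> A"
    and B: "finite B" "{p. homogeneous_part H b p \<noteq> \<zero>} \<subseteq> B"
  shows "f (a \<circ>\<^sub>\<zeta> b) =
    (\<Sum>p\<in>A. \<Sum>p'\<in>B. twist \<zeta> p p' * f (homogeneous_part H a p \<otimes> homogeneous_part H b p'))"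
proof -
  let ?A = "{p. homogeneous_part H a p \<noteq> \<zero>}" and ?B = "{p. homogeneous_part H b p \<noteq> \<zero>}"
  let ?t = "\<lambda>p p'. homogeneous_part H a p \<otimes> homogeneous_part H b p'"
  have cl: "?t p p' \<in> carrier H" for p p'
    using a b by (simp add: homogeneous_part_closed)
  have "f (a \<circ>\<^sub>\<zeta> b) = (\<Sum>p\<in>?A. f (\<Oplus>p'\<in>?B. twist \<zeta> p p' \<odot> ?t p p'))"
    unfolding deformed_mult_def twist_def[symmetric]
    by (rule linear_form_finsum[OF f homogeneous_part_finite[OF a]])
      (use cl in \<open>auto intro!: alg.finsum_closed smult_closed\<close>)
  also have "\<dots> = (\<Sum>p\<in>?A. \<Sum>p'\<in>?B. f (twist \<zeta> p p' \<odot> ?t p p'))"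
    by (intro sum.cong refl linear_form_finsum[OF f homogeneous_part_finite[OF b]])
      (use cl in \<open>auto intro!: smult_closed\<close>)
  also have "\<dots> = (\<Sum>p\<in>?A. \<Sum>p'\<in>?B. twist \<zeta> p p' * f (?t p p'))"
    by (simp add: linear_formD(2)[OF f cl])
  also have "\<dots> = (\<Sum>p\<in>?A. \<Sum>p'\<in>B. twist \<zeta> p p' * f (?t p p'))"
    by (intro sum.cong refl sum.mono_neutral_left[OF B])
      (use a linear_form_zero[OF f] in \<open>auto simp: homogeneous_part_closed\<close>)
  also have "\<dots> = (\<Sum>p\<in>A. \<Sum>p'\<in>B. twist \<zeta> p p' * f (?t p p'))"
    by (intro sum.mono_neutral_left[OF A] ballI sum.neutral)
      (use b linear_form_zero[OF f] in \<open>auto simp: homogeneous_part_closed\<close>)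
  finally show ?thesis .
qed

lemma deformed_mult_add_left:
  assumes a: "a \<in> carrier H" and a': "a' \<in> carrier H" and b: "b \<in> carrier H"
  shows "(a \<oplus> a') \<circ>\<^sub>\<zeta> b = a \<circ>\<^sub>\<zeta> b \<oplus> a' \<circ>\<^sub>\<zeta> b"
proof (rule forms_separate_points)
  fix f assume f: "linear_form H f"
  let ?A = "{p. homogeneous_part H a p \<noteq> \<zero>} \<union> {p. homogeneous_part H a' p \<noteq> \<zero>}"
  let ?B = "{p. homogeneous_part H b p \<noteq> \<zero>}"
  have fin: "finite ?A" "finite ?B"
    using a a' b by (simp_all add: homogeneous_part_finite)
  have sub: "{p. homogeneous_part H (a \<oplus> a') p \<noteq> \<zero>} \<subseteq> ?A"
    using a a' by (auto simp: homogeneous_part_add)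
  have "f ((a \<oplus> a') \<circ>\<^sub>\<zeta> b) = f (a \<circ>\<^sub>\<zeta> b) + f (a' \<circ>\<^sub>\<zeta> b)"
    unfolding linear_form_deformed_mult[OF f alg.a_closed[OF a a'] b fin(1) sub fin(2) subset_refl]
    using a a' b
    by (simp add: linear_form_deformed_mult[OF f _ b fin(1) _ fin(2) subset_refl]
        homogeneous_part_add alg.l_distr homogeneous_part_closed linear_formD(1)[OF f]
        distrib_left sum.distrib)
  then show "f ((a \<oplus> a') \<circ>\<^sub>\<zeta> b) = f (a \<circ>\<^sub>\<zeta> b \<oplus> a' \<circ>\<^sub>\<zeta> b)"
    using assms by (simp add: linear_formD(1)[OF f] deformed_mult_closed)
qed (use assms in \<open>auto intro!: deformed_mult_closed\<close>)

lemma deformed_mult_add_right: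
  assumes a: "a \<in> carrier H" and b: "b \<in> carrier H" and b': "b' \<in> carrier H"
  shows "a \<circ>\<^sub>\<zeta> (b \<oplus> b') = a \<circ>\<^sub>\<zeta> b \<oplus> a \<circ>\<^sub>\<zeta> b'"
proof (rule forms_separate_points)
  fix f assume f: "linear_form H f"
  let ?B = "{p. homogeneous_part H b p \<noteq> \<zero>} \<union> {p. homogeneous_part H b' p \<noteq> \<zero>}"
  let ?A = "{p. homogeneous_part H a p \<noteq> \<zero>}"
  have fin: "finite ?A" "finite ?B"
    using a b b' by (simp_all add: homogeneous_part_finite)
  have sub: "{p. homogeneous_part H (b \<oplus> b') p \<noteq> \<zero>} \<subseteq> ?B"
    using b b' by (auto simp: homogeneous_part_add)
  have "f (a \<circ>\<^sub>\<zeta> (b \<oplus> b')) = f (a \<circ>\<^sub>\<zeta> b) + f (a \<circ>\<^sub>\<zeta> b')"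
    unfolding linear_form_deformed_mult[OF f a alg.a_closed[OF b b'] fin(1) subset_refl fin(2) sub]
    using a b b'
    by (simp add: linear_form_deformed_mult[OF f a _ fin(1) subset_refl fin(2)]
        homogeneous_part_add alg.r_distr homogeneous_part_closed linear_formD(1)[OF f]
        distrib_left sum.distrib)
  then show "f (a \<circ>\<^sub>\<zeta> (b \<oplus> b')) = f (a \<circ>\<^sub>\<zeta> b \<oplus> a \<circ>\<^sub>\<zeta> b')"
    using assms by (simp add: linear_formD(1)[OF f] deformed_mult_closed)
qed (use assms in \<open>auto intro!: deformed_mult_closed\<close>)

lemma deformed_mult_smult:
  assumes a: "a \<in> carrier H" and b: "b \<in> carrier H"
  shows "(c \<odot> a) \<circ>\<^sub>\<zeta> b = c \<odot> (a \<circ>\<^sub>\<zeta> b)" "a \<circ>\<^sub>\<zeta> (c \<odot> b) = c \<odot> (a \<circ>\<^sub>\<zeta> b)"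
proof -
  let ?A = "{p. homogeneous_part H a p \<noteq> \<zero>}" and ?B = "{p. homogeneous_part H b p \<noteq> \<zero>}"
  have fin: "finite ?A" "finite ?B"
    using a b by (simp_all add: homogeneous_part_finite)
  have sub: "{p. homogeneous_part H (c \<odot> a) p \<noteq> \<zero>} \<subseteq> ?A" "{p. homogeneous_part H (c \<odot> b) p \<noteq> \<zero>} \<subseteq> ?B"
    using a b by (auto simp: homogeneous_part_smult smult_zero)
  have "f ((c \<odot> a) \<circ>\<^sub>\<zeta> b) = c * f (a \<circ>\<^sub>\<zeta> b)" "f (a \<circ>\<^sub>\<zeta> (c \<odot> b)) = c * f (a \<circ>\<^sub>\<zeta> b)"
    if f: "linear_form H f" for f
    unfolding linear_form_deformed_mult[OF f smult_closed[OF a] b fin(1) sub(1) fin(2) subset_refl]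
      linear_form_deformed_mult[OF f a smult_closed[OF b] fin(1) subset_refl fin(2) sub(2)]
      linear_form_deformed_mult[OF f a b fin(1) subset_refl fin(2) subset_refl]
    using a b
    by (simp_all add: smult_closed
        homogeneous_part_smult smult_mult_left smult_mult_right homogeneous_part_closed
        linear_formD(2)[OF f] sum_distrib_left mult.left_commute)
  then show "(c \<odot> a) \<circ>\<^sub>\<zeta> b = c \<odot> (a \<circ>\<^sub>\<zeta> b)" "a \<circ>\<^sub>\<zeta> (c \<odot> b) = c \<odot> (a \<circ>\<^sub>\<zeta> b)"
    using a b
    by (auto intro!: forms_separate_points deformed_mult_closed smult_closed
        simp: linear_formD(2) deformed_mult_closed)
qed

lemma deformed_mult_homogeneous:
  assumes a: "a \<in> component H p" and b: "b \<in> component H p'"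
  shows "a \<circ>\<^sub>\<zeta> b = twist \<zeta> p p' \<odot> (a \<otimes> b)"
proof -
  have ab: "a \<in> carrier H" "b \<in> carrier H"
    using a b component_closed by blast+
  have "f (a \<circ>\<^sub>\<zeta> b) = twist \<zeta> p p' * f (a \<otimes> b)" if f: "linear_form H f" for f
    by (subst linear_form_deformed_mult[OF f ab, of "{p}" "{p'}"])
      (auto simp: homogeneous_part_homogeneous[OF a] homogeneous_part_homogeneous[OF b])
  then show ?thesis
    using ab by (auto intro!: forms_separate_points deformed_mult_closed smult_closed simp: linear_formD(2))
qed

lemma deformed_mult_component:
  "x \<in> component H p \<Longrightarrow> y \<in> component H p' \<Longrightarrow> x \<circ>\<^sub>\<zeta> y \<in> component H (p + p')"
  by (simp add: deformed_mult_homogeneous component_smult mult_component)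

lemma deformed_mult_assoc:
  assumes "a \<in> carrier H" "b \<in> carrier H" "c \<in> carrier H"
  shows "a \<circ>\<^sub>\<zeta> b \<circ>\<^sub>\<zeta> c = a \<circ>\<^sub>\<zeta> (b \<circ>\<^sub>\<zeta> c)"
  using assms
proof (induction a rule: homogeneous_induct)
  case (homogeneous p a)
  from homogeneous(2,3) show ?case
  proof (induction b rule: homogeneous_induct)
    case (homogeneous p' b)
    from homogeneous(2) show ?case
    proof (induction c rule: homogeneous_induct)
      case (homogeneous p'' c)
      note a = \<open>a \<in> component H p\<close> and b = \<open>b \<in> component H p'\<close>
      note cl = component_closed[OF a] component_closed[OF b] component_closed[OF homogeneous]
      have "a \<circ>\<^sub>\<zeta> b \<circ>\<^sub>\<zeta> c = twist \<zeta> (p + p') p'' \<odot> ((a \<circ>\<^sub>\<zeta> b) \<otimes> c)"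
        by (rule deformed_mult_homogeneous[OF deformed_mult_component[OF a b] homogeneous])
      also have "\<dots> = (twist \<zeta> (p + p') p'' * twist \<zeta> p p') \<odot> (a \<otimes> b \<otimes> c)"
        using cl by (simp add: deformed_mult_homogeneous[OF a b] smult_mult_left smult_smult)
      also have "\<dots> = (twist \<zeta> p (p' + p'') * twist \<zeta> p' p'') \<odot> (a \<otimes> (b \<otimes> c))"
        using cl by (simp add: twist_add[OF bichar] alg.m_assoc ac_simps)
      also have "\<dots> = twist \<zeta> p (p' + p'') \<odot> (a \<otimes> (b \<circ>\<^sub>\<zeta> c))"
        using cl by (simp add: deformed_mult_homogeneous[OF b homogeneous] smult_mult_right smult_smult)
      also have "\<dots> = a \<circ>\<^sub>\<zeta> (b \<circ>\<^sub>\<zeta> c)"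
        by (rule deformed_mult_homogeneous[OF a deformed_mult_component[OF b homogeneous], symmetric])
      finally show ?case .
    next
      case (add x y)
      then show ?case
        using component_closed[OF \<open>a \<in> component H p\<close>] component_closed[OF \<open>b \<in> component H p'\<close>]
        by (simp add: deformed_mult_add_right deformed_mult_closed)
    qed
  next
    case (add x y)
    then show ?case
      using component_closed[OF \<open>a \<in> component H p\<close>]
      by (simp add: deformed_mult_add_right deformed_mult_add_left deformed_mult_closed)
  qed
next
  case (add x y)
  then show ?case
    by (simp add: deformed_mult_add_left deformed_mult_closed)
qed

lemma deformed_mult_one:
  assumes "a \<in> carrier H"
  shows "\<one> \<circ>\<^sub>\<zeta> a = a" "a \<circ>\<^sub>\<zeta> \<one> = a"
  using assms
  by (induction a rule: homogeneous_induct)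
    (simp_all add: deformed_mult_homogeneous[OF one_degree] deformed_mult_homogeneous[OF _ one_degree]
      twist_zero[OF bichar] component_closed smult_1 deformed_mult_add_left deformed_mult_add_right)

lemma assoc_algebra_deform: "assoc_algebra (deform H \<zeta>)"
proof (rule assoc_algebra.intro)
  interpret M: Module.module "ring_of_type_algebra :: 'k ring" H
    by (rule module)
  have ab: "abelian_group (deform H \<zeta>)"
    using alg.abelian_group_axioms
    unfolding abelian_group_def abelian_monoid_def abelian_group_axioms_def deform_linear_structure .
  then show "Module.module (ring_of_type_algebra :: 'k ring) (deform H \<zeta>)"
    by (intro moduleI)
      (auto simp: M.smult_l_distr M.smult_r_distr M.smult_assoc1 M.is_cring)
  show "Ring.ring (deform H \<zeta>)"
    by (intro ringI monoidI ab)
      (simp_all add: deformed_mult_closed deformed_mult_assoc deformed_mult_one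
        deformed_mult_add_left deformed_mult_add_right)
qed (simp_all add: deformed_mult_smult)

text \<open>A representative of $\Delta(x)$ that shows the grading: the inner degrees of the two tensor
  factors are opposite to each other.\<close>

lemma homogeneous_comult:
  assumes x: "x \<in> component H (\<alpha>, \<beta>)"
  obtains t where
    "\<And>f. bilinear_form H f \<Longrightarrow>
       pairing (\<lambda>(x, y). f x y) (comult H x) = pairing (\<lambda>(x, y). f x y) t"
    and "\<And>y z. (y, z) \<in> Poly_Mapping.keys t \<Longrightarrow>
       \<exists>\<gamma>. y \<in> component H (\<alpha>, \<gamma>) \<and> z \<in> component H (- \<gamma>, \<beta>)"
    and "Poly_Mapping.keys t \<subseteq> carrier H \<times> carrier H"
proof -
  obtain t where t: "tensor_eq H (comult H x) t"
    and k: "Poly_Mapping.keys t \<subseteq> (\<Union>\<gamma>. component H (\<alpha>, \<gamma>) \<times> component H (- \<gamma>, \<beta>))"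
    using comult_degree[OF x] by blast
  show ?thesis
  proof (rule that)
    show "pairing (\<lambda>(x, y). f x y) (comult H x) = pairing (\<lambda>(x, y). f x y) t"
      if "bilinear_form H f" for f
      using t that by (simp add: tensor_eq_forms)
    show "\<exists>\<gamma>. y \<in> component H (\<alpha>, \<gamma>) \<and> z \<in> component H (- \<gamma>, \<beta>)"
      if "(y, z) \<in> Poly_Mapping.keys t" for y z
      using that k by blast
    show "Poly_Mapping.keys t \<subseteq> carrier H \<times> carrier H"
      using k component_closed by blast
  qed
qed

lemma bilinear_form_deformed_mult:
  assumes f: "bilinear_form H f" and t: "Poly_Mapping.keys t \<subseteq> carrier H \<times> carrier H"
  shows "bilinear_form H (\<lambda>x y. pairing (\<lambda>(x', y'). f (x \<circ>\<^sub>\<zeta> x') (y \<circ>\<^sub>\<zeta> y')) t)"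
    and "bilinear_form H (\<lambda>x y. pairing (\<lambda>(x', y'). f (x' \<circ>\<^sub>\<zeta> x) (y' \<circ>\<^sub>\<zeta> y)) t)"
  using assoc_algebra.bilinear_form_mult[OF assoc_algebra_deform, of f t] assms by simp_all

lemma bicharacter_at_negatives:
  "\<zeta> \<alpha> (- \<alpha>) = 1" "\<zeta> (- \<alpha>) \<alpha> = 1" "\<zeta> (- \<alpha>) (- \<beta>) = \<zeta> \<alpha> \<beta>"
proof -
  have "\<zeta> \<alpha> \<alpha> = 1"
    using skew unfolding skew_bicharacter_def by blast
  then show "\<zeta> \<alpha> (- \<alpha>) = 1" "\<zeta> (- \<alpha>) \<alpha> = 1" "\<zeta> (- \<alpha>) (- \<beta>) = \<zeta> \<alpha> \<beta>"
    by (simp_all add: bicharacter_uminus[OF bichar])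
qed

text \<open>Multiply terms of degrees $(\alpha,\gamma) \otimes (-\gamma,\beta)$ and
  $(\alpha',\gamma') \otimes (-\gamma',\beta')$.  The deformation contributes
  $\zeta(\alpha,\alpha')\zeta(\gamma,\gamma')^{-1} \cdot \zeta(-\gamma,-\gamma')\zeta(\beta,\beta')^{-1}$,
  where the factors with $\gamma$ cancel.  What remains is the factor of the product of the two
  elements themselves.\<close>

lemma comult_deformed_mult_homogeneous:
  assumes f: "bilinear_form H f" and a: "a \<in> component H (\<alpha>, \<beta>)" and b: "b \<in> component H (\<alpha>', \<beta>')"
  shows "pairing (\<lambda>(x, y). f x y) (comult H (a \<circ>\<^sub>\<zeta> b)) =
    pairing (\<lambda>(x, y). pairing (\<lambda>(x', y'). f (x \<circ>\<^sub>\<zeta> x') (y \<circ>\<^sub>\<zeta> y')) (comult H b)) (comult H a)"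
proof -
  let ?c = "twist \<zeta> (\<alpha>, \<beta>) (\<alpha>', \<beta>')"
  note cl = component_closed[OF a] component_closed[OF b]
  obtain t where t: "\<And>f. bilinear_form H f \<Longrightarrow>
       pairing (\<lambda>(x, y). f x y) (comult H a) = pairing (\<lambda>(x, y). f x y) t"
    and tk: "\<And>y z. (y, z) \<in> Poly_Mapping.keys t \<Longrightarrow>
       \<exists>\<gamma>. y \<in> component H (\<alpha>, \<gamma>) \<and> z \<in> component H (- \<gamma>, \<beta>)"
    and tc: "Poly_Mapping.keys t \<subseteq> carrier H \<times> carrier H"
    using homogeneous_comult[OF a] by metis
  obtain u where u: "\<And>f. bilinear_form H f \<Longrightarrow>
       pairing (\<lambda>(x, y). f x y) (comult H b) = pairing (\<lambda>(x, y). f x y) u"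
    and uk: "\<And>y z. (y, z) \<in> Poly_Mapping.keys u \<Longrightarrow>
       \<exists>\<gamma>. y \<in> component H (\<alpha>', \<gamma>) \<and> z \<in> component H (- \<gamma>, \<beta>')"
    using homogeneous_comult[OF b] by metis
  have key: "f (x \<circ>\<^sub>\<zeta> x') (y \<circ>\<^sub>\<zeta> y') = ?c * f (x \<otimes> x') (y \<otimes> y')"
    if xy: "(x, y) \<in> Poly_Mapping.keys t" and xy': "(x', y') \<in> Poly_Mapping.keys u" for x y x' y'
  proof -
    obtain \<gamma> \<gamma>' where g: "x \<in> component H (\<alpha>, \<gamma>)" "y \<in> component H (- \<gamma>, \<beta>)"
      "x' \<in> component H (\<alpha>', \<gamma>')" "y' \<in> component H (- \<gamma>', \<beta>')"
      using tk[OF xy] uk[OF xy'] by blast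
    note gc = g[THEN component_closed]
    have "f (x \<circ>\<^sub>\<zeta> x') (y \<circ>\<^sub>\<zeta> y') =
        twist \<zeta> (\<alpha>, \<gamma>) (\<alpha>', \<gamma>') * (twist \<zeta> (- \<gamma>, \<beta>) (- \<gamma>', \<beta>') * f (x \<otimes> x') (y \<otimes> y'))"
      using gc
      by (simp add: deformed_mult_homogeneous[OF g(1,3)] deformed_mult_homogeneous[OF g(2,4)]
          linear_formD(2)[OF bilinear_formD(1)[OF f]] linear_formD(2)[OF bilinear_formD(2)[OF f]] smult_closed)
    moreover have "twist \<zeta> (\<alpha>, \<gamma>) (\<alpha>', \<gamma>') * twist \<zeta> (- \<gamma>, \<beta>) (- \<gamma>', \<beta>') = ?c"
      using bichar by (simp add: twist_def bicharacter_at_negatives bicharacter_def)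
    ultimately show ?thesis
      by (simp add: mult.assoc[symmetric])
  qed
  have "pairing (\<lambda>(x, y). pairing (\<lambda>(x', y'). f (x \<circ>\<^sub>\<zeta> x') (y \<circ>\<^sub>\<zeta> y')) (comult H b)) (comult H a) =
      pairing (\<lambda>(x, y). pairing (\<lambda>(x', y'). f (x \<circ>\<^sub>\<zeta> x') (y \<circ>\<^sub>\<zeta> y')) (comult H b)) t"
    by (rule t[OF bilinear_form_deformed_mult(1)[OF f comult_closed[OF cl(2)]]])
  also have "\<dots> = pairing (\<lambda>(x, y). pairing (\<lambda>(x', y'). f (x \<circ>\<^sub>\<zeta> x') (y \<circ>\<^sub>\<zeta> y')) u) t"
  proof (rule pairing_cong, clarify)
    fix x y assume "(x, y) \<in> Poly_Mapping.keys t"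
    then have "x \<in> carrier H" "y \<in> carrier H"
      using tc by auto
    then have "bilinear_form H (\<lambda>x' y'. f (x \<circ>\<^sub>\<zeta> x') (y \<circ>\<^sub>\<zeta> y'))"
      using assoc_algebra.bilinear_form_translate(2)[OF assoc_algebra_deform, of f x y] f by simp
    then show "pairing (\<lambda>(x', y'). f (x \<circ>\<^sub>\<zeta> x') (y \<circ>\<^sub>\<zeta> y')) (comult H b) =
      pairing (\<lambda>(x', y'). f (x \<circ>\<^sub>\<zeta> x') (y \<circ>\<^sub>\<zeta> y')) u"
      by (rule u)
  qed
  also have "\<dots> = pairing (\<lambda>(x, y). ?c * pairing (\<lambda>(x', y'). f (x \<otimes> x') (y \<otimes> y')) u) t"
    unfolding pairing_fun_scale[symmetric]
    by (intro pairing_cong) (auto intro!: pairing_cong simp: key)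
  also have "\<dots> = ?c * pairing (\<lambda>(x, y). pairing (\<lambda>(x', y'). f (x \<otimes> x') (y \<otimes> y')) u) t"
    by (simp add: case_prod_unfold pairing_fun_scale)
  also have "pairing (\<lambda>(x, y). pairing (\<lambda>(x', y'). f (x \<otimes> x') (y \<otimes> y')) u) t =
      pairing (\<lambda>(x, y). pairing (\<lambda>(x', y'). f (x \<otimes> x') (y \<otimes> y')) (comult H b)) t"
  proof (rule pairing_cong, clarify)
    fix x y assume "(x, y) \<in> Poly_Mapping.keys t"
    then have "bilinear_form H (\<lambda>x' y'. f (x \<otimes> x') (y \<otimes> y'))"
      using tc by (intro bilinear_form_translate(2)[OF f]) auto
    then show "pairing (\<lambda>(x', y'). f (x \<otimes> x') (y \<otimes> y')) u =
      pairing (\<lambda>(x', y'). f (x \<otimes> x') (y \<otimes> y')) (comult H b)"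
      by (rule u[symmetric])
  qed
  also have "\<dots> = pairing (\<lambda>(x, y). pairing (\<lambda>(x', y'). f (x \<otimes> x') (y \<otimes> y')) (comult H b)) (comult H a)"
    by (rule t[OF bilinear_form_mult(1)[OF f comult_closed[OF cl(2)]], symmetric])
  also have "\<dots> = pairing (\<lambda>(x, y). f x y) (comult H (a \<otimes> b))"
    by (rule pairing_comult_mult[OF f cl, symmetric])
  also have "?c * \<dots> = pairing (\<lambda>(x, y). f x y) (comult H (a \<circ>\<^sub>\<zeta> b))"
    unfolding deformed_mult_homogeneous[OF a b]
    using cl by (intro linear_formD(2)[OF linear_form_comult[OF f], symmetric]) simp
  finally show ?thesis
    by simp
qed

lemma comult_deformed_mult:
  assumes f: "bilinear_form H f" and "a \<in> carrier H" "b \<in> carrier H"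
  shows "pairing (\<lambda>(x, y). f x y) (comult H (a \<circ>\<^sub>\<zeta> b)) =
    pairing (\<lambda>(x, y). pairing (\<lambda>(x', y'). f (x \<circ>\<^sub>\<zeta> x') (y \<circ>\<^sub>\<zeta> y')) (comult H b)) (comult H a)"
  using assms(2,3)
proof (induction a rule: homogeneous_induct)
  case (homogeneous p a)
  from homogeneous(2) show ?case
  proof (induction b rule: homogeneous_induct)
    case (homogeneous p' b)
    with \<open>a \<in> component H p\<close> show ?case
      by (cases p; cases p') (simp add: comult_deformed_mult_homogeneous[OF f])
  next
    case (add b b')
    have a: "a \<in> carrier H"
      using component_closed \<open>a \<in> component H p\<close> by blast
    have lin: "linear_form H (\<lambda>b. pairing (\<lambda>(x', y').
        pairing (\<lambda>(x, y). f (x \<circ>\<^sub>\<zeta> x') (y \<circ>\<^sub>\<zeta> y')) (comult H a)) (comult H b))"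
      using linear_form_comult[OF bilinear_form_deformed_mult(2)[OF f comult_closed[OF a]]] .
    have swap: "pairing (\<lambda>(x, y). pairing (\<lambda>(x', y'). f (x \<circ>\<^sub>\<zeta> x') (y \<circ>\<^sub>\<zeta> y')) (comult H b)) (comult H a)
      = pairing (\<lambda>(x', y'). pairing (\<lambda>(x, y). f (x \<circ>\<^sub>\<zeta> x') (y \<circ>\<^sub>\<zeta> y')) (comult H a)) (comult H b)" for b
      unfolding case_prod_unfold by (rule pairing_swap)
    from add show ?case
      unfolding swap deformed_mult_add_right[OF a add(1,2)]
      using linear_formD(1)[OF lin add(1,2)] linear_formD(1)[OF linear_form_comult[OF f]] a
      by (simp add: deformed_mult_closed)
  qed
next
  case (add a a')
  show ?case
    unfolding deformed_mult_add_left[OF add(1,2,5)]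
    using add linear_formD(1)[OF linear_form_comult[OF f]]
      linear_formD(1)[OF linear_form_comult[OF bilinear_form_deformed_mult(1)[OF f comult_closed[OF add(5)]]] add(1,2)]
    by (simp add: deformed_mult_closed)
qed

text \<open>The counit lives in the degrees $(\alpha,-\alpha)$, and between two such degrees the twist is $1$.\<close>

lemma counit_deformed_mult:
  assumes "a \<in> carrier H" "b \<in> carrier H"
  shows "counit H (a \<circ>\<^sub>\<zeta> b) = counit H a * counit H b"
  using assms
proof (induction a rule: homogeneous_induct)
  case (homogeneous p a)
  from homogeneous(2) show ?case
  proof (induction b rule: homogeneous_induct)
    case (homogeneous p' b)
    note a = \<open>a \<in> component H p\<close>
    note cl = component_closed[OF a] component_closed[OF homogeneous]
    have "counit H (a \<circ>\<^sub>\<zeta> b) = twist \<zeta> p p' * (counit H a * counit H b)"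
      unfolding deformed_mult_homogeneous[OF a homogeneous]
      using cl by (simp add: counit_smult counit_mult)
    moreover have "counit H a = 0 \<or> counit H b = 0 \<or> twist \<zeta> p p' = 1"
    proof (cases "fst p = - snd p \<and> fst p' = - snd p'")
      case True
      then show ?thesis
        using bichar by (simp add: twist_def bicharacter_at_negatives bicharacter_def)
    next
      case False
      then show ?thesis
        using counit_degree[of a "fst p" "snd p"] counit_degree[of b "fst p'" "snd p'"] a homogeneous
        by auto
    qed
    ultimately show ?case
      by auto
  next
    case (add x y)
    with component_closed[OF \<open>a \<in> component H p\<close>] show ?case
      by (simp add: deformed_mult_add_right counit_add deformed_mult_closed distrib_left)
  qed
next
  case (add x y)
  then show ?case
    by (simp add: deformed_mult_add_left counit_add deformed_mult_closed distrib_right)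
qed

text \<open>For $x$ of degree $(\alpha,\beta)$ the product of $S(x_{(1)})$, of degree $(\gamma,\alpha)$, with
  $x_{(2)}$, of degree $(-\gamma,\beta)$, is deformed by $\zeta(\alpha,\beta)^{-1}$ since
  $\zeta(\gamma,-\gamma) = 1$.  This factor is the same for all terms, and it is $1$ whenever
  $\varepsilon(x) \neq 0$.\<close>

lemma deformed_antipode_left:
  assumes x: "x \<in> carrier H"
  shows "comb_eval H (\<lambda>(y, z). antipode H y \<circ>\<^sub>\<zeta> z) (comult H x) = counit H x \<odot> \<one>"
proof (rule forms_separate_points)
  have cl: "(\<lambda>(y, z). antipode H y \<circ>\<^sub>\<zeta> z) yz \<in> carrier H" "(\<lambda>(y, z). antipode H y \<otimes> z) yz \<in> carrier H"
    if "yz \<in> Poly_Mapping.keys (comult H x)" "x \<in> carrier H" for x yz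
    using subsetD[OF comult_closed[OF that(2)] that(1)]
    by (simp_all add: mem_Times_iff case_prod_unfold deformed_mult_closed antipode_closed)
  then show "comb_eval H (\<lambda>(y, z). antipode H y \<circ>\<^sub>\<zeta> z) (comult H x) \<in> carrier H"
    using x by (intro comb_eval_closed)
  show "counit H x \<odot> \<one> \<in> carrier H"
    by (simp add: smult_closed)
  fix f assume f: "linear_form H f"
  have bil: "bilinear_form H (\<lambda>y z. f (antipode H y \<circ>\<^sub>\<zeta> z))" "bilinear_form H (\<lambda>y z. f (antipode H y \<otimes> z))"
    by (auto intro!: bilinear_formI linear_formI
        simp: antipode_closed antipode_add antipode_smult deformed_mult_add_left deformed_mult_add_right
          deformed_mult_smult deformed_mult_closed alg.l_distr alg.r_distr smult_mult_left smult_mult_right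
          linear_formD[OF f])
  have "f (comb_eval H (\<lambda>(y, z). antipode H y \<circ>\<^sub>\<zeta> z) (comult H x)) =
      pairing (\<lambda>(y, z). f (antipode H y \<circ>\<^sub>\<zeta> z)) (comult H x)"
    using x cl by (subst linear_form_comb_eval[OF f]) (auto simp: case_prod_unfold)
  also have "\<dots> = counit H x * f \<one>"
  proof (rule linear_forms_eqI[OF linear_form_comult[OF bil(1)] _ x])
    show "linear_form H (\<lambda>x. counit H x * f \<one>)"
      by (simp add: linear_form_def counit_add counit_smult distrib_right mult.assoc)
    fix p x assume xp: "x \<in> component H p"
    obtain \<alpha> \<beta> where p: "p = (\<alpha>, \<beta>)"
      by force
    have x: "x \<in> carrier H"
      using component_closed[OF xp] .
    let ?c = "inverse (\<zeta> \<alpha> \<beta>)"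
    obtain t where t: "\<And>f. bilinear_form H f \<Longrightarrow>
         pairing (\<lambda>(x, y). f x y) (comult H x) = pairing (\<lambda>(x, y). f x y) t"
      and tk: "\<And>y z. (y, z) \<in> Poly_Mapping.keys t \<Longrightarrow>
         \<exists>\<gamma>. y \<in> component H (\<alpha>, \<gamma>) \<and> z \<in> component H (- \<gamma>, \<beta>)"
      using homogeneous_comult[OF xp[unfolded p]] by metis
    have key: "f (antipode H y \<circ>\<^sub>\<zeta> z) = ?c * f (antipode H y \<otimes> z)"
      if yz: "(y, z) \<in> Poly_Mapping.keys t" for y z
    proof -
      obtain \<gamma> where g: "y \<in> component H (\<alpha>, \<gamma>)" "z \<in> component H (- \<gamma>, \<beta>)"
        using tk[OF yz] by blast
      have "f (antipode H y \<circ>\<^sub>\<zeta> z) = twist \<zeta> (\<gamma>, \<alpha>) (- \<gamma>, \<beta>) * f (antipode H y \<otimes> z)"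
        unfolding deformed_mult_homogeneous[OF antipode_degree[OF g(1)] g(2)]
        using g[THEN component_closed] by (simp add: linear_formD(2)[OF f] antipode_closed)
      then show ?thesis
        by (simp add: twist_def bicharacter_at_negatives)
    qed
    have "pairing (\<lambda>(y, z). f (antipode H y \<circ>\<^sub>\<zeta> z)) (comult H x) =
        pairing (\<lambda>(y, z). ?c * f (antipode H y \<otimes> z)) t"
      unfolding t[OF bil(1)] by (rule pairing_cong) (auto simp: key)
    also have "\<dots> = ?c * pairing (\<lambda>(y, z). f (antipode H y \<otimes> z)) (comult H x)"
      unfolding t[OF bil(2)] pairing_fun_scale[symmetric] by (simp add: case_prod_unfold)
    also have "pairing (\<lambda>(y, z). f (antipode H y \<otimes> z)) (comult H x) =
        f (comb_eval H (\<lambda>(y, z). antipode H y \<otimes> z) (comult H x))"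
      using x cl by (subst linear_form_comb_eval[OF f]) (auto simp: case_prod_unfold)
    also have "\<dots> = counit H x * f \<one>"
      using x by (simp add: antipode_left linear_formD(2)[OF f])
    also have "?c * (counit H x * f \<one>) = counit H x * f \<one>"
      using counit_degree[OF xp[unfolded p]]
      by (cases "\<alpha> = - \<beta>") (simp_all add: bicharacter_at_negatives)
    finally show "pairing (\<lambda>(y, z). f (antipode H y \<circ>\<^sub>\<zeta> z)) (comult H x) = counit H x * f \<one>" .
  qed
  also have "\<dots> = f (counit H x \<odot> \<one>)"
    by (simp add: linear_formD(2)[OF f])
  finally show "f (comb_eval H (\<lambda>(y, z). antipode H y \<circ>\<^sub>\<zeta> z) (comult H x)) = f (counit H x \<odot> \<one>)" .
qed

text \<open>Symmetric to the previous lemma: now every term is deformed by $\zeta(\alpha,\beta)$.\<close>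

lemma deformed_antipode_right:
  assumes x: "x \<in> carrier H"
  shows "comb_eval H (\<lambda>(y, z). y \<circ>\<^sub>\<zeta> antipode H z) (comult H x) = counit H x \<odot> \<one>"
proof (rule forms_separate_points)
  have cl: "(\<lambda>(y, z). y \<circ>\<^sub>\<zeta> antipode H z) yz \<in> carrier H" "(\<lambda>(y, z). y \<otimes> antipode H z) yz \<in> carrier H"
    if "yz \<in> Poly_Mapping.keys (comult H x)" "x \<in> carrier H" for x yz
    using subsetD[OF comult_closed[OF that(2)] that(1)]
    by (simp_all add: mem_Times_iff case_prod_unfold deformed_mult_closed antipode_closed)
  then show "comb_eval H (\<lambda>(y, z). y \<circ>\<^sub>\<zeta> antipode H z) (comult H x) \<in> carrier H"
    using x by (intro comb_eval_closed)
  show "counit H x \<odot> \<one> \<in> carrier H"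
    by (simp add: smult_closed)
  fix f assume f: "linear_form H f"
  have bil: "bilinear_form H (\<lambda>y z. f (y \<circ>\<^sub>\<zeta> antipode H z))" "bilinear_form H (\<lambda>y z. f (y \<otimes> antipode H z))"
    by (auto intro!: bilinear_formI linear_formI
        simp: antipode_closed antipode_add antipode_smult deformed_mult_add_left deformed_mult_add_right
          deformed_mult_smult deformed_mult_closed alg.l_distr alg.r_distr smult_mult_left smult_mult_right
          linear_formD[OF f])
  have "f (comb_eval H (\<lambda>(y, z). y \<circ>\<^sub>\<zeta> antipode H z) (comult H x)) =
      pairing (\<lambda>(y, z). f (y \<circ>\<^sub>\<zeta> antipode H z)) (comult H x)"
    using x cl by (subst linear_form_comb_eval[OF f]) (auto simp: case_prod_unfold)
  also have "\<dots> = counit H x * f \<one>"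
  proof (rule linear_forms_eqI[OF linear_form_comult[OF bil(1)] _ x])
    show "linear_form H (\<lambda>x. counit H x * f \<one>)"
      by (simp add: linear_form_def counit_add counit_smult distrib_right mult.assoc)
    fix p x assume xp: "x \<in> component H p"
    obtain \<alpha> \<beta> where p: "p = (\<alpha>, \<beta>)"
      by force
    have x: "x \<in> carrier H"
      using component_closed[OF xp] .
    let ?c = "\<zeta> \<alpha> \<beta>"
    obtain t where t: "\<And>f. bilinear_form H f \<Longrightarrow>
         pairing (\<lambda>(x, y). f x y) (comult H x) = pairing (\<lambda>(x, y). f x y) t"
      and tk: "\<And>y z. (y, z) \<in> Poly_Mapping.keys t \<Longrightarrow>
         \<exists>\<gamma>. y \<in> component H (\<alpha>, \<gamma>) \<and> z \<in> component H (- \<gamma>, \<beta>)"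
      using homogeneous_comult[OF xp[unfolded p]] by metis
    have key: "f (y \<circ>\<^sub>\<zeta> antipode H z) = ?c * f (y \<otimes> antipode H z)"
      if yz: "(y, z) \<in> Poly_Mapping.keys t" for y z
    proof -
      obtain \<gamma> where g: "y \<in> component H (\<alpha>, \<gamma>)" "z \<in> component H (- \<gamma>, \<beta>)"
        using tk[OF yz] by blast
      have "f (y \<circ>\<^sub>\<zeta> antipode H z) = twist \<zeta> (\<alpha>, \<gamma>) (\<beta>, - \<gamma>) * f (y \<otimes> antipode H z)"
        unfolding deformed_mult_homogeneous[OF g(1) antipode_degree[OF g(2)]]
        using g[THEN component_closed] by (simp add: linear_formD(2)[OF f] antipode_closed)
      then show ?thesis
        by (simp add: twist_def bicharacter_at_negatives)
    qed
    have "pairing (\<lambda>(y, z). f (y \<circ>\<^sub>\<zeta> antipode H z)) (comult H x) =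
        pairing (\<lambda>(y, z). ?c * f (y \<otimes> antipode H z)) t"
      unfolding t[OF bil(1)] by (rule pairing_cong) (auto simp: key)
    also have "\<dots> = ?c * pairing (\<lambda>(y, z). f (y \<otimes> antipode H z)) (comult H x)"
      unfolding t[OF bil(2)] pairing_fun_scale[symmetric] by (simp add: case_prod_unfold)
    also have "pairing (\<lambda>(y, z). f (y \<otimes> antipode H z)) (comult H x) =
        f (comb_eval H (\<lambda>(y, z). y \<otimes> antipode H z) (comult H x))"
      using x cl by (subst linear_form_comb_eval[OF f]) (auto simp: case_prod_unfold)
    also have "\<dots> = counit H x * f \<one>"
      using x by (simp add: antipode_right linear_formD(2)[OF f])
    also have "?c * (counit H x * f \<one>) = counit H x * f \<one>"
      using counit_degree[OF xp[unfolded p]]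
      by (cases "\<alpha> = - \<beta>") (simp_all add: bicharacter_at_negatives)
    finally show "pairing (\<lambda>(y, z). f (y \<circ>\<^sub>\<zeta> antipode H z)) (comult H x) = counit H x * f \<one>" .
  qed
  also have "\<dots> = f (counit H x \<odot> \<one>)"
    by (simp add: linear_formD(2)[OF f])
  finally show "f (comb_eval H (\<lambda>(y, z). y \<circ>\<^sub>\<zeta> antipode H z) (comult H x)) = f (counit H x \<odot> \<one>)" .
qed

lemma hopf_algebra_deform: "hopf_algebra (deform H \<zeta>)"
proof (rule hopf_algebra.intro[OF assoc_algebra_deform hopf_algebra_axioms.intro], goal_cases)
  case (4 x y)
  then show ?case
    by (subst deform_linear_structure) (simp add: tensor_eq_forms pairing_tensor_mult comult_deformed_mult)
qed (simp_all add: comult_closed comult_add comult_smult comult_one coassoc counit_add counit_smult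
    counit_deformed_mult counit_one counit_left counit_right antipode_closed antipode_add antipode_smult
    deformed_antipode_left deformed_antipode_right)

lemma bigraded_hopf_algebra_deform: "bigraded_hopf_algebra (deform H \<zeta>)"
proof (rule bigraded_hopf_algebra.intro[OF hopf_algebra_deform bigraded_hopf_algebra_axioms.intro], goal_cases)
  case (1 p)
  then show ?case
    using component_submodule[of p] component_closed[of _ p]
    by (auto simp: submodule_def submodule_axioms_def)
next
  case (4 x \<alpha> \<beta> y \<alpha>' \<beta>')
  then show ?case
    using deformed_mult_component[of x "(\<alpha>, \<beta>)" y "(\<alpha>', \<beta>')"] by simp
qed (simp_all add: direct_sum scalar_degree comult_degree counit_degree antipode_degree)

end

section \<open>Homogeneous generators\<close>

definition word_degree :: "('x \<Rightarrow> 'g::monoid_add) \<Rightarrow> 'x word \<Rightarrow> 'g" where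
  "word_degree \<delta> w = sum_list (map \<delta> (letters w))"

definition rescale :: "('x \<Rightarrow> 'k) \<Rightarrow> ('x \<Rightarrow>\<^sub>0 'k::field) \<Rightarrow> ('x \<Rightarrow>\<^sub>0 'k)" where
  "rescale c t = Poly_Mapping.mapp (\<lambda>w. (*) (c w)) t"

lemma lookup_rescale: "Poly_Mapping.lookup (rescale c t) w = c w * Poly_Mapping.lookup t w"
  by (simp add: rescale_def lookup_mapp when_def in_keys_iff)

lemma rescale_add: "rescale c (t + u) = rescale c t + rescale c u"
  by (rule poly_mapping_eqI) (simp add: lookup_rescale lookup_add distrib_left)

lemma rescale_diff: "rescale c (t - u) = rescale c t - rescale c u"
  by (rule poly_mapping_eqI) (simp add: lookup_rescale lookup_minus right_diff_distrib)

lemma rescale_sum: "rescale c (\<Sum>i\<in>I. t i) = (\<Sum>i\<in>I. rescale c (t i))"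
  by (rule poly_mapping_eqI) (simp add: lookup_rescale lookup_sum sum_distrib_left)

lemma rescale_single:
  "rescale c (Poly_Mapping.single w k) = Poly_Mapping.single w (c w * k)"
  by (rule poly_mapping_eqI) (simp add: lookup_rescale lookup_single when_def)

lemma scale_comb_single: "scale_comb c (Poly_Mapping.single w k) = Poly_Mapping.single w (c * k)"
  by (rule poly_mapping_eqI) (simp add: lookup_single when_def)

lemma rescale_zero: "rescale c 0 = 0"
  by (rule poly_mapping_eqI) (simp add: lookup_rescale)

lemma rescale_rescale:
  assumes "\<And>w. c' w * c w = 1"
  shows "rescale c' (rescale c t) = t"
  by (rule poly_mapping_eqI) (simp add: lookup_rescale mult.assoc[symmetric] assms)

context bigraded_hopf_algebra
begin

lemma homogeneous_part_mult_left:
  assumes x: "x \<in> component H p" and y: "y \<in> carrier H"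
  shows "homogeneous_part H (x \<otimes> y) (p + p') = x \<otimes> homogeneous_part H y p'"
  using y
proof (induction y rule: homogeneous_induct)
  case (homogeneous p'' y)
  show ?case
    unfolding homogeneous_part_homogeneous[OF mult_component[OF x homogeneous]]
      homogeneous_part_homogeneous[OF homogeneous]
    using component_closed[OF x] by simp
next
  case (add y z)
  then show ?case
    using component_closed[OF x]
    by (simp add: alg.r_distr homogeneous_part_add homogeneous_part_closed)
qed

text \<open>The component of \<open>y\<close> in degree \<open>- p\<close> is already a right inverse of \<open>x\<close>, hence equal to \<open>y\<close>.\<close>

lemma inverse_component:
  assumes x: "x \<in> component H p" and y: "y \<in> carrier H" and inv: "x \<otimes> y = \<one>" "y \<otimes> x = \<one>"
  shows "y \<in> component H (- p)"
proof -
  let ?z = "homogeneous_part H y (- p)"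
  have z: "?z \<in> carrier H"
    by (rule homogeneous_part_closed[OF y])
  have "x \<otimes> ?z = homogeneous_part H \<one> 0"
    using homogeneous_part_mult_left[OF x y, of "- p"] inv by simp
  also have "\<dots> = \<one>"
    using homogeneous_part_homogeneous[OF one_degree] by (simp add: zero_prod_def)
  finally have "y = (y \<otimes> x) \<otimes> ?z"
    using y z component_closed[OF x] by (simp add: alg.m_assoc)
  then have "y = ?z"
    using z inv by simp
  then show ?thesis
    using homogeneous_part_in_component[OF y, of "- p"] by simp
qed

context
  fixes g :: "'x \<Rightarrow> 'h" and \<delta> :: "'x \<Rightarrow> 'g \<times> 'g"
  assumes gens_degree: "\<And>x. g x \<in> component H (\<delta> x)"
begin

lemma homogeneous_gens_closed: "range g \<subseteq> carrier H"
  using component_closed[OF gens_degree] by auto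

lemma word_eval_degree: "word_eval g w \<in> component H (word_degree \<delta> w)"
proof (cases w)
  case (Word xs)
  show ?thesis
    unfolding Word
    by (induction xs)
      (use one_degree in \<open>auto simp: word_eval_simps word_degree_def zero_prod_def intro: mult_component gens_degree\<close>)
qed

lemma homogeneous_part_free_eval:
  "homogeneous_part H (free_eval H g t) p =
   free_eval H g (rescale (\<lambda>w. if word_degree \<delta> w = p then 1 else 0) t)"
proof (induction t rule: comb_induct)
  case (single w c)
  show ?case
    unfolding rescale_single free_eval_single[OF homogeneous_gens_closed]
    by (simp add: homogeneous_part_smult word_eval_closed[OF homogeneous_gens_closed]
        homogeneous_part_homogeneous[OF word_eval_degree] smult_zero smult_0)
next
  case (add t u)
  then show ?case
    by (simp add: rescale_add free_eval_add[OF homogeneous_gens_closed] homogeneous_part_add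
        free_eval_closed[OF homogeneous_gens_closed])
qed

text \<open>Projecting to a component corresponds to dropping all words of other degrees.\<close>

lemma component_eq_free_eval:
  assumes surj: "range (free_eval H g) = carrier H"
  shows "component H p =
    free_eval H g ` {t. \<forall>w\<in>Poly_Mapping.keys t. word_degree \<delta> w = p}"
proof (intro equalityI subsetI)
  let ?e = "\<lambda>w. if word_degree \<delta> w = p then 1 else 0 :: 'k"
  fix x assume x: "x \<in> component H p"
  then obtain t where t: "x = free_eval H g t"
    using surj component_closed by blast
  have "x = homogeneous_part H x p"
    by (simp add: homogeneous_part_homogeneous[OF x])
  also have "\<dots> = free_eval H g (rescale ?e t)"
    unfolding t by (rule homogeneous_part_free_eval)
  finally show "x \<in> free_eval H g ` {t. \<forall>w\<in>Poly_Mapping.keys t. word_degree \<delta> w = p}"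
    by (rule image_eqI) (auto simp: in_keys_iff lookup_rescale split: if_splits)
next
  let ?e = "\<lambda>w. if word_degree \<delta> w = p then 1 else 0 :: 'k"
  fix x assume "x \<in> free_eval H g ` {t. \<forall>w\<in>Poly_Mapping.keys t. word_degree \<delta> w = p}"
  then obtain t where t: "x = free_eval H g t" "\<forall>w\<in>Poly_Mapping.keys t. word_degree \<delta> w = p"
    by blast
  have "rescale ?e t = t"
    using t(2) by (intro poly_mapping_eqI) (auto simp: lookup_rescale in_keys_iff)
  then have "x = homogeneous_part H x p"
    unfolding t(1) homogeneous_part_free_eval by simp
  then show "x \<in> component H p"
    using homogeneous_part_in_component[of x p] free_eval_closed[OF homogeneous_gens_closed] t(1)
    by simp
qed

end

end

text \<open>The scalar by which a product of generators changes when the generators \<open>x\<close> are multiplied by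
  \<open>b x\<close> and the product is deformed: every pair of letters contributes one factor \<open>\<chi>\<close>, taken in
  the order in which the letters occur.\<close>

fun list_twist :: "('x \<Rightarrow> 'x \<Rightarrow> 'k::field) \<Rightarrow> ('x \<Rightarrow> 'k) \<Rightarrow> 'x list \<Rightarrow> 'k" where
  "list_twist \<chi> b [] = 1"
| "list_twist \<chi> b (x # xs) = b x * prod_list (map (\<lambda>y. \<chi> x y) xs) * list_twist \<chi> b xs"

abbreviation word_twist :: "('x \<Rightarrow> 'x \<Rightarrow> 'k::field) \<Rightarrow> ('x \<Rightarrow> 'k) \<Rightarrow> 'x word \<Rightarrow> 'k" where
  "word_twist \<chi> b w \<equiv> list_twist \<chi> b (letters w)"

lemma list_twist_inverse:
  assumes "\<And>x y. \<chi> x y \<noteq> 0" "\<And>x. b x \<noteq> 0"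
  shows "list_twist (\<lambda>x y. inverse (\<chi> x y)) (\<lambda>x. inverse (b x)) xs * list_twist \<chi> b xs = 1"
proof (induction xs)
  case (Cons x xs)
  have "prod_list (map (\<lambda>y. inverse (\<chi> x y)) xs) * prod_list (map (\<lambda>y. \<chi> x y) xs) = 1"
    by (induction xs) (use assms in \<open>auto simp: field_simps\<close>)
  then have "(b x * inverse (b x)) * (prod_list (map (\<lambda>y. inverse (\<chi> x y)) xs) * prod_list (map (\<lambda>y. \<chi> x y) xs)) *
      (list_twist (\<lambda>x y. inverse (\<chi> x y)) (\<lambda>x. inverse (b x)) xs * list_twist \<chi> b xs) = 1"
    using Cons assms by simp
  then show ?case
    by (simp add: ac_simps)
qed simp

context twisted_hopf
begin

lemma twist_word_degree:
  "twist \<zeta> p (word_degree \<delta> (Word xs)) = prod_list (map (\<lambda>y. twist \<zeta> p (\<delta> y)) xs)"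
  by (induction xs)
    (simp_all add: word_degree_def zero_prod_def twist_zero[OF bichar] twist_add[OF bichar])

text \<open>The bicharacter makes the scalars collected in a repeated deformed product depend on the word
  only, so that the deformation becomes a diagonal change of coordinates on the free algebra.\<close>

lemma free_eval_deform:
  fixes g :: "'x \<Rightarrow> 'h"
  assumes \<delta>: "\<And>x. g x \<in> component H (\<delta> x)"
  shows "free_eval (deform H \<zeta>) (\<lambda>x. b x \<odot> g x) t =
    free_eval H g (rescale (word_twist (\<lambda>x y. twist \<zeta> (\<delta> x) (\<delta> y)) b) t)"
proof -
  interpret D: assoc_algebra "deform H \<zeta>"
    by (rule assoc_algebra_deform)
  have gens: "range g \<subseteq> carrier H"
    by (rule homogeneous_gens_closed[OF \<delta>])
  let ?c = "list_twist (\<lambda>x y. twist \<zeta> (\<delta> x) (\<delta> y)) b" and ?G = "\<lambda>x. b x \<odot> g x"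
  have G: "range ?G \<subseteq> carrier (deform H \<zeta>)"
    using component_closed[OF \<delta>] by (auto intro: smult_closed)
  have words: "D.word_eval ?G (Word xs) = ?c xs \<odot> word_eval g (Word xs)" for xs
  proof (induction xs)
    case Nil
    then show ?case
      by (simp add: word_eval_simps D.word_eval_simps smult_1)
  next
    case (Cons x xs)
    have cl: "g x \<in> carrier H" "word_eval g (Word xs) \<in> carrier H"
      using component_closed[OF \<delta>] word_eval_closed[OF gens] by auto
    have "D.word_eval ?G (Word (x # xs)) = (b x \<odot> g x) \<circ>\<^sub>\<zeta> (?c xs \<odot> word_eval g (Word xs))"
      by (simp add: D.word_eval_simps Cons)
    also have "\<dots> = (b x * ?c xs) \<odot> (g x \<circ>\<^sub>\<zeta> word_eval g (Word xs))"
      using cl by (simp add: deformed_mult_smult smult_closed smult_smult deformed_mult_closed mult.commute)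
    also have "\<dots> = ?c (x # xs) \<odot> word_eval g (Word (x # xs))"
      using cl
      by (simp add: deformed_mult_homogeneous[OF \<delta> word_eval_degree[OF \<delta>]] smult_smult
          twist_word_degree word_eval_simps ac_simps)
    finally show ?case .
  qed
  show ?thesis
  proof (induction t rule: comb_induct)
    case (single w c)
    show ?case
      using words[of "letters w"] word_eval_closed[OF gens, of w]
      by (simp add: rescale_single D.free_eval_single[OF G] free_eval_single[OF gens] smult_smult mult.commute)
  next
    case (add t u)
    then show ?case
      using D.free_eval_add[OF G] by (simp add: rescale_add free_eval_add[OF gens])
  qed
qed

end

section \<open>Twisting the relations of a two-parameter quantum group\<close>

fun qdegree :: "'i qgen \<Rightarrow> 'i root_lattice \<times> 'i root_lattice" where
  "qdegree (E i) = (simple_root i, 0)"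
| "qdegree (F i) = (0, - simple_root i)"
| "qdegree (Om i) = (simple_root i, - simple_root i)"
| "qdegree (Om' i) = (simple_root i, - simple_root i)"
| "qdegree (OmI i) = (- simple_root i, simple_root i)"
| "qdegree (OmI' i) = (- simple_root i, simple_root i)"

lemma presented_by_relation:
  assumes "presented_by H g R" "(t, u) \<in> R"
  shows "free_eval H g t = free_eval H g u"
proof -
  interpret assoc_algebra H
    using assms(1) by (simp add: presented_by_def)
  have gens: "range g \<subseteq> carrier H"
    using assms(1) by (simp add: presented_by_def)
  have "t - u \<in> Idl\<^bsub>ring_of_type_algebra\<^esub> {t - u | t u. (t, u) \<in> R}"
    by (rule subsetD[OF ring.genideal_self[OF ring_free_algebra]])
      (use assms(2) in \<open>auto simp: ring_of_type_algebra_def\<close>)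
  then have "free_eval H g (t - u) = \<zero>\<^bsub>H\<^esub>"
    using assms(1) unfolding presented_by_def by blast
  then have "free_eval H g t \<ominus>\<^bsub>H\<^esub> free_eval H g u = \<zero>\<^bsub>H\<^esub>"
    by (simp add: free_eval_diff[OF gens])
  then show ?thesis
    by (simp add: free_eval_closed[OF gens])
qed

lemma qgroup_inverses:
  assumes "is_qgroup a d r s U g"
  shows "g (Om i) \<otimes>\<^bsub>U\<^esub> g (OmI i) = \<one>\<^bsub>U\<^esub>" "g (OmI i) \<otimes>\<^bsub>U\<^esub> g (Om i) = \<one>\<^bsub>U\<^esub>"
    "g (Om' i) \<otimes>\<^bsub>U\<^esub> g (OmI' i) = \<one>\<^bsub>U\<^esub>" "g (OmI' i) \<otimes>\<^bsub>U\<^esub> g (Om' i) = \<one>\<^bsub>U\<^esub>"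
proof -
  have pres: "presented_by U g (qgroup_relations a d r s)"
    using assms by (simp add: is_qgroup_def)
  interpret assoc_algebra U
    using pres by (simp add: presented_by_def)
  have gens: "range g \<subseteq> carrier U"
    using pres by (simp add: presented_by_def)
  have rel: "g x \<otimes>\<^bsub>U\<^esub> g y = \<one>\<^bsub>U\<^esub>" if "(gen x * gen y, 1) \<in> qgroup_relations a d r s" for x y
    using presented_by_relation[OF pres that]
    by (simp add: free_eval_mult[OF gens] free_eval_gen[OF gens] free_eval_one[OF gens])
  show "g (Om i) \<otimes>\<^bsub>U\<^esub> g (OmI i) = \<one>\<^bsub>U\<^esub>" "g (OmI i) \<otimes>\<^bsub>U\<^esub> g (Om i) = \<one>\<^bsub>U\<^esub>"
    "g (Om' i) \<otimes>\<^bsub>U\<^esub> g (OmI' i) = \<one>\<^bsub>U\<^esub>" "g (OmI' i) \<otimes>\<^bsub>U\<^esub> g (Om' i) = \<one>\<^bsub>U\<^esub>"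
    by (rule rel, unfold qgroup_relations_def, blast)+
qed

lemma qgroup_degree:
  assumes "is_qgroup a d r s U g"
  shows "g x \<in> component U (qdegree x)"
proof -
  interpret bigraded_hopf_algebra U
    using assms by (simp add: is_qgroup_def)
  have gens: "g x \<in> carrier U" for x
    using assms by (auto simp: is_qgroup_def presented_by_def)
  have deg: "g (E i) \<in> component U (simple_root i, 0)" "g (F i) \<in> component U (0, - simple_root i)"
    "g (Om i) \<in> component U (simple_root i, - simple_root i)"
    "g (Om' i) \<in> component U (simple_root i, - simple_root i)" for i
    using assms by (auto simp: is_qgroup_def)
  show ?thesis
    using deg inverse_component[OF deg(3) gens qgroup_inverses(1,2)[OF assms]]
      inverse_component[OF deg(4) gens qgroup_inverses(3,4)[OF assms]]
    by (cases x) (simp_all add: uminus_prod_def)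
qed

lemma qgroup_exchange_relations:
  "(gen (Om i) * gen (E j),
    const (r powi (euler a d j i) * s powi (- euler a d i j)) * gen (E j) * gen (Om i)) \<in> qgroup_relations a d r s"
  "(gen (Om' i) * gen (E j),
    const (r powi (- euler a d i j) * s powi (euler a d j i)) * gen (E j) * gen (Om' i)) \<in> qgroup_relations a d r s"
  "(gen (Om i) * gen (F j),
    const (r powi (- euler a d j i) * s powi (euler a d i j)) * gen (F j) * gen (Om i)) \<in> qgroup_relations a d r s"
  "(gen (Om' i) * gen (F j),
    const (r powi (euler a d i j) * s powi (- euler a d j i)) * gen (F j) * gen (Om' i)) \<in> qgroup_relations a d r s"
  "(gen (E i) * gen (F j) - gen (F j) * gen (E i),
    if i = j then const (1 / (r ^ d i - s ^ d i)) * (gen (Om i) - gen (Om' i)) else 0) \<in> qgroup_relations a d r s"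
  unfolding qgroup_relations_def
  by (rule UnI1, rule UnI1, rule UnI2, rule UN_I[of i], rule UNIV_I, rule UN_I[of j], rule UNIV_I,
      simp only: insert_iff simp_thms)+

lemma gen_power: "gen x ^ n = pure (Word (replicate n x))"
  by (induction n) (simp_all add: gen_def mult_single plus_word_def flip: zero_word_def)

lemma list_twist_replicate_append:
  assumes "\<chi> x x = 1"
  shows "list_twist \<chi> b (replicate n x @ ys) =
    b x ^ n * prod_list (map (\<chi> x) ys) ^ n * list_twist \<chi> b ys"
proof (induction n)
  case (Suc n)
  have "prod_list (map (\<chi> x) (replicate n x)) = 1"
    by (induction n) (simp_all add: assms)
  with Suc show ?case
    by (simp add: ac_simps)
qed simp

text \<open>Equal letters do not interact, so the scalar is governed by the $n$ letters before and the $k$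
  letters after \<open>y\<close>.\<close>

lemma list_twist_serre_word:
  assumes "\<chi> x x = 1"
  shows "list_twist \<chi> b (replicate n x @ y # replicate k x) =
    b x ^ (n + k) * b y * \<chi> x y ^ n * \<chi> y x ^ k"
proof -
  have ones: "prod_list (map (\<chi> x) (replicate k x)) = 1"
    by (induction k) (simp_all add: assms)
  have "prod_list (map (\<chi> y) (replicate k x)) = \<chi> y x ^ k"
    by (induction k) simp_all
  then show ?thesis
    using list_twist_replicate_append[of \<chi> x b k "[]"] ones assms
    by (simp add: list_twist_replicate_append[of \<chi> x, OF assms] power_add ac_simps)
qed

lemma euler_sum:
  assumes "a i i = 2" "int (d i) * a i j = int (d j) * a j i"
  shows "euler a d i j + euler a d j i = int (d i) * a i j"
  using assms by (auto simp: euler_def)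

text \<open>Two pairs of parameters with the same ratios $r_i s_i^{-1}$, whose exchange factors differ by the
  square of $\zeta$ on simple roots.  The conditions are preserved when the two pairs are
  interchanged and $\zeta$ is inverted, which is why $(r,s)$ and $(r',s')$ are treated alike.\<close>

locale qgroup_twist =
  fixes a :: "'i::{finite,linorder} \<Rightarrow> 'i \<Rightarrow> int" and d :: "'i \<Rightarrow> nat"
    and r s r' s' :: "'k::field" and \<zeta> :: "'i root_lattice \<Rightarrow> 'i root_lattice \<Rightarrow> 'k"
  assumes cartan_diag: "a i i = 2"
    and symmetrized: "int (d i) * a i j = int (d j) * a j i"
    and nonzero: "r \<noteq> 0" "s \<noteq> 0" "r' \<noteq> 0" "s' \<noteq> 0"
    and same_ratio: "r' ^ d i / s' ^ d i = r ^ d i / s ^ d i"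
    and distinct: "r ^ d i \<noteq> s ^ d i" "r' ^ d i \<noteq> s' ^ d i"
    and skew: "skew_bicharacter \<zeta>"
    and square: "r' powi euler a d j i * s' powi (- euler a d i j) =
      (\<zeta> (simple_root i) (simple_root j))\<^sup>2 * (r powi euler a d j i * s powi (- euler a d i j))"
begin

abbreviation root :: "'i \<Rightarrow> 'i \<Rightarrow> 'k" where
  "root i j \<equiv> \<zeta> (simple_root i) (simple_root j)"

text \<open>Deforming does not affect $e_if_i - f_ie_i$, whose prescribed value depends on $r_i - s_i$; the
  new $f_i$ has to absorb the quotient of the two denominators.\<close>

definition scaling :: "'i qgen \<Rightarrow> 'k" where
  "scaling x = (case x of F i \<Rightarrow> (r ^ d i - s ^ d i) / (r' ^ d i - s' ^ d i) | _ \<Rightarrow> 1)"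

abbreviation qtwist :: "'i qgen \<Rightarrow> 'i qgen \<Rightarrow> 'k" where
  "qtwist x y \<equiv> twist \<zeta> (qdegree x) (qdegree y)"

lemma bichar: "bicharacter \<zeta>"
  using skew by (simp add: skew_bicharacter_def)

lemma root_nonzero: "root i j \<noteq> 0"
  using bichar by (simp add: bicharacter_def)

lemma root_diag: "root i i = 1"
  using skew unfolding skew_bicharacter_def by blast

lemma root_swap: "root j i = inverse (root i j)"
  using skew unfolding skew_bicharacter_def by blast

lemmas bichar_simps = twist_def bicharacter_zero[OF bichar] bicharacter_uminus[OF bichar]

lemma qtwist_simps:
  "qtwist (E i) (E j) = root i j" "qtwist (F i) (F j) = inverse (root i j)"
  "qtwist (E i) (F j) = 1" "qtwist (F i) (E j) = 1"
  "qtwist (Om i) (E j) = root i j" "qtwist (E j) (Om i) = inverse (root i j)"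
  "qtwist (Om' i) (E j) = root i j" "qtwist (E j) (Om' i) = inverse (root i j)"
  "qtwist (Om i) (F j) = inverse (root i j)" "qtwist (F j) (Om i) = root i j"
  "qtwist (Om' i) (F j) = inverse (root i j)" "qtwist (F j) (Om' i) = root i j"
  using root_nonzero root_swap[of j i] by (simp_all add: bichar_simps)

lemma qtwist_cartan:
  "x \<in> range Om \<union> range Om' \<Longrightarrow> y \<in> range Om \<union> range Om' \<Longrightarrow> qtwist x y = 1"
  "qtwist (Om i) (OmI i) = 1" "qtwist (OmI i) (Om i) = 1"
  "qtwist (Om' i) (OmI' i) = 1" "qtwist (OmI' i) (Om' i) = 1"
  using root_nonzero by (auto simp: bichar_simps)

text \<open>Values of \<open>qtwist\<close> are from now on taken from the tables \<open>qtwist_simps\<close> and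
  \<open>qtwist_cartan\<close>, which requires that degrees stay folded.\<close>

declare qdegree.simps [simp del]

lemma scaling_simps:
  "scaling (E i) = 1" "scaling (Om i) = 1" "scaling (Om' i) = 1"
  "scaling (OmI i) = 1" "scaling (OmI' i) = 1"
  "scaling (F i) = (r ^ d i - s ^ d i) / (r' ^ d i - s' ^ d i)"
  by (simp_all add: scaling_def)

lemma scaling_nonzero: "scaling x \<noteq> 0"
  using distinct by (cases x) (simp_all add: scaling_def)

text \<open>The exchange factors of $\omega_i$ and $\omega_i'$ with $e_j$ have the quotient
  $(rs^{-1})^{\langle i,j\rangle + \langle j,i\rangle} = (r_is_i^{-1})^{a_{ij}}$, which is common to both
  pairs of parameters.\<close>

lemma square_prime:
  "r' powi (- euler a d i j) * s' powi (euler a d j i) =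
   (root i j)\<^sup>2 * (r powi (- euler a d i j) * s powi (euler a d j i))"
proof -
  let ?e = "euler a d i j + euler a d j i"
  have "(r' / s') powi ?e = (r / s) powi ?e"
    unfolding euler_sum[of a i d j, OF cartan_diag symmetrized] power_int_mult by (simp add: power_divide same_ratio)
  moreover have "x powi (- euler a d i j) * y powi (euler a d j i) =
      (x powi euler a d j i * y powi (- euler a d i j)) / (x / y) powi ?e"
    if "x \<noteq> 0" "y \<noteq> 0" for x y :: 'k
    using that by (simp add: power_int_divide_distrib power_int_add power_int_minus field_simps)
  ultimately show ?thesis
    using nonzero square[of j i] by simp
qed

lemma square_inverse:
  "r' powi (- euler a d j i) * s' powi (euler a d i j) =
     inverse ((root i j)\<^sup>2) * (r powi (- euler a d j i) * s powi (euler a d i j))"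
  "r' powi (euler a d i j) * s' powi (- euler a d j i) =
     inverse ((root i j)\<^sup>2) * (r powi (euler a d i j) * s powi (- euler a d j i))"
proof -
  have *: "x powi (- m) * y powi n = inverse (x powi m * y powi (- n))" for x y :: 'k and m n
    by (simp add: power_int_minus)
  show "r' powi (- euler a d j i) * s' powi (euler a d i j) =
     inverse ((root i j)\<^sup>2) * (r powi (- euler a d j i) * s powi (euler a d i j))"
    unfolding * square by simp
  show "r' powi (euler a d i j) * s' powi (- euler a d j i) =
     inverse ((root i j)\<^sup>2) * (r powi (euler a d i j) * s powi (- euler a d j i))"
    using arg_cong[OF square_prime[of i j], of inverse] by (simp add: power_int_minus)
qed

lemma serre_coeff_twist:
  "serre_coeff a d r' s' i j k = (root i j) ^ (2 * k) * serre_coeff a d r s i j k"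
proof -
  have *: "x powi (int k * m) * y powi (- int k * n) = (x powi m * y powi (- n)) ^ k"
    for x y :: 'k and m n
  proof -
    have "int k * m = m * int k" "- int k * n = - n * int k"
      by simp_all
    then show ?thesis
      by (simp only: power_int_mult power_int_of_nat power_mult_distrib)
  qed
  show ?thesis
    unfolding serre_coeff_def same_ratio mult.assoc * square
    by (simp only: power_mult_distrib power_mult) (simp only: ac_simps)
qed

abbreviation coeff_twist :: "'i qgen word \<Rightarrow> 'k" where
  "coeff_twist \<equiv> word_twist qtwist scaling"

lemma rescale_two_terms:
  assumes "coeff_twist w * k' = coeff_twist v * k"
  shows "rescale coeff_twist (pure v - Poly_Mapping.single w k') =
    scale_comb (coeff_twist v) (pure v - Poly_Mapping.single w k)"
  by (rule poly_mapping_eqI)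
    (use assms in \<open>auto simp: lookup_rescale lookup_minus lookup_single when_def right_diff_distrib\<close>)

lemma monomial_simps:
  "gen x * gen y = pure (Word [x, y])"
  "const k * gen x * gen y = Poly_Mapping.single (Word [x, y]) k"
  "1 = pure (Word [])"
  by (simp_all add: gen_def const_def mult_single plus_word_def zero_word_def flip: single_one)

lemma const_gen: "const k * gen x = Poly_Mapping.single (Word [x]) k"
  by (simp add: gen_def const_def mult_single plus_word_def zero_word_def)

lemma serre_monomial:
  "const k * gen x ^ n * gen y * gen x ^ m = Poly_Mapping.single (Word (replicate n x @ y # replicate m x)) k"
  unfolding gen_power by (simp add: const_def gen_def mult_single plus_word_def zero_word_def)

text \<open>For the exchange relations this is the condition on the exchange factors: rescaling multiplies
  the two monomials by factors whose quotient is the square of a value of $\zeta$.  In a Serre relation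
  the $k$-th coefficient changes by $\zeta(\alpha_i,\alpha_j)^{2k}$, and its monomial by
  $\zeta(\alpha_i,\alpha_j)^{m-2k}$ up to a common scalar, with $m = 1 - a_{ij}$; the product does not
  depend on $k$.\<close>

lemma rescale_relation:
  assumes "(t', u') \<in> qgroup_relations a d r' s'"
  shows "\<exists>\<kappa> t u. (t, u) \<in> qgroup_relations a d r s \<and>
    rescale coeff_twist (t' - u') = scale_comb \<kappa> (t - u)"
proof -
  let ?R = "qgroup_relations a d r s"
  let ?goal = "\<lambda>t' u'. \<exists>\<kappa> t u. (t, u) \<in> ?R \<and> rescale coeff_twist (t' - u') = scale_comb \<kappa> (t - u)"
  have inv: "?goal (gen x * gen y) 1"
    if "(gen x * gen y, 1) \<in> ?R" "qtwist x y = 1" "scaling x = 1" "scaling y = 1" for x y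
  proof (intro exI conjI)
    show "rescale coeff_twist (gen x * gen y - 1) = scale_comb (coeff_twist (Word [x, y])) (gen x * gen y - 1)"
      unfolding monomial_simps by (rule rescale_two_terms) (simp add: that)
  qed (rule that(1))
  have swap: "?goal (gen x * gen y) (const k' * gen y * gen x)"
    if "(gen x * gen y, const k * gen y * gen x) \<in> ?R" "k' = qtwist x y ^ 2 * k"
      "qtwist x y * qtwist y x = 1" for x y k k'
  proof (intro exI conjI)
    have "qtwist y x * k' = (qtwist x y * qtwist y x) * qtwist x y * k"
      by (simp add: that(2) power2_eq_square)
    then have "qtwist y x * k' = qtwist x y * k"
      by (simp add: that(3))
    then show "rescale coeff_twist (gen x * gen y - const k' * gen y * gen x) =
        scale_comb (coeff_twist (Word [x, y])) (gen x * gen y - const k * gen y * gen x)"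
      unfolding monomial_simps by (intro rescale_two_terms) (simp add: ac_simps)
  qed (rule that(1))
  from assms show ?thesis
    unfolding qgroup_relations_def[of a d r' s']
  proof (elim UnE UN_E)
    fix i
    assume "(t', u') \<in> {(gen (Om i) * gen (OmI i), 1), (gen (OmI i) * gen (Om i), 1),
           (gen (Om' i) * gen (OmI' i), 1), (gen (OmI' i) * gen (Om' i), 1)}"
    moreover have "(gen (Om i) * gen (OmI i), 1) \<in> ?R" "(gen (OmI i) * gen (Om i), 1) \<in> ?R"
      "(gen (Om' i) * gen (OmI' i), 1) \<in> ?R" "(gen (OmI' i) * gen (Om' i), 1) \<in> ?R"
      unfolding qgroup_relations_def by blast+
    ultimately show ?thesis
      using inv by (elim insertE) (auto simp only: prod.inject qtwist_cartan scaling_simps)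
  next
    assume "(t', u') \<in> {(gen x * gen y, gen y * gen x) | x y.
      x \<in> range Om \<union> range Om' \<and> y \<in> range Om \<union> range Om'}"
    then obtain x y where t': "t' = gen x * gen y" "u' = gen y * gen x"
      and xy: "x \<in> range Om \<union> range Om'" "y \<in> range Om \<union> range Om'"
      by blast
    have "(gen x * gen y, gen y * gen x) \<in> ?R"
      using xy unfolding qgroup_relations_def by blast
    moreover have "rescale coeff_twist (gen x * gen y - gen y * gen x) =
        scale_comb (coeff_twist (Word [x, y])) (gen x * gen y - gen y * gen x)"
      unfolding monomial_simps
      by (rule rescale_two_terms) (simp add: qtwist_cartan(1)[OF xy] qtwist_cartan(1)[OF xy(2,1)] mult.commute)
    ultimately show ?thesis
      unfolding t' by blast
  next
    fix i j
    assume "(t', u') \<in>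
       {(gen (Om i) * gen (E j),
           const (r' powi (euler a d j i) * s' powi (- euler a d i j)) * gen (E j) * gen (Om i)),
        (gen (Om' i) * gen (E j),
           const (r' powi (- euler a d i j) * s' powi (euler a d j i)) * gen (E j) * gen (Om' i)),
        (gen (Om i) * gen (F j),
           const (r' powi (- euler a d j i) * s' powi (euler a d i j)) * gen (F j) * gen (Om i)),
        (gen (Om' i) * gen (F j),
           const (r' powi (euler a d i j) * s' powi (- euler a d j i)) * gen (F j) * gen (Om' i)),
        (gen (E i) * gen (F j) - gen (F j) * gen (E i),
           if i = j then const (1 / (r' ^ d i - s' ^ d i)) * (gen (Om i) - gen (Om' i)) else 0)}"
    then show ?thesis
    proof (elim insertE emptyE; unfold prod.inject; elim conjE; hypsubst)
      show "?goal (gen (Om i) * gen (E j))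
          (const (r' powi (euler a d j i) * s' powi (- euler a d i j)) * gen (E j) * gen (Om i))"
        by (rule swap[of _ _ "r powi (euler a d j i) * s powi (- euler a d i j)"])
          (rule qgroup_exchange_relations, simp_all add: square qtwist_simps root_nonzero)
      show "?goal (gen (Om' i) * gen (E j))
          (const (r' powi (- euler a d i j) * s' powi (euler a d j i)) * gen (E j) * gen (Om' i))"
        by (rule swap[of _ _ "r powi (- euler a d i j) * s powi (euler a d j i)"])
          (rule qgroup_exchange_relations, simp_all add: square_prime qtwist_simps root_nonzero)
      show "?goal (gen (Om i) * gen (F j))
          (const (r' powi (- euler a d j i) * s' powi (euler a d i j)) * gen (F j) * gen (Om i))"
        by (rule swap[of _ _ "r powi (- euler a d j i) * s powi (euler a d i j)"])
          (rule qgroup_exchange_relations, simp_all add: square_inverse qtwist_simps root_nonzero power_inverse)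
      show "?goal (gen (Om' i) * gen (F j))
          (const (r' powi (euler a d i j) * s' powi (- euler a d j i)) * gen (F j) * gen (Om' i))"
        by (rule swap[of _ _ "r powi (euler a d i j) * s powi (- euler a d j i)"])
          (rule qgroup_exchange_relations, simp_all add: square_inverse qtwist_simps root_nonzero power_inverse)
      let ?u = "\<lambda>c. if i = j then const c * (gen (Om i) - gen (Om' i)) else (0 :: ('i qgen, 'k) free_algebra)"
      have "rescale coeff_twist (gen (E i) * gen (F j) - gen (F j) * gen (E i) - ?u (1 / (r' ^ d i - s' ^ d i))) =
        scale_comb (scaling (F j)) (gen (E i) * gen (F j) - gen (F j) * gen (E i) - ?u (1 / (r ^ d i - s ^ d i)))"
      proof -
        have "scaling (F i) * (1 / (r ^ d i - s ^ d i)) = 1 / (r' ^ d i - s' ^ d i)"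
          using distinct[of i] by (simp add: scaling_simps)
        then show ?thesis
          unfolding right_diff_distrib monomial_simps const_gen
          by (auto simp: rescale_diff rescale_single rescale_zero comb.scale_right_diff_distrib
              scale_comb_single qtwist_simps scaling_simps(1-5))
      qed
      moreover have "(gen (E i) * gen (F j) - gen (F j) * gen (E i), ?u (1 / (r ^ d i - s ^ d i))) \<in> ?R"
        by (rule qgroup_exchange_relations)
      ultimately show "?goal (gen (E i) * gen (F j) - gen (F j) * gen (E i)) (?u (1 / (r' ^ d i - s' ^ d i)))"
        by blast
    qed
  next
    assume "(t', u') \<in> {(\<Sum>k\<le>nat (1 - a i j). const (serre_coeff a d r' s' i j k) *
          gen (E i) ^ (nat (1 - a i j) - k) * gen (E j) * gen (E i) ^ k, 0) | i j. i \<noteq> j}"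
    then obtain i j where ij: "i \<noteq> j" and u': "u' = 0"
      and t': "t' = (\<Sum>k\<le>nat (1 - a i j). const (serre_coeff a d r' s' i j k) *
          gen (E i) ^ (nat (1 - a i j) - k) * gen (E j) * gen (E i) ^ k)"
      by blast
    let ?m = "nat (1 - a i j)"
    let ?t = "\<Sum>k\<le>?m. const (serre_coeff a d r s i j k) * gen (E i) ^ (?m - k) * gen (E j) * gen (E i) ^ k"
    have "rescale coeff_twist (t' - u') = scale_comb (root i j ^ ?m) (?t - 0)"
      unfolding t' u' diff_zero rescale_sum comb.scale_sum_right
    proof (rule sum.cong[OF refl])
      fix k assume k: "k \<in> {..?m}"
      let ?w = "replicate (?m - k) (E i) @ E j # replicate k (E i)"
      have "root i j ^ ?m = root i j ^ (?m - k) * root i j ^ k"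
        using k by (simp flip: power_add)
      then have "list_twist qtwist scaling ?w * serre_coeff a d r' s' i j k =
          root i j ^ ?m * serre_coeff a d r s i j k"
        using root_nonzero[of i j]
        by (simp add: list_twist_serre_word qtwist_simps root_diag scaling_simps serre_coeff_twist
            root_swap[of j i] power_inverse power_mult power2_eq_square power_mult_distrib field_simps)
      then show "rescale coeff_twist (const (serre_coeff a d r' s' i j k) *
            gen (E i) ^ (?m - k) * gen (E j) * gen (E i) ^ k) =
          scale_comb (root i j ^ ?m) (const (serre_coeff a d r s i j k) *
            gen (E i) ^ (?m - k) * gen (E j) * gen (E i) ^ k)"
        unfolding serre_monomial rescale_single
        by (intro poly_mapping_eqI) (simp add: lookup_single when_def)
    qed
    moreover have "(?t, 0) \<in> ?R"
      using ij unfolding qgroup_relations_def by blast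
    ultimately show ?thesis
      by blast
  next
    assume "(t', u') \<in> {(\<Sum>k\<le>nat (1 - a i j). const (serre_coeff a d r' s' i j k) *
          gen (F i) ^ k * gen (F j) * gen (F i) ^ (nat (1 - a i j) - k), 0) | i j. i \<noteq> j}"
    then obtain i j where ij: "i \<noteq> j" and u': "u' = 0"
      and t': "t' = (\<Sum>k\<le>nat (1 - a i j). const (serre_coeff a d r' s' i j k) *
          gen (F i) ^ k * gen (F j) * gen (F i) ^ (nat (1 - a i j) - k))"
      by blast
    let ?m = "nat (1 - a i j)"
    let ?\<kappa> = "scaling (F i) ^ ?m * scaling (F j) * root i j ^ ?m"
    let ?t = "\<Sum>k\<le>?m. const (serre_coeff a d r s i j k) * gen (F i) ^ k * gen (F j) * gen (F i) ^ (?m - k)"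
    have "rescale coeff_twist (t' - u') = scale_comb ?\<kappa> (?t - 0)"
      unfolding t' u' diff_zero rescale_sum comb.scale_sum_right
    proof (rule sum.cong[OF refl])
      fix k assume k: "k \<in> {..?m}"
      let ?w = "replicate k (F i) @ F j # replicate (?m - k) (F i)"
      have "root i j ^ ?m = root i j ^ (?m - k) * root i j ^ k" "k + (?m - k) = ?m"
        using k by (simp_all flip: power_add)
      then have "list_twist qtwist scaling ?w * serre_coeff a d r' s' i j k =
          ?\<kappa> * serre_coeff a d r s i j k"
        using root_nonzero[of i j]
        by (simp add: list_twist_serre_word qtwist_simps root_diag serre_coeff_twist
            root_swap[of j i] power_inverse power_mult power2_eq_square power_mult_distrib field_simps)
      then show "rescale coeff_twist (const (serre_coeff a d r' s' i j k) *
            gen (F i) ^ k * gen (F j) * gen (F i) ^ (?m - k)) =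
          scale_comb ?\<kappa> (const (serre_coeff a d r s i j k) *
            gen (F i) ^ k * gen (F j) * gen (F i) ^ (?m - k))"
        unfolding serre_monomial rescale_single
        by (intro poly_mapping_eqI) (simp add: lookup_single when_def)
    qed
    moreover have "(?t, 0) \<in> ?R"
      using ij unfolding qgroup_relations_def by blast
    ultimately show ?thesis
      by blast
  qed
qed

text \<open>Rescaling is not multiplicative, so it is not obvious that the polynomials whose rescaling
  vanishes in \<open>U\<close> form an ideal.  They do because they are the kernel of evaluation in the
  deformed algebra.\<close>

lemma ideal_twist:
  assumes U: "is_qgroup a d r s U g"
    and t: "t \<in> Idl\<^bsub>ring_of_type_algebra\<^esub> {t - u | t u. (t, u) \<in> qgroup_relations a d r' s'}"
  shows "free_eval U g (rescale coeff_twist t) = \<zero>\<^bsub>U\<^esub>"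
proof -
  have pres: "presented_by U g (qgroup_relations a d r s)"
    using U by (simp add: is_qgroup_def)
  have gens: "range g \<subseteq> carrier U"
    using pres by (simp add: presented_by_def)
  interpret bigraded_hopf_algebra U
    using U by (simp add: is_qgroup_def)
  interpret twisted_hopf U \<zeta>
    by unfold_locales (rule skew)
  interpret D: assoc_algebra "deform U \<zeta>"
    by (rule assoc_algebra_deform)
  let ?G = "\<lambda>x. scaling x \<odot>\<^bsub>U\<^esub> g x"
  have eval: "free_eval (deform U \<zeta>) ?G t = free_eval U g (rescale coeff_twist t)" for t
    by (rule free_eval_deform[OF qgroup_degree[OF U]])
  have G: "range ?G \<subseteq> carrier (deform U \<zeta>)"
    using gens by (auto intro: smult_closed)
  have "Idl\<^bsub>ring_of_type_algebra\<^esub> {t - u | t u. (t, u) \<in> qgroup_relations a d r' s'} \<subseteq>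
      {t. free_eval (deform U \<zeta>) ?G t = \<zero>\<^bsub>deform U \<zeta>\<^esub>}"
  proof (rule ring.genideal_minimal[OF ring_free_algebra D.kernel_ideal[OF G]])
    show "{t - u | t u. (t, u) \<in> qgroup_relations a d r' s'} \<subseteq>
      {t. free_eval (deform U \<zeta>) ?G t = \<zero>\<^bsub>deform U \<zeta>\<^esub>}"
    proof clarify
      fix t' u' assume "(t', u') \<in> qgroup_relations a d r' s'"
      then obtain \<kappa> t u where rel: "(t, u) \<in> qgroup_relations a d r s"
        and tu: "rescale coeff_twist (t' - u') = scale_comb \<kappa> (t - u)"
        using rescale_relation by blast
      show "free_eval (deform U \<zeta>) ?G (t' - u') = \<zero>\<^bsub>deform U \<zeta>\<^esub>"
        unfolding eval tu free_eval_scale[OF gens] free_eval_diff[OF gens]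
          presented_by_relation[OF pres rel]
        by (simp add: alg.r_neg a_minus_def free_eval_closed[OF gens] smult_zero)
    qed
  qed
  with t have "free_eval (deform U \<zeta>) ?G t = \<zero>\<^bsub>deform U \<zeta>\<^esub>"
    by blast
  then show ?thesis
    by (simp add: eval)
qed

end

section \<open>Hopf algebras with a common presentation\<close>

text \<open>Generated algebras in which the same noncommutative polynomials vanish, graded by the same degrees
  of the generators.\<close>

locale common_presentation =
  A: bigraded_hopf_algebra A + B: bigraded_hopf_algebra B
  for A :: "('k::field, 'u, 'g::ab_group_add) bihopf" and B :: "('k, 'v, 'g) bihopf" +
  fixes g :: "'x \<Rightarrow> 'u" and h :: "'x \<Rightarrow> 'v" and \<delta> :: "'x \<Rightarrow> 'g \<times> 'g"
  assumes degree_A: "g x \<in> component A (\<delta> x)" and degree_B: "h x \<in> component B (\<delta> x)"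
    and generated_A: "range (free_eval A g) = carrier A"
    and generated_B: "range (free_eval B h) = carrier B"
    and kernel: "free_eval A g t = \<zero>\<^bsub>A\<^esub> \<longleftrightarrow> free_eval B h t = \<zero>\<^bsub>B\<^esub>"
begin

lemma gens_A: "range g \<subseteq> carrier A"
  using A.component_closed[OF degree_A] by blast

lemma gens_B: "range h \<subseteq> carrier B"
  using B.component_closed[OF degree_B] by blast

definition \<phi> :: "'u \<Rightarrow> 'v" where
  "\<phi> x = free_eval B h (SOME t. free_eval A g t = x)"

lemma kernel_eq:
  "free_eval A g t = free_eval A g u \<longleftrightarrow> free_eval B h t = free_eval B h u"
proof -
  have "free_eval A g t = free_eval A g u \<longleftrightarrow> free_eval A g (t - u) = \<zero>\<^bsub>A\<^esub>"
    using A.free_eval_closed[OF gens_A] by (simp add: A.free_eval_diff[OF gens_A])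
  also have "\<dots> \<longleftrightarrow> free_eval B h (t - u) = \<zero>\<^bsub>B\<^esub>"
    by (rule kernel)
  also have "\<dots> \<longleftrightarrow> free_eval B h t = free_eval B h u"
    using B.free_eval_closed[OF gens_B] by (simp add: B.free_eval_diff[OF gens_B])
  finally show ?thesis .
qed

lemma \<phi>_free_eval: "\<phi> (free_eval A g t) = free_eval B h t"
  unfolding \<phi>_def kernel_eq[symmetric] by (rule someI) simp

lemma \<phi>_gen: "\<phi> (g x) = h x"
  using \<phi>_free_eval[of "gen x"] by (simp add: A.free_eval_gen[OF gens_A] B.free_eval_gen[OF gens_B])

lemma carrier_A_cases:
  assumes "x \<in> carrier A"
  obtains t where "x = free_eval A g t"
  using assms generated_A by blast

lemma \<phi>_closed: "x \<in> carrier A \<Longrightarrow> \<phi> x \<in> carrier B"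
  by (elim carrier_A_cases) (simp add: \<phi>_free_eval B.free_eval_closed[OF gens_B])

lemma \<phi>_add: "x \<in> carrier A \<Longrightarrow> y \<in> carrier A \<Longrightarrow> \<phi> (x \<oplus>\<^bsub>A\<^esub> y) = \<phi> x \<oplus>\<^bsub>B\<^esub> \<phi> y"
  by (elim carrier_A_cases)
    (simp add: \<phi>_free_eval B.free_eval_add[OF gens_B] flip: A.free_eval_add[OF gens_A])

lemma \<phi>_mult: "x \<in> carrier A \<Longrightarrow> y \<in> carrier A \<Longrightarrow> \<phi> (x \<otimes>\<^bsub>A\<^esub> y) = \<phi> x \<otimes>\<^bsub>B\<^esub> \<phi> y"
  by (elim carrier_A_cases)
    (simp add: \<phi>_free_eval B.free_eval_mult[OF gens_B] flip: A.free_eval_mult[OF gens_A])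

lemma \<phi>_smult: "x \<in> carrier A \<Longrightarrow> \<phi> (c \<odot>\<^bsub>A\<^esub> x) = c \<odot>\<^bsub>B\<^esub> \<phi> x"
  by (elim carrier_A_cases)
    (simp add: \<phi>_free_eval B.free_eval_scale[OF gens_B] flip: A.free_eval_scale[OF gens_A])

lemma \<phi>_one: "\<phi> \<one>\<^bsub>A\<^esub> = \<one>\<^bsub>B\<^esub>"
  using \<phi>_free_eval[of 1] by (simp add: A.free_eval_one[OF gens_A] B.free_eval_one[OF gens_B])

lemma \<phi>_bij: "bij_betw \<phi> (carrier A) (carrier B)"
  unfolding bij_betw_def
proof
  show "inj_on \<phi> (carrier A)"
    by (intro inj_onI, elim carrier_A_cases) (simp add: \<phi>_free_eval kernel_eq)
  show "\<phi> ` carrier A = carrier B"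
    unfolding generated_A[symmetric] generated_B[symmetric] image_image \<phi>_free_eval ..
qed

lemma \<phi>_component: "\<phi> ` component A p = component B p"
  unfolding A.component_eq_free_eval[of g \<delta>, OF degree_A generated_A]
    B.component_eq_free_eval[of h \<delta>, OF degree_B generated_B]
  by (simp add: image_image \<phi>_free_eval)

lemma linear_form_pullback: "linear_form B f \<Longrightarrow> linear_form A (\<lambda>x. f (\<phi> x))"
  by (auto intro!: linear_formI simp: \<phi>_add \<phi>_smult \<phi>_closed linear_formD)

lemma bilinear_form_pullback:
  assumes "bilinear_form B f"
  shows "bilinear_form A (\<lambda>x y. f (\<phi> x) (\<phi> y))"
  using linear_form_pullback[OF bilinear_formD(1)[OF assms \<phi>_closed]]
    linear_form_pullback[OF bilinear_formD(2)[OF assms \<phi>_closed]]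
  by (auto intro!: bilinear_formI)

text \<open>Compatibility with the comultiplication at one element, tested by bilinear forms.  The elements
  that satisfy it are shown to form a subalgebra closed under inverses.\<close>

definition comult_preserving :: "'u \<Rightarrow> bool" where
  "comult_preserving x \<longleftrightarrow> (\<forall>f. bilinear_form B f \<longrightarrow>
     pairing (\<lambda>(u, v). f u v) (comult B (\<phi> x)) =
     pairing (\<lambda>(u, v). f (\<phi> u) (\<phi> v)) (comult A x))"

lemma comult_preservingD:
  "comult_preserving x \<Longrightarrow> bilinear_form B f \<Longrightarrow>
     pairing (\<lambda>(u, v). f u v) (comult B (\<phi> x)) = pairing (\<lambda>(u, v). f (\<phi> u) (\<phi> v)) (comult A x)"
  by (simp add: comult_preserving_def)

lemma comult_preserving_add:
  assumes x: "x \<in> carrier A" and y: "y \<in> carrier A"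
    and "comult_preserving x" "comult_preserving y"
  shows "comult_preserving (x \<oplus>\<^bsub>A\<^esub> y)"
  unfolding comult_preserving_def
proof (intro allI impI)
  fix f assume f: "bilinear_form B f"
  show "pairing (\<lambda>(u, v). f u v) (comult B (\<phi> (x \<oplus>\<^bsub>A\<^esub> y))) =
     pairing (\<lambda>(u, v). f (\<phi> u) (\<phi> v)) (comult A (x \<oplus>\<^bsub>A\<^esub> y))"
    using linear_formD(1)[OF B.linear_form_comult[OF f] \<phi>_closed[OF x] \<phi>_closed[OF y]]
      linear_formD(1)[OF A.linear_form_comult[OF bilinear_form_pullback[OF f]] x y]
    by (simp add: \<phi>_add x y comult_preservingD[OF assms(3) f] comult_preservingD[OF assms(4) f])
qed

lemma comult_preserving_smult:
  assumes x: "x \<in> carrier A" and "comult_preserving x"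
  shows "comult_preserving (c \<odot>\<^bsub>A\<^esub> x)"
  unfolding comult_preserving_def
proof (intro allI impI)
  fix f assume f: "bilinear_form B f"
  show "pairing (\<lambda>(u, v). f u v) (comult B (\<phi> (c \<odot>\<^bsub>A\<^esub> x))) =
     pairing (\<lambda>(u, v). f (\<phi> u) (\<phi> v)) (comult A (c \<odot>\<^bsub>A\<^esub> x))"
    using linear_formD(2)[OF B.linear_form_comult[OF f] \<phi>_closed[OF x]]
      linear_formD(2)[OF A.linear_form_comult[OF bilinear_form_pullback[OF f]] x]
    by (simp add: \<phi>_smult x comult_preservingD[OF assms(2) f])
qed

lemma comult_preserving_one: "comult_preserving \<one>\<^bsub>A\<^esub>"
  by (auto simp: comult_preserving_def \<phi>_one B.pairing_comult_one A.pairing_comult_one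
      bilinear_form_pullback)

lemma keys_comult_A: "x \<in> carrier A \<Longrightarrow> (u, v) \<in> Poly_Mapping.keys (comult A x) \<Longrightarrow>
    u \<in> carrier A \<and> v \<in> carrier A"
  using A.comult_closed by blast

lemma keys_comult_B: "x \<in> carrier B \<Longrightarrow> (u, v) \<in> Poly_Mapping.keys (comult B x) \<Longrightarrow>
    u \<in> carrier B \<and> v \<in> carrier B"
  using B.comult_closed by blast

lemma pairing_pullback_mult:
  assumes f: "bilinear_form B f" and x: "x \<in> carrier A" and y: "y \<in> carrier A"
  shows "pairing (\<lambda>(u, v). f (\<phi> u) (\<phi> v)) (comult A (x \<otimes>\<^bsub>A\<^esub> y)) =
    pairing (\<lambda>(u, v). pairing (\<lambda>(u', v'). f (\<phi> u \<otimes>\<^bsub>B\<^esub> \<phi> u') (\<phi> v \<otimes>\<^bsub>B\<^esub> \<phi> v'))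
      (comult A y)) (comult A x)"
  unfolding A.pairing_comult_mult[OF bilinear_form_pullback[OF f] x y]
  by (rule pairing_cong, clarify, rule pairing_cong)
    (use keys_comult_A[OF x] keys_comult_A[OF y] in \<open>auto simp: \<phi>_mult\<close>)

lemma bilinear_form_pairing_pullback:
  assumes f: "bilinear_form B f" and y: "y \<in> carrier A"
  shows "bilinear_form B (\<lambda>u v. pairing (\<lambda>(u', v'). f (u \<otimes>\<^bsub>B\<^esub> \<phi> u') (v \<otimes>\<^bsub>B\<^esub> \<phi> v')) (comult A y))"
  unfolding case_prod_unfold
  by (rule bilinear_form_pairing, rule B.bilinear_form_translate(1)[OF f])
    (use keys_comult_A[OF y] in \<open>auto intro!: \<phi>_closed\<close>)

lemma comult_preserving_mult:
  assumes x: "x \<in> carrier A" and y: "y \<in> carrier A"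
    and px: "comult_preserving x" and py: "comult_preserving y"
  shows "comult_preserving (x \<otimes>\<^bsub>A\<^esub> y)"
  unfolding comult_preserving_def
proof (intro allI impI)
  fix f assume f: "bilinear_form B f"
  have "pairing (\<lambda>(u, v). f u v) (comult B (\<phi> (x \<otimes>\<^bsub>A\<^esub> y))) =
    pairing (\<lambda>(u, v). pairing (\<lambda>(u', v'). f (u \<otimes>\<^bsub>B\<^esub> u') (v \<otimes>\<^bsub>B\<^esub> v')) (comult B (\<phi> y))) (comult B (\<phi> x))"
    unfolding \<phi>_mult[OF x y] by (rule B.pairing_comult_mult[OF f \<phi>_closed[OF x] \<phi>_closed[OF y]])
  also have "\<dots> =
    pairing (\<lambda>(u, v). pairing (\<lambda>(u', v'). f (u \<otimes>\<^bsub>B\<^esub> \<phi> u') (v \<otimes>\<^bsub>B\<^esub> \<phi> v')) (comult A y)) (comult B (\<phi> x))"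
  proof (rule pairing_cong, clarify)
    fix u v assume "(u, v) \<in> Poly_Mapping.keys (comult B (\<phi> x))"
    then have "bilinear_form B (\<lambda>u' v'. f (u \<otimes>\<^bsub>B\<^esub> u') (v \<otimes>\<^bsub>B\<^esub> v'))"
      using keys_comult_B[OF \<phi>_closed[OF x]] by (intro B.bilinear_form_translate(2)[OF f]) auto
    then show "pairing (\<lambda>(u', v'). f (u \<otimes>\<^bsub>B\<^esub> u') (v \<otimes>\<^bsub>B\<^esub> v')) (comult B (\<phi> y)) =
        pairing (\<lambda>(u', v'). f (u \<otimes>\<^bsub>B\<^esub> \<phi> u') (v \<otimes>\<^bsub>B\<^esub> \<phi> v')) (comult A y)"
      by (rule comult_preservingD[OF py])
  qed
  also have "\<dots> = pairing (\<lambda>(u, v). f (\<phi> u) (\<phi> v)) (comult A (x \<otimes>\<^bsub>A\<^esub> y))"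
    unfolding pairing_pullback_mult[OF f x y]
    by (rule comult_preservingD[OF px bilinear_form_pairing_pullback[OF f y]])
  finally show "pairing (\<lambda>(u, v). f u v) (comult B (\<phi> (x \<otimes>\<^bsub>A\<^esub> y))) =
    pairing (\<lambda>(u, v). f (\<phi> u) (\<phi> v)) (comult A (x \<otimes>\<^bsub>A\<^esub> y))" .
qed

text \<open>With $\Delta' = (\varphi \otimes \varphi) \circ \Delta$, which is multiplicative as well, the reason
  is $\Delta(\varphi y) = \Delta(\varphi y)\Delta'(x)\Delta'(y) =
  \Delta(\varphi y)\Delta(\varphi x)\Delta'(y) = \Delta'(y)$.\<close>

lemma comult_preserving_inverse:
  assumes x: "x \<in> carrier A" and y: "y \<in> carrier A"
    and inv: "x \<otimes>\<^bsub>A\<^esub> y = \<one>\<^bsub>A\<^esub>" "y \<otimes>\<^bsub>A\<^esub> x = \<one>\<^bsub>A\<^esub>"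
    and px: "comult_preserving x"
  shows "comult_preserving y"
  unfolding comult_preserving_def
proof (intro allI impI)
  fix f assume f: "bilinear_form B f"
  note cl = \<phi>_closed[OF x] \<phi>_closed[OF y]
  let ?F = "\<lambda>w w'. pairing (\<lambda>(e, e'). f (w \<otimes>\<^bsub>B\<^esub> \<phi> e) (w' \<otimes>\<^bsub>B\<^esub> \<phi> e')) (comult A y)"
  have F: "bilinear_form B ?F"
    by (rule bilinear_form_pairing_pullback[OF f y])
  \<comment> \<open>Multiplication by $1 = \Delta'(x)\Delta'(y)$, with $\Delta'(x)$ already replaced by $\Delta(\varphi x)$.\<close>
  have insert: "f u v = pairing (\<lambda>(c, c'). ?F (u \<otimes>\<^bsub>B\<^esub> c) (v \<otimes>\<^bsub>B\<^esub> c')) (comult B (\<phi> x))"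
    if u: "u \<in> carrier B" and v: "v \<in> carrier B" for u v
  proof -
    note fuv = B.bilinear_form_translate(2)[OF f u v]
    have "f u v = pairing (\<lambda>(c, c'). f (u \<otimes>\<^bsub>B\<^esub> \<phi> c) (v \<otimes>\<^bsub>B\<^esub> \<phi> c')) (comult A (x \<otimes>\<^bsub>A\<^esub> y))"
      unfolding inv A.pairing_comult_one[OF bilinear_form_pullback[OF fuv]]
      by (simp add: \<phi>_one u v)
    also have "\<dots> = pairing (\<lambda>(c, c'). pairing (\<lambda>(e, e').
        f (u \<otimes>\<^bsub>B\<^esub> (\<phi> c \<otimes>\<^bsub>B\<^esub> \<phi> e)) (v \<otimes>\<^bsub>B\<^esub> (\<phi> c' \<otimes>\<^bsub>B\<^esub> \<phi> e'))) (comult A y)) (comult A x)"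
      by (rule pairing_pullback_mult[OF fuv x y])
    also have "\<dots> = pairing (\<lambda>(c, c'). ?F (u \<otimes>\<^bsub>B\<^esub> \<phi> c) (v \<otimes>\<^bsub>B\<^esub> \<phi> c')) (comult A x)"
      by (rule pairing_cong, clarify, rule pairing_cong)
        (use keys_comult_A[OF x] keys_comult_A[OF y] u v in \<open>auto simp: B.alg.m_assoc \<phi>_closed\<close>)
    also have "\<dots> = pairing (\<lambda>(c, c'). ?F (u \<otimes>\<^bsub>B\<^esub> c) (v \<otimes>\<^bsub>B\<^esub> c')) (comult B (\<phi> x))"
      by (rule comult_preservingD[OF px B.bilinear_form_translate(2)[OF F u v], symmetric])
    finally show ?thesis .
  qed
  have "pairing (\<lambda>(u, v). f u v) (comult B (\<phi> y)) =
      pairing (\<lambda>(u, v). pairing (\<lambda>(c, c'). ?F (u \<otimes>\<^bsub>B\<^esub> c) (v \<otimes>\<^bsub>B\<^esub> c')) (comult B (\<phi> x))) (comult B (\<phi> y))"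
    by (rule pairing_cong, clarify, rule insert) (use keys_comult_B[OF cl(2)] in auto)
  also have "\<dots> = pairing (\<lambda>(w, w'). ?F w w') (comult B (\<phi> y \<otimes>\<^bsub>B\<^esub> \<phi> x))"
    by (rule B.pairing_comult_mult[OF F cl(2,1), symmetric])
  also have "\<phi> y \<otimes>\<^bsub>B\<^esub> \<phi> x = \<one>\<^bsub>B\<^esub>"
    using \<phi>_mult[OF y x] by (simp add: inv \<phi>_one)
  also have "pairing (\<lambda>(w, w'). ?F w w') (comult B \<one>\<^bsub>B\<^esub>) = ?F \<one>\<^bsub>B\<^esub> \<one>\<^bsub>B\<^esub>"
    by (rule B.pairing_comult_one[OF F])
  also have "\<dots> = pairing (\<lambda>(u, v). f (\<phi> u) (\<phi> v)) (comult A y)"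
    by (rule pairing_cong) (use keys_comult_A[OF y] in \<open>auto simp: \<phi>_closed\<close>)
  finally show "pairing (\<lambda>(u, v). f u v) (comult B (\<phi> y)) =
    pairing (\<lambda>(u, v). f (\<phi> u) (\<phi> v)) (comult A y)" .
qed

text \<open>Here \<open>T\<close> is a formula for the coproduct in terms of the generators that is valid in both algebras.\<close>

lemma comult_preserving_generator:
  assumes "tensor_eq A (comult A (g x))
      (lin_ext (\<lambda>(t, u). pure (free_eval A g t, free_eval A g u)) T)"
    and "tensor_eq B (comult B (h x))
      (lin_ext (\<lambda>(t, u). pure (free_eval B h t, free_eval B h u)) T)"
  shows "comult_preserving (g x)"
  unfolding comult_preserving_def
proof (intro allI impI)
  fix f assume f: "bilinear_form B f"
  show "pairing (\<lambda>(u, v). f u v) (comult B (\<phi> (g x))) =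
     pairing (\<lambda>(u, v). f (\<phi> u) (\<phi> v)) (comult A (g x))"
    using assms(1)[unfolded tensor_eq_forms, rule_format, OF bilinear_form_pullback[OF f]]
      assms(2)[unfolded tensor_eq_forms, rule_format, OF f]
    by (simp add: \<phi>_gen pairing_lin_ext case_prod_unfold \<phi>_free_eval)
qed

text \<open>An antipode is a two-sided convolution inverse, hence unique: by coassociativity the sum
  $\sum \varphi(S(x_{(1)}))\,\varphi(x_{(2)})\,S(\varphi(x_{(3)}))$ equals $S(\varphi(x))$ if the
  first two factors are contracted, and $\varphi(S(x))$ if the last two are.\<close>

lemma antipode_preserved:
  assumes comult: "\<And>x. x \<in> carrier A \<Longrightarrow> comult_preserving x"
    and counit: "\<And>x. x \<in> carrier A \<Longrightarrow> counit B (\<phi> x) = counit A x"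
    and x: "x \<in> carrier A"
  shows "antipode B (\<phi> x) = \<phi> (antipode A x)"
proof (rule B.forms_separate_points)
  fix f assume f: "linear_form B f"
  let ?F = "\<lambda>y z w. f (\<phi> (antipode A y) \<otimes>\<^bsub>B\<^esub> \<phi> z \<otimes>\<^bsub>B\<^esub> antipode B (\<phi> w))"
  note closed = \<phi>_closed A.antipode_closed B.antipode_closed
  have tri: "trilinear_form A ?F"
    unfolding trilinear_form_def
    by (auto intro!: bilinear_formI linear_formI simp: closed
        \<phi>_add \<phi>_smult A.antipode_add A.antipode_smult B.antipode_add B.antipode_smult
        B.alg.l_distr B.alg.r_distr B.smult_mult_left B.smult_mult_right A.smult_closed B.smult_closed
        linear_formD[OF f])
  have right_unit: "f (antipode B (\<phi> x)) =
      pairing (\<lambda>(y, z). counit A y * f (antipode B (\<phi> z))) (comult A x)"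
  proof -
    have lin: "linear_form A (\<lambda>z. f (antipode B (\<phi> z)))"
      by (auto intro!: linear_formI simp: closed \<phi>_add \<phi>_smult B.antipode_add B.antipode_smult linear_formD[OF f])
    have "f (antipode B (\<phi> x)) =
        f (antipode B (\<phi> (comb_eval A (\<lambda>(y, z). counit A y \<odot>\<^bsub>A\<^esub> z) (comult A x))))"
      by (simp add: A.counit_left x)
    also have "\<dots> = pairing (\<lambda>yz. f (antipode B (\<phi> (case yz of (y, z) \<Rightarrow> counit A y \<odot>\<^bsub>A\<^esub> z)))) (comult A x)"
      by (rule A.linear_form_comb_eval[OF lin]) (use keys_comult_A[OF x] in \<open>auto intro: A.smult_closed\<close>)
    also have "\<dots> = pairing (\<lambda>(y, z). counit A y * f (antipode B (\<phi> z))) (comult A x)"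
      by (rule pairing_cong) (use keys_comult_A[OF x] linear_formD(2)[OF lin] in auto)
    finally show ?thesis .
  qed
  have left_unit: "f (\<phi> (antipode A x)) =
      pairing (\<lambda>(y, z). counit A z * f (\<phi> (antipode A y))) (comult A x)"
  proof -
    have lin: "linear_form A (\<lambda>y. f (\<phi> (antipode A y)))"
      by (auto intro!: linear_formI simp: closed \<phi>_add \<phi>_smult A.antipode_add A.antipode_smult linear_formD[OF f])
    have "f (\<phi> (antipode A x)) =
        f (\<phi> (antipode A (comb_eval A (\<lambda>(y, z). counit A z \<odot>\<^bsub>A\<^esub> y) (comult A x))))"
      by (simp add: A.counit_right x)
    also have "\<dots> = pairing (\<lambda>yz. f (\<phi> (antipode A (case yz of (y, z) \<Rightarrow> counit A z \<odot>\<^bsub>A\<^esub> y)))) (comult A x)"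
      by (rule A.linear_form_comb_eval[OF lin]) (use keys_comult_A[OF x] in \<open>auto intro: A.smult_closed\<close>)
    also have "\<dots> = pairing (\<lambda>(y, z). counit A z * f (\<phi> (antipode A y))) (comult A x)"
      by (rule pairing_cong) (use keys_comult_A[OF x] linear_formD(2)[OF lin] in auto)
    finally show ?thesis .
  qed
  have inner_left: "pairing (\<lambda>(y1, y2). ?F y1 y2 z) (comult A y) = counit A y * f (antipode B (\<phi> z))"
    if y: "y \<in> carrier A" and z: "z \<in> carrier A" for y z
  proof -
    have lin: "linear_form A (\<lambda>b. f (\<phi> b \<otimes>\<^bsub>B\<^esub> antipode B (\<phi> z)))"
      using z by (auto intro!: linear_formI simp: closed \<phi>_add \<phi>_smult B.alg.l_distr B.smult_mult_left linear_formD[OF f])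
    have "pairing (\<lambda>(y1, y2). ?F y1 y2 z) (comult A y) =
        pairing (\<lambda>yy. f (\<phi> (case yy of (y1, y2) \<Rightarrow> antipode A y1 \<otimes>\<^bsub>A\<^esub> y2) \<otimes>\<^bsub>B\<^esub> antipode B (\<phi> z))) (comult A y)"
      by (rule pairing_cong) (use keys_comult_A[OF y] in \<open>auto simp: \<phi>_mult A.antipode_closed\<close>)
    also have "\<dots> = f (\<phi> (comb_eval A (\<lambda>(y1, y2). antipode A y1 \<otimes>\<^bsub>A\<^esub> y2) (comult A y)) \<otimes>\<^bsub>B\<^esub> antipode B (\<phi> z))"
      by (rule A.linear_form_comb_eval[OF lin, symmetric])
        (use keys_comult_A[OF y] in \<open>auto intro: A.antipode_closed\<close>)
    also have "\<dots> = counit A y * f (antipode B (\<phi> z))"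
      using y z linear_formD(2)[OF lin, of "\<one>\<^bsub>A\<^esub>"] by (simp add: A.antipode_left \<phi>_one closed)
    finally show ?thesis .
  qed
  have inner_right: "pairing (\<lambda>(z1, z2). ?F y z1 z2) (comult A z) = counit A z * f (\<phi> (antipode A y))"
    if y: "y \<in> carrier A" and z: "z \<in> carrier A" for y z
  proof -
    let ?y = "\<phi> (antipode A y)"
    have cy: "?y \<in> carrier B"
      using y by (simp add: closed)
    have bil: "bilinear_form B (\<lambda>b1 b2. f (?y \<otimes>\<^bsub>B\<^esub> b1 \<otimes>\<^bsub>B\<^esub> antipode B b2))"
      using cy by (auto intro!: bilinear_formI linear_formI simp: closed B.antipode_add B.antipode_smult
          B.alg.l_distr B.alg.r_distr B.smult_mult_left B.smult_mult_right linear_formD[OF f])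
    have lin: "linear_form B (\<lambda>b. f (?y \<otimes>\<^bsub>B\<^esub> b))"
      using cy by (auto intro!: linear_formI simp: B.alg.r_distr B.smult_mult_right linear_formD[OF f])
    have "pairing (\<lambda>(z1, z2). ?F y z1 z2) (comult A z) =
        pairing (\<lambda>(b1, b2). f (?y \<otimes>\<^bsub>B\<^esub> b1 \<otimes>\<^bsub>B\<^esub> antipode B b2)) (comult B (\<phi> z))"
      by (rule comult_preservingD[OF comult[OF z] bil, symmetric])
    also have "\<dots> = pairing (\<lambda>bb. f (?y \<otimes>\<^bsub>B\<^esub> (case bb of (b1, b2) \<Rightarrow> b1 \<otimes>\<^bsub>B\<^esub> antipode B b2))) (comult B (\<phi> z))"
      by (rule pairing_cong)
        (use keys_comult_B[OF \<phi>_closed[OF z]] cy in \<open>auto simp: B.alg.m_assoc B.antipode_closed\<close>)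
    also have "\<dots> = f (?y \<otimes>\<^bsub>B\<^esub> comb_eval B (\<lambda>(b1, b2). b1 \<otimes>\<^bsub>B\<^esub> antipode B b2) (comult B (\<phi> z)))"
      by (rule B.linear_form_comb_eval[OF lin, symmetric])
        (use keys_comult_B[OF \<phi>_closed[OF z]] in \<open>auto intro: B.antipode_closed\<close>)
    also have "\<dots> = counit A z * f (\<phi> (antipode A y))"
      using cy z linear_formD(2)[OF lin, of "\<one>\<^bsub>B\<^esub>"] by (simp add: B.antipode_right counit \<phi>_closed)
    finally show ?thesis .
  qed
  have "f (antipode B (\<phi> x)) =
      pairing (\<lambda>(y, z). pairing (\<lambda>(y1, y2). ?F y1 y2 z) (comult A y)) (comult A x)"
    unfolding right_unit by (rule pairing_cong) (use keys_comult_A[OF x] inner_left in auto)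
  also have "\<dots> = pairing (\<lambda>(y, z). pairing (\<lambda>(z1, z2). ?F y z1 z2) (comult A z)) (comult A x)"
    using tensor3_eq_forms[OF A.coassoc[OF x] tri] by (simp add: pairing_lin_ext case_prod_unfold)
  also have "\<dots> = f (\<phi> (antipode A x))"
    unfolding left_unit by (rule pairing_cong) (use keys_comult_A[OF x] inner_right in auto)
  finally show "f (antipode B (\<phi> x)) = f (\<phi> (antipode A x))" .
qed (use x in \<open>auto intro!: \<phi>_closed A.antipode_closed B.antipode_closed\<close>)

lemma isomorphic:
  assumes generator: "\<And>x. x \<in> S \<Longrightarrow> comult_preserving (g x) \<and> counit B (h x) = counit A (g x)"
    and inverse: "\<And>x. x \<notin> S \<Longrightarrow> \<exists>y\<in>S. g y \<otimes>\<^bsub>A\<^esub> g x = \<one>\<^bsub>A\<^esub> \<and> g x \<otimes>\<^bsub>A\<^esub> g y = \<one>\<^bsub>A\<^esub>"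
  shows "A \<simeq>\<^sub>H B"
proof -
  have g: "g x \<in> carrier A" for x
    using gens_A by blast
  have gens: "comult_preserving (g x) \<and> counit B (\<phi> (g x)) = counit A (g x)" for x
  proof (cases "x \<in> S")
    case True
    then show ?thesis
      using generator by (simp add: \<phi>_gen)
  next
    case False
    then obtain y where y: "y \<in> S" and inv: "g y \<otimes>\<^bsub>A\<^esub> g x = \<one>\<^bsub>A\<^esub>" "g x \<otimes>\<^bsub>A\<^esub> g y = \<one>\<^bsub>A\<^esub>"
      using inverse by blast
    have "counit A (g y) * counit A (g x) = 1"
      using A.counit_mult[OF g g, of y x] by (simp add: inv A.counit_one)
    moreover have "counit B (\<phi> (g y)) * counit B (\<phi> (g x)) = 1"
      using B.counit_mult[OF \<phi>_closed[OF g] \<phi>_closed[OF g], of y x]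
      by (simp add: inv B.counit_one \<phi>_one flip: \<phi>_mult[OF g g])
    moreover have "counit B (\<phi> (g y)) = counit A (g y)"
      using generator[OF y] by (simp add: \<phi>_gen)
    ultimately have "counit B (\<phi> (g x)) = counit A (g x)"
      by (metis inverse_unique)
    then show ?thesis
      using comult_preserving_inverse[OF g g inv] generator[OF y] by blast
  qed
  have "comult_preserving x \<and> counit B (\<phi> x) = counit A x" if "x \<in> carrier A" for x
    using that
  proof (rule A.generated_induct[OF gens_A generated_A])
    show "comult_preserving (x \<oplus>\<^bsub>A\<^esub> y) \<and> counit B (\<phi> (x \<oplus>\<^bsub>A\<^esub> y)) = counit A (x \<oplus>\<^bsub>A\<^esub> y)"
      if "x \<in> carrier A" "y \<in> carrier A" "comult_preserving x \<and> counit B (\<phi> x) = counit A x"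
        "comult_preserving y \<and> counit B (\<phi> y) = counit A y" for x y
      using that comult_preserving_add by (simp add: \<phi>_add \<phi>_closed A.counit_add B.counit_add)
    show "comult_preserving (x \<otimes>\<^bsub>A\<^esub> y) \<and> counit B (\<phi> (x \<otimes>\<^bsub>A\<^esub> y)) = counit A (x \<otimes>\<^bsub>A\<^esub> y)"
      if "x \<in> carrier A" "y \<in> carrier A" "comult_preserving x \<and> counit B (\<phi> x) = counit A x"
        "comult_preserving y \<and> counit B (\<phi> y) = counit A y" for x y
      using that comult_preserving_mult by (simp add: \<phi>_mult \<phi>_closed A.counit_mult B.counit_mult)
    show "comult_preserving (c \<odot>\<^bsub>A\<^esub> x) \<and> counit B (\<phi> (c \<odot>\<^bsub>A\<^esub> x)) = counit A (c \<odot>\<^bsub>A\<^esub> x)"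
      if "x \<in> carrier A" "comult_preserving x \<and> counit B (\<phi> x) = counit A x" for c x
      using that comult_preserving_smult by (simp add: \<phi>_smult \<phi>_closed A.counit_smult B.counit_smult)
  qed (use gens comult_preserving_one in \<open>auto simp: \<phi>_one A.counit_one B.counit_one\<close>)
  then have comult: "comult_preserving x" and counit: "counit B (\<phi> x) = counit A x"
    if "x \<in> carrier A" for x
    using that by blast+
  have "bigraded_hopf_iso A B \<phi>"
    unfolding bigraded_hopf_iso_def
  proof (intro conjI allI ballI)
    show "bigraded_hopf_algebra A" "bigraded_hopf_algebra B"
      by (rule A.bigraded_hopf_algebra_axioms B.bigraded_hopf_algebra_axioms)+
    show "\<phi> \<in> ring_hom A B"
      by (rule ring_hom_memI) (simp_all add: \<phi>_closed \<phi>_add \<phi>_mult \<phi>_one)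
    show "tensor_eq B (comult B (\<phi> x)) (lin_ext (\<lambda>(y, z). pure (\<phi> y, \<phi> z)) (comult A x))"
      if "x \<in> carrier A" for x
      using comult[OF that]
      by (simp add: comult_preserving_def tensor_eq_forms pairing_lin_ext case_prod_unfold)
  qed (simp_all add: \<phi>_bij \<phi>_smult counit \<phi>_component antipode_preserved[OF comult counit])
  then show ?thesis
    by (auto simp: bigraded_hopf_isomorphic_def)
qed

end

section \<open>The two-parameter quantum group as a deformation\<close>

context qgroup_twist
begin

lemma qgroup_twist_inverse: "qgroup_twist a d r' s' r s (\<lambda>\<alpha> \<beta>. inverse (\<zeta> \<alpha> \<beta>))"
proof
  show "skew_bicharacter (\<lambda>\<alpha> \<beta>. inverse (\<zeta> \<alpha> \<beta>))"
    unfolding skew_bicharacter_def bicharacter_def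
  proof (intro conjI allI)
    fix \<alpha> \<alpha>' \<beta>
    have "\<zeta> \<alpha> \<alpha> = 1" "\<zeta> \<alpha> \<beta> = inverse (\<zeta> \<beta> \<alpha>)"
      using skew unfolding skew_bicharacter_def by blast+
    then show "inverse (\<zeta> \<alpha> \<alpha>) = 1" "inverse (\<zeta> \<alpha> \<beta>) = inverse (inverse (\<zeta> \<beta> \<alpha>))"
      by simp_all
  qed (use bichar in \<open>simp_all add: bicharacter_def\<close>)
  show "r powi euler a d j i * s powi (- euler a d i j) =
      (inverse (root i j))\<^sup>2 * (r' powi euler a d j i * s' powi (- euler a d i j))" for i j
    unfolding square using root_nonzero by (simp add: power_inverse)
qed (use cartan_diag symmetrized nonzero same_ratio distinct in simp_all)

interpretation inv: qgroup_twist a d r' s' r s "\<lambda>\<alpha> \<beta>. inverse (\<zeta> \<alpha> \<beta>)"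
  by (rule qgroup_twist_inverse)

lemma coeff_twist_inverse:
  "inv.coeff_twist w * coeff_twist w = 1" "coeff_twist w * inv.coeff_twist w = 1"
proof -
  have "inv.qtwist = (\<lambda>x y. inverse (qtwist x y))"
    by (intro ext) (simp add: twist_def)
  moreover have "inv.scaling = (\<lambda>x. inverse (scaling x))"
    by (rule ext) (simp add: scaling_def inv.scaling_def split: qgen.split)
  ultimately show "inv.coeff_twist w * coeff_twist w = 1"
    using list_twist_inverse[of qtwist scaling "letters w"]
    by (simp add: twist_nonzero[OF bichar] scaling_nonzero)
  then show "coeff_twist w * inv.coeff_twist w = 1"
    by (simp add: mult.commute)
qed

text \<open>One implication is \<open>ideal_twist\<close>; the other one is the same lemma for the interchanged parameters,
  because the two rescalings are inverse to each other.\<close>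

lemma kernel_twist:
  assumes U: "is_qgroup a d r s U g" and V: "is_qgroup a d r' s' V h"
  shows "free_eval V h t = \<zero>\<^bsub>V\<^esub> \<longleftrightarrow> free_eval U g (rescale coeff_twist t) = \<zero>\<^bsub>U\<^esub>"
proof
  have ker_U: "{t. free_eval U g t = \<zero>\<^bsub>U\<^esub>} =
      Idl\<^bsub>ring_of_type_algebra\<^esub> {t - u | t u. (t, u) \<in> qgroup_relations a d r s}"
    and ker_V: "{t. free_eval V h t = \<zero>\<^bsub>V\<^esub>} =
      Idl\<^bsub>ring_of_type_algebra\<^esub> {t - u | t u. (t, u) \<in> qgroup_relations a d r' s'}"
    using U V by (auto simp: is_qgroup_def presented_by_def)
  show "free_eval U g (rescale coeff_twist t) = \<zero>\<^bsub>U\<^esub>" if "free_eval V h t = \<zero>\<^bsub>V\<^esub>"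
    using that ker_V by (intro ideal_twist[OF U]) blast
  assume "free_eval U g (rescale coeff_twist t) = \<zero>\<^bsub>U\<^esub>"
  then have "free_eval V h (rescale inv.coeff_twist (rescale coeff_twist t)) = \<zero>\<^bsub>V\<^esub>"
    using ker_U by (intro inv.ideal_twist[OF V]) blast
  then show "free_eval V h t = \<zero>\<^bsub>V\<^esub>"
    by (simp add: rescale_rescale coeff_twist_inverse)
qed

theorem deform_isomorphic:
  assumes U: "is_qgroup a d r s U g" and V: "is_qgroup a d r' s' V h"
  shows "deform U \<zeta> \<simeq>\<^sub>H V"
proof -
  interpret U: bigraded_hopf_algebra U
    using U by (simp add: is_qgroup_def)
  interpret V: bigraded_hopf_algebra V
    using V by (simp add: is_qgroup_def)
  interpret U: twisted_hopf U \<zeta>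
    by unfold_locales (rule skew)
  interpret D: bigraded_hopf_algebra "deform U \<zeta>"
    by (rule U.bigraded_hopf_algebra_deform)
  let ?G = "\<lambda>x. scaling x \<odot>\<^bsub>U\<^esub> g x"
  note degU = qgroup_degree[OF U]
  have gU: "g x \<in> carrier U" for x
    using U.component_closed[OF degU] .
  have eval: "free_eval (deform U \<zeta>) ?G t = free_eval U g (rescale coeff_twist t)" for t
    by (rule U.free_eval_deform[OF degU])
  interpret common_presentation "deform U \<zeta>" V ?G h qdegree
  proof
    show "?G x \<in> component (deform U \<zeta>) (qdegree x)" for x
      using degU by (simp add: U.component_smult)
    show "h x \<in> component V (qdegree x)" for x
      by (rule qgroup_degree[OF V])
    have untwist: "free_eval U g t = free_eval (deform U \<zeta>) ?G (rescale inv.coeff_twist t)" for t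
      unfolding eval by (simp add: rescale_rescale coeff_twist_inverse)
    have "range (free_eval (deform U \<zeta>) ?G) \<subseteq> range (free_eval U g)"
      unfolding eval by blast
    moreover have "range (free_eval U g) \<subseteq> range (free_eval (deform U \<zeta>) ?G)"
      unfolding untwist by blast
    ultimately show "range (free_eval (deform U \<zeta>) ?G) = carrier (deform U \<zeta>)"
      using U by (simp add: is_qgroup_def presented_by_def)
    show "range (free_eval V h) = carrier V"
      using V by (simp add: is_qgroup_def presented_by_def)
    show "free_eval (deform U \<zeta>) ?G t = \<zero>\<^bsub>deform U \<zeta>\<^esub> \<longleftrightarrow> free_eval V h t = \<zero>\<^bsub>V\<^esub>" for t
      using kernel_twist[OF U V] by (simp add: eval)
  qed
  note evals = D.free_eval_gen[OF gens_A] D.free_eval_one[OF gens_A]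
    V.free_eval_gen[OF gens_B] V.free_eval_one[OF gens_B]
  show ?thesis
  proof (rule isomorphic[where S = "- (range OmI \<union> range OmI')"])
    fix x :: "'i qgen" assume "x \<in> - (range OmI \<union> range OmI')"
    then consider i where "x = E i" | i where "x = F i" | i where "x = Om i" | i where "x = Om' i"
      by (cases x) auto
    then show "comult_preserving (?G x) \<and> counit V (h x) = counit (deform U \<zeta>) (?G x)"
    proof cases
      case (1 i)
      have "comult_preserving (?G (E i))"
        by (rule comult_preserving_generator[where T = "pure (gen (E i), 1) + pure (gen (Om i), gen (E i))"])
          (use U V in \<open>simp_all add: is_qgroup_def tensor_eq_forms pairing_lin_ext pairing_add evals
            scaling_simps U.smult_1 gU\<close>)
      then show ?thesis
        using U V by (simp add: 1 is_qgroup_def scaling_simps U.smult_1 gU)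
    next
      case (2 i)
      have "pairing (\<lambda>(u, v). f u v) (comult U (?G (F i))) = f \<one>\<^bsub>U\<^esub> (?G (F i)) + f (?G (F i)) (g (Om' i))"
        if f: "bilinear_form U f" for f
        using U f
        by (simp add: is_qgroup_def tensor_eq_forms pairing_add distrib_left gU
            linear_formD(2)[OF U.linear_form_comult[OF f] gU]
            linear_formD(2)[OF bilinear_formD(1)[OF f]] linear_formD(2)[OF bilinear_formD(2)[OF f]])
      then have "comult_preserving (?G (F i))"
        by (intro comult_preserving_generator[where T = "pure (1, gen (F i)) + pure (gen (F i), gen (Om' i))"])
          (use V in \<open>simp_all add: is_qgroup_def tensor_eq_forms pairing_lin_ext pairing_add evals
            scaling_simps(3) U.smult_1 gU\<close>)
      then show ?thesis
        using U V by (simp add: 2 is_qgroup_def U.counit_smult gU)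
    next
      case (3 i)
      have "comult_preserving (?G (Om i))"
        by (rule comult_preserving_generator[where T = "pure (gen (Om i), gen (Om i))"])
          (use U V in \<open>simp_all add: is_qgroup_def tensor_eq_forms pairing_lin_ext evals
            scaling_simps U.smult_1 gU\<close>)
      then show ?thesis
        using U V by (simp add: 3 is_qgroup_def scaling_simps U.smult_1 gU)
    next
      case (4 i)
      have "comult_preserving (?G (Om' i))"
        by (rule comult_preserving_generator[where T = "pure (gen (Om' i), gen (Om' i))"])
          (use U V in \<open>simp_all add: is_qgroup_def tensor_eq_forms pairing_lin_ext evals
            scaling_simps U.smult_1 gU\<close>)
      then show ?thesis
        using U V by (simp add: 4 is_qgroup_def scaling_simps U.smult_1 gU)
    qed
  next
    fix x :: "'i qgen" assume "x \<notin> - (range OmI \<union> range OmI')"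
    then consider i where "x = OmI i" | i where "x = OmI' i"
      by auto
    then show "\<exists>y\<in>- (range OmI \<union> range OmI').
        ?G y \<otimes>\<^bsub>deform U \<zeta>\<^esub> ?G x = \<one>\<^bsub>deform U \<zeta>\<^esub> \<and> ?G x \<otimes>\<^bsub>deform U \<zeta>\<^esub> ?G y = \<one>\<^bsub>deform U \<zeta>\<^esub>"
    proof cases
      case (1 i)
      have "?G (Om i) \<otimes>\<^bsub>deform U \<zeta>\<^esub> ?G x = \<one>\<^bsub>deform U \<zeta>\<^esub> \<and> ?G x \<otimes>\<^bsub>deform U \<zeta>\<^esub> ?G (Om i) = \<one>\<^bsub>deform U \<zeta>\<^esub>"
        by (simp add: 1 scaling_simps U.smult_1 gU U.deformed_mult_homogeneous[OF degU degU]
            qtwist_cartan qgroup_inverses[OF U])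
      then show ?thesis
        by blast
    next
      case (2 i)
      have "?G (Om' i) \<otimes>\<^bsub>deform U \<zeta>\<^esub> ?G x = \<one>\<^bsub>deform U \<zeta>\<^esub> \<and> ?G x \<otimes>\<^bsub>deform U \<zeta>\<^esub> ?G (Om' i) = \<one>\<^bsub>deform U \<zeta>\<^esub>"
        by (simp add: 2 scaling_simps U.smult_1 gU U.deformed_mult_homogeneous[OF degU degU]
            qtwist_cartan qgroup_inverses[OF U])
      then show ?thesis
        by blast
    qed
  qed
qed

end

text \<open>For a fixed second argument the quantity $\zeta(\alpha,\beta)\zeta(\beta,\alpha)$ is
  multiplicative in $\alpha$, so it is $1$ as soon as it is $1$ on simple roots.  Then
  $\zeta(\alpha,\alpha)$ is multiplicative, too.\<close>

lemma skew_bicharacter_if_on_simple_roots: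
  fixes \<zeta> :: "'i root_lattice \<Rightarrow> 'i root_lattice \<Rightarrow> 'k::field"
  assumes bichar: "bicharacter \<zeta>"
    and diag: "\<And>i. \<zeta> (simple_root i) (simple_root i) = 1"
    and skew: "\<And>i j. \<zeta> (simple_root i) (simple_root j) * \<zeta> (simple_root j) (simple_root i) = 1"
  shows "skew_bicharacter \<zeta>"
proof -
  have add: "\<zeta> (\<alpha> - \<alpha>') \<beta> = \<zeta> \<alpha> \<beta> / \<zeta> \<alpha>' \<beta>" "\<zeta> \<alpha> (\<beta> - \<beta>') = \<zeta> \<alpha> \<beta> / \<zeta> \<alpha> \<beta>'" for \<alpha> \<alpha>' \<beta> \<beta>'
  proof -
    have "\<zeta> (\<alpha> + - \<alpha>') \<beta> = \<zeta> \<alpha> \<beta> * \<zeta> (- \<alpha>') \<beta>" "\<zeta> \<alpha> (\<beta> + - \<beta>') = \<zeta> \<alpha> \<beta> * \<zeta> \<alpha> (- \<beta>')"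
      using bichar unfolding bicharacter_def by blast+
    then show "\<zeta> (\<alpha> - \<alpha>') \<beta> = \<zeta> \<alpha> \<beta> / \<zeta> \<alpha>' \<beta>" "\<zeta> \<alpha> (\<beta> - \<beta>') = \<zeta> \<alpha> \<beta> / \<zeta> \<alpha> \<beta>'"
      by (simp_all add: bicharacter_uminus[OF bichar] divide_inverse)
  qed
  have nz: "\<zeta> \<alpha> \<beta> \<noteq> 0" for \<alpha> \<beta>
    using bichar by (simp add: bicharacter_def)
  have one: "\<zeta> \<alpha> (simple_root j) * \<zeta> (simple_root j) \<alpha> = 1" for \<alpha> j
    by (induction \<alpha> rule: frag_induction[OF subset_UNIV])
      (auto simp: bicharacter_zero[OF bichar] skew add nz field_simps)
  have prod: "\<zeta> \<alpha> \<beta> * \<zeta> \<beta> \<alpha> = 1" for \<alpha> \<beta>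
    by (induction \<beta> rule: frag_induction[OF subset_UNIV])
      (auto simp: bicharacter_zero[OF bichar] one add nz field_simps)
  have "\<zeta> \<alpha> \<alpha> = 1" for \<alpha>
  proof (induction \<alpha> rule: frag_induction[OF subset_UNIV])
    case (3 \<alpha> \<beta>)
    then show ?case
      using prod[of \<alpha> \<beta>] nz by (simp add: add field_simps)
  qed (auto simp: bicharacter_zero[OF bichar] diag)
  moreover have "\<zeta> \<alpha> \<beta> = inverse (\<zeta> \<beta> \<alpha>)" for \<alpha> \<beta>
    using prod[of \<beta> \<alpha>] by (simp add: inverse_unique)
  ultimately show ?thesis
    using bichar unfolding skew_bicharacter_def by blast
qed

lemma alg_independent_nonzero:
  assumes "alg_independent_over_rat r s"
  shows "r \<noteq> 0" "s \<noteq> 0"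
proof -
  show "r \<noteq> 0"
    \<comment> \<open>The polynomial that is evaluated to \<open>r\<close>; the next one is evaluated to \<open>s\<close>.\<close>
    using assms[unfolded alg_independent_over_rat_def, rule_format, of "[:[:0, 1:]:]"]
    by (auto simp: map_poly_pCons)
  show "s \<noteq> 0"
    using assms[unfolded alg_independent_over_rat_def, rule_format, of "[:0, 1:]"]
    by (auto simp: map_poly_pCons)
qed

theorem proposition34:
  fixes a :: "'i::{finite,linorder} \<Rightarrow> 'i \<Rightarrow> int"
    and d :: "'i \<Rightarrow> nat"
    and r s q :: "'k::field_char_0"
    and p sqrt_p :: "'i \<Rightarrow> 'i \<Rightarrow> 'k"
    and \<zeta> :: "'i root_lattice \<Rightarrow> 'i root_lattice \<Rightarrow> 'k"
    and U\<^sub>q :: "('k, 'u, 'i root_lattice) bihopf"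
    and U\<^sub>r\<^sub>s :: "('k, 'v, 'i root_lattice) bihopf"
    and g :: "'i qgen \<Rightarrow> 'u"
    and h :: "'i qgen \<Rightarrow> 'v"
  assumes "simple_cartan_matrix a"
    and "symmetrizer a d"
    and "alg_independent_over_rat r s"
    and "\<exists>t. t ^ weight_exponent a = r * inverse s"
    and "\<forall>k>0. (r * inverse s) ^ k \<noteq> 1"
    and "is_qgroup a d q (inverse q) U\<^sub>q g"
    and "is_qgroup a d r s U\<^sub>r\<^sub>s h"
    and "\<forall>i. r ^ d i * inverse (s ^ d i) = q ^ (2 * d i)"
    and "\<forall>i j. p i j = r powi (euler a d j i) * s powi (- euler a d i j)
                        * q powi (- (int (d i) * a i j))"
    and "\<forall>i j. (sqrt_p i j)\<^sup>2 = p i j"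
    and "\<forall>i. sqrt_p i i = 1"
    and "\<forall>i j. sqrt_p i j * sqrt_p j i = 1"
    and "bicharacter \<zeta>"
    and "\<forall>i j. \<zeta> (simple_root i) (simple_root j) = sqrt_p i j"
  shows "skew_bicharacter \<zeta> \<and> deform U\<^sub>q \<zeta> \<simeq>\<^sub>H U\<^sub>r\<^sub>s"
proof -
  note r_s = alg_independent_nonzero[OF assms(3)]
  have d: "d i > 0" and sym: "int (d i) * a i j = int (d j) * a j i" for i j
    using assms(2) by (auto simp: symmetrizer_def)
  have diag: "a i i = 2" for i
    using assms(1) by (simp add: simple_cartan_matrix_def)
  have ratio: "r ^ d i / s ^ d i = q ^ (2 * d i)" for i
    using assms(8) by (simp add: divide_inverse)
  have q: "q \<noteq> 0"
  proof
    assume "q = 0"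
    then show False
      using ratio[of undefined] d[of undefined] r_s by (simp add: zero_power)
  qed
  have not_one: "r ^ d i / s ^ d i \<noteq> 1" for i
    using assms(5) d[of i] by (simp add: divide_inverse power_mult_distrib power_inverse)
  have skew: "skew_bicharacter \<zeta>"
    using assms(11-14) by (intro skew_bicharacter_if_on_simple_roots) simp_all
  have "qgroup_twist a d q (inverse q) r s \<zeta>"
  proof
    show "r ^ d i / s ^ d i = q ^ d i / inverse q ^ d i" for i
      unfolding ratio by (simp add: power_inverse divide_inverse mult_2 power_add)
    show "r ^ d i \<noteq> s ^ d i" for i
      using not_one[of i] r_s by auto
    show "q ^ d i \<noteq> inverse q ^ d i" for i
    proof
      assume "q ^ d i = inverse q ^ d i"
      then have "q ^ d i * q ^ d i = 1"
        using q by (simp add: power_inverse field_simps)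
      then show False
        using not_one[of i] by (simp add: ratio mult_2 power_add)
    qed
    show "r powi euler a d j i * s powi (- euler a d i j) =
        (\<zeta> (simple_root i) (simple_root j))\<^sup>2 *
        (q powi euler a d j i * inverse q powi (- euler a d i j))" for i j
    proof -
      have "q powi euler a d j i * inverse q powi (- euler a d i j) = q powi (euler a d i j + euler a d j i)"
        using q by (simp add: power_int_add power_int_minus power_int_inverse mult.commute)
      also have "\<dots> = q powi (int (d i) * a i j)"
        by (simp add: euler_sum[of a i d j, OF diag sym])
      finally show ?thesis
        using assms(9,10,14) q by (simp add: power_int_minus)
    qed
  qed (use diag sym r_s q skew in simp_all)
  then show ?thesis
    using qgroup_twist.deform_isomorphic[OF _ assms(6,7)] skew by blast
qed

end
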